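(* There exist a constant $c>0$ such that for all sufficiently large $n$ there are an integer $q\le n^5$ and a distribution $\mu$ on $[q]^n$ for which the parallel sampler instantiated with $\mathrm{UC}=\mathrm{MinCoupler}$ and run on $\mu$ uses at least $c\,n^{2/3}/\log n$ rounds with probability at least $0.99$.
   Context: $\mu$ is a distribution on $[q]^n$, $X\sim\mu$, and $(X_i\mid X_S=\tau)$ is the conditional law of $X_i$ given $X_S=\tau$ (an arbitrary fixed distribution if the event has probability $0$). $\mathrm{MinCoupler}(\nu,r)$, for $\nu$ a distribution on $[q]$ and a seed $r$ consisting of i.i.d. pairs $(x_k,p_k)$ with $x_k$ uniform on $[q]$ and $p_k$ uniform on $[0,1]$, outputs $x_{i^*}$ with $i^*=\min\{k:p_k\le\nu(x_k)\}$. The parallel sampler with universal coupler $\mathrm{UC}$: draw a uniformly random permutation $\sigma$ of $[n]$ and i.i.d. seeds $u_1,\dots,u_n$; set $a\leftarrow0$, $t\leftarrow0$, $x^0$ arbitrary. Repeat (one round each): $t\leftarrow t+1$; for every $i\in[n]$ set $y^t_{\sigma(i)}=\mathrm{UC}\big((X_{\sigma(i)}\mid X_{\sigma(j)}=x^{t-1}_{\sigma(j)}\ \forall j\in[a]),u_i\big)$; then for every $i\in[n]$ set $x^t_{\sigma(i)}=\mathrm{UC}\big((X_{\sigma(i)}\mid X_{\sigma(j)}=y^t_{\sigma(j)}\ \forall j\in[i-1]),u_i\big)$. If $x^t=y^t$, output $x^t$ and stop. Otherwise set $a\leftarrow\min\{i:y^t_{\sigma(i)}\ne x^t_{\sigma(i)}\}$,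 and if $a=n$ output $x^t$ and stop. The number of rounds is the final value of $t$. *)

theory Defs
  imports "HOL-Probability.Probability"
begin

text \<open>Conventions: [q] is rendered as {0..<q}; coordinates are 0-indexed, so [q]^n is the set of
  lists of length n with entries below q. Configurations are functions nat => nat (only the
  coordinates below n matter).\<close>

definition cube :: "nat \<Rightarrow> nat \<Rightarrow> nat list set" where
  "cube q n = {xs. length xs = n \<and> set xs \<subseteq> {..<q}}"

definition is_dist_on :: "nat \<Rightarrow> (nat \<Rightarrow> real) \<Rightarrow> bool" where
  "is_dist_on q \<nu> \<longleftrightarrow> (\<forall>v. 0 \<le> \<nu> v) \<and> (\<forall>v. q \<le> v \<longrightarrow> \<nu> v = 0) \<and> (\<Sum>v<q. \<nu> v) = 1"

definition cond_law :: "nat list pmf \<Rightarrow> (nat \<Rightarrow> real) \<Rightarrow> nat \<Rightarrow> nat set \<Rightarrow> (nat \<Rightarrow> nat) \<Rightarrow> nat \<Rightarrow> real" where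
  "cond_law \<mu> dflt i S \<tau> v =
     (let Z = measure_pmf.prob \<mu> {xs. \<forall>j\<in>S. xs ! j = \<tau> j}
      in if Z = 0 then dflt v
         else measure_pmf.prob \<mu> {xs. xs ! i = v \<and> (\<forall>j\<in>S. xs ! j = \<tau> j)} / Z)"

text \<open>MinCoupler: the seed r k = (x_k, p_k); output x_{i*} with i* = min {k. p_k <= nu(x_k)}
  (0 on the null event that no such k exists).\<close>
definition min_coupler :: "(nat \<Rightarrow> real) \<Rightarrow> (nat \<Rightarrow> nat \<times> real) \<Rightarrow> nat" where
  "min_coupler \<nu> r =
     (if \<exists>k. snd (r k) \<le> \<nu> (fst (r k))
      then fst (r (LEAST k. snd (r k) \<le> \<nu> (fst (r k)))) else 0)"

text \<open>One round of the parallel sampler. sigma permutes {..<n}; u i is the seed of position i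
  (paper's u_{i+1}); a is the number of conditioned positions; x is x^{t-1}.
  Returns (y^t, x^t).\<close>
definition sampler_round ::
  "nat list pmf \<Rightarrow> (nat \<Rightarrow> real) \<Rightarrow> nat \<Rightarrow> (nat \<Rightarrow> nat) \<Rightarrow> (nat \<Rightarrow> nat \<Rightarrow> nat \<times> real)
     \<Rightarrow> nat \<Rightarrow> (nat \<Rightarrow> nat) \<Rightarrow> (nat \<Rightarrow> nat) \<times> (nat \<Rightarrow> nat)" where
  "sampler_round \<mu> dflt n \<sigma> u a x =
     (let pos = the_inv_into {..<n} \<sigma>;
          y = (\<lambda>c. min_coupler (cond_law \<mu> dflt c (\<sigma> ` {..<a}) x) (u (pos c)));
          x' = (\<lambda>c. min_coupler (cond_law \<mu> dflt c (\<sigma> ` {..<pos c}) y) (u (pos c)))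
      in (y, x'))"

text \<open>State (a, x^t) after t rounds (evolving formally also after the sampler has stopped;
  the initial x^0 is irrelevant since a = 0 initially).\<close>
fun sampler_state ::
  "nat list pmf \<Rightarrow> (nat \<Rightarrow> real) \<Rightarrow> nat \<Rightarrow> (nat \<Rightarrow> nat) \<Rightarrow> (nat \<Rightarrow> nat \<Rightarrow> nat \<times> real)
     \<Rightarrow> nat \<Rightarrow> nat \<times> (nat \<Rightarrow> nat)" where
  "sampler_state \<mu> dflt n \<sigma> u 0 = (0, (\<lambda>_. 0))"
| "sampler_state \<mu> dflt n \<sigma> u (Suc t) =
     (let (a, x) = sampler_state \<mu> dflt n \<sigma> u t;
          (y, x') = sampler_round \<mu> dflt n \<sigma> u a x
      in (Suc (LEAST i. y (\<sigma> i) \<noteq> x' (\<sigma> i)), x'))"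

definition sampler_stops_at ::
  "nat list pmf \<Rightarrow> (nat \<Rightarrow> real) \<Rightarrow> nat \<Rightarrow> (nat \<Rightarrow> nat) \<Rightarrow> (nat \<Rightarrow> nat \<Rightarrow> nat \<times> real) \<Rightarrow> nat \<Rightarrow> bool" where
  "sampler_stops_at \<mu> dflt n \<sigma> u t \<longleftrightarrow>
     1 \<le> t \<and>
     (let (a, x) = sampler_state \<mu> dflt n \<sigma> u (t - 1);
          (y, x') = sampler_round \<mu> dflt n \<sigma> u a x
      in (\<forall>c<n. x' c = y c) \<or> Suc (LEAST i. y (\<sigma> i) \<noteq> x' (\<sigma> i)) = n)"

definition sampler_rounds_at_least ::
  "nat list pmf \<Rightarrow> (nat \<Rightarrow> real) \<Rightarrow> nat \<Rightarrow> (nat \<Rightarrow> nat) \<Rightarrow> (nat \<Rightarrow> nat \<Rightarrow> nat \<times> real) \<Rightarrow> real \<Rightarrow> bool" where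
  "sampler_rounds_at_least \<mu> dflt n \<sigma> u K \<longleftrightarrow>
     (\<forall>t. real t < K \<longrightarrow> \<not> sampler_stops_at \<mu> dflt n \<sigma> u t)"

definition seed_space :: "nat \<Rightarrow> (nat \<Rightarrow> nat \<times> real) measure" where
  "seed_space q = PiM UNIV (\<lambda>_. uniform_count_measure {..<q} \<Otimes>\<^sub>M uniform_measure lborel {0..1::real})"

definition sampler_space :: "nat \<Rightarrow> nat \<Rightarrow> ((nat \<Rightarrow> nat) \<times> (nat \<Rightarrow> nat \<Rightarrow> nat \<times> real)) measure" where
  "sampler_space n q =
     uniform_count_measure {\<sigma>. \<sigma> permutes {..<n}} \<Otimes>\<^sub>M PiM {..<n} (\<lambda>_. seed_space q)"

end

(*
  Some coordinates ("revealers") are uniform on [q]; every other coordinate (a "tester") is joined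
  to about n^(2/3) revealers, and given their values x_k it takes the value v with probability
  proportional to the product of 1 + eps g(x_k, v), where eps is of order n^(-1/3) and g is a
  +-1 Hadamard-type matrix. Bessel's inequality for g shows that, given almost any partial
  information, the correlation E[g(x_k, X_c)] between a tester and its neighbour k is at least
  eps/2 if x_k has been revealed and at most eps/4 if it has not. Hence revealing a single
  neighbour shifts the law of a tester by eps/8 in total variation.

  A round that starts with the first a positions fixed stops at the first position i for which the coupler,
  run with the seed of i on the law given the first a coordinates, disagrees with the final output.
  A window of order n^(1/3) log n positions of a random order reveals a neighbour of every tester
  and then contains order n^(1/3) log n testers, each of which disagrees with conditional probability
  at least eps/8. So with high probability every round advances by at most one window.
*)
theory Submission
  imports Defs "HOL-Real_Asymp.Real_Asymp"
begin

section \<open>Hadamard matrices and sums over configurations\<close>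

text \<open>The exponent is a balance. Let s be the number of neighbours of a tester and m the
  window length. The second moment bounds need s * eps^2 bounded. A window must meet every
  neighbourhood, so m is about (n / s) log n, and must hold about (1 / eps) log n testers. With s of
  order eps^(-2) these agree at eps of order n^(-1/3), and n / m is of order n^(2/3) / log n. Two
  obstacles shape the rest. The start a of a round depends on the seeds; it is handled by a union
  bound over all fixed a up to n / 2, with mismatches measured against the final output, one
  configuration common to all a. And revealed testers carry information about hidden revealers: a
  revealer occurs in at most T testers, each worth chi-square information of order eps^2, so T *
  eps^2 bounded keeps its posterior comparable to uniform. The Bessel estimates leave exceptional
  sets of probability of order 1 / (eps * sqrt q) for each start and each tester in its window.
  Summed over about n * n^(1/3) log n such pairs they are absorbed by q of order n^4.\<close>

primrec sylvester :: "nat \<Rightarrow> nat \<Rightarrow> nat \<Rightarrow> real" where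
  "sylvester 0 x z = 1"
| "sylvester (Suc d) x z =
     (if odd x \<and> odd z then - 1 else 1) * sylvester d (x div 2) (z div 2)"

lemma sum_lessThan_double:
  fixes F :: "nat \<Rightarrow> 'a::comm_monoid_add"
  shows "(\<Sum>v<2 * N. F v) = (\<Sum>u<N. F (2 * u) + F (2 * u + 1))"
  by (induction N) (simp_all add: add.assoc)

text \<open>The matrix for \<open>Suc d\<close> is the Kronecker product of the one for
  \<open>d\<close> with the 2 x 2 Hadamard matrix, acting on the lowest bit. Summing over that bit
  of y yields \<open>1 + s v * s v'\<close>, which vanishes when the parities differ.\<close>

lemma sylvester_orthogonal:
  "v < 2 ^ d \<Longrightarrow> v' < 2 ^ d \<Longrightarrow>
   (\<Sum>y<2 ^ d. sylvester d y v * sylvester d y v') = (if v = v' then 2 ^ d else 0)"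
proof (induction d arbitrary: v v')
  case (Suc d)
  have lt: "v div 2 < 2 ^ d" "v' div 2 < 2 ^ d"
    using Suc.prems by auto
  have eq: "v = v' \<longleftrightarrow> v div 2 = v' div 2 \<and> (odd v \<longleftrightarrow> odd v')"
    by (metis dvd_mult_div_cancel odd_two_times_div_two_succ)
  define s where "s = (\<lambda>v::nat. if odd v then - 1 else 1 :: real)"
  have "(\<Sum>y<2 ^ Suc d. sylvester (Suc d) y v * sylvester (Suc d) y v')
      = (\<Sum>u<2 ^ d. (1 + s v * s v') * (sylvester d u (v div 2) * sylvester d u (v' div 2)))"
    unfolding power_Suc sum_lessThan_double
    by (rule sum.cong) (auto simp: s_def algebra_simps)
  also have "\<dots> = (1 + s v * s v') * (if v div 2 = v' div 2 then 2 ^ d else 0)"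
    by (simp only: sum_distrib_left[symmetric] Suc.IH[OF lt])
  also have "\<dots> = (if v = v' then 2 ^ Suc d else 0)"
    unfolding eq by (auto simp: s_def)
  finally show ?case .
qed simp

text \<open>Kronecker product of a Sylvester matrix with the block with rows (1, -1) and (-1, 1). A
  Sylvester matrix has a constant row and a constant column; the block makes all row and column sums
  zero, at the price of halving the rank.\<close>

definition signed_sylvester :: "nat \<Rightarrow> nat \<Rightarrow> nat \<Rightarrow> real" where
  "signed_sylvester d y v = (-1) ^ y * (-1) ^ v * sylvester d (y div 2) (v div 2)"

lemma abs_sylvester: "\<bar>sylvester d y v\<bar> = 1"
  by (induction d arbitrary: y v) auto

lemma abs_signed_sylvester: "\<bar>signed_sylvester d y v\<bar> = 1"
  by (simp add: signed_sylvester_def abs_mult abs_sylvester power_abs)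

lemma signed_sylvester_row: "(\<Sum>v<2 * N. signed_sylvester d y v) = 0"
  unfolding sum_lessThan_double by (simp add: signed_sylvester_def)

lemma signed_sylvester_col: "(\<Sum>y<2 * N. signed_sylvester d y v) = 0"
  unfolding sum_lessThan_double by (simp add: signed_sylvester_def)

text \<open>The signed matrix sees only the differences \<open>G u\<close> of F over the pairs 2u,
  2u + 1, and orthogonality applies to these. A Hadamard matrix of order q would give the factor q;
  the rank-one block has squared operator norm 4 instead of 2, hence 2 q.\<close>

lemma signed_sylvester_bessel:
  "(\<Sum>y<2 * 2 ^ d. (\<Sum>v<2 * 2 ^ d. F v * signed_sylvester d y v)\<^sup>2)
     \<le> 2 * real (2 * 2 ^ d) * (\<Sum>v<2 * 2 ^ d. (F v)\<^sup>2)"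
proof -
  define G where "G = (\<lambda>u. F (2 * u) - F (2 * u + 1))"
  define M :: nat where "M = 2 ^ d"
  have inner: "(\<Sum>v<2 * M. F v * signed_sylvester d y v)
      = (-1) ^ y * (\<Sum>u<M. G u * sylvester d (y div 2) u)" for y
    unfolding sum_lessThan_double sum_distrib_left
    by (rule sum.cong) (auto simp: signed_sylvester_def G_def algebra_simps)
  have "(\<Sum>y<2 * M. (\<Sum>v<2 * M. F v * signed_sylvester d y v)\<^sup>2)
      = 2 * (\<Sum>y<M. (\<Sum>u<M. G u * sylvester d y u)\<^sup>2)"
    by (simp only: inner, simp only: sum_lessThan_double)
       (simp add: power_mult_distrib sum_distrib_left sum_negf flip: power_mult)
  also have "(\<Sum>y<M. (\<Sum>u<M. G u * sylvester d y u)\<^sup>2)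
      = (\<Sum>y<M. \<Sum>u<M. \<Sum>u'<M. G u * G u' * (sylvester d y u * sylvester d y u'))"
    unfolding power2_eq_square sum_product by (intro sum.cong refl) (simp only: mult_ac)
  also have "\<dots> = (\<Sum>u<M. \<Sum>u'<M. \<Sum>y<M. G u * G u' * (sylvester d y u * sylvester d y u'))"
    by (subst sum.swap) (intro sum.cong refl sum.swap)
  also have "\<dots> = (\<Sum>u<M. \<Sum>u'<M. G u * G u' * (if u = u' then 2 ^ d else 0))"
    by (intro sum.cong refl) (simp add: M_def sylvester_orthogonal flip: sum_distrib_left)
  also have "\<dots> = (\<Sum>u<M. G u * G u * 2 ^ d)"
    by (intro sum.cong refl) (simp add: if_distrib[of "\<lambda>x. _ * x"] cong: if_cong)
  also have "\<dots> \<le> (\<Sum>u<M. 2 * 2 ^ d * ((F (2 * u))\<^sup>2 + (F (2 * u + 1))\<^sup>2))"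
  proof (rule sum_mono)
    fix u
    have "G u * G u \<le> 2 * ((F (2 * u))\<^sup>2 + (F (2 * u + 1))\<^sup>2)"
      using zero_le_power2[of "F (2 * u) + F (2 * u + 1)"]
      by (simp add: G_def power2_eq_square algebra_simps)
    then show "G u * G u * 2 ^ d \<le> 2 * 2 ^ d * ((F (2 * u))\<^sup>2 + (F (2 * u + 1))\<^sup>2)"
      using mult_right_mono[of "G u * G u" _ "2 ^ d"] by (simp add: mult_ac)
  qed
  also have "\<dots> = 2 * 2 ^ d * (\<Sum>v<2 * M. (F v)\<^sup>2)"
    unfolding sum_lessThan_double by (simp add: sum_distrib_left)
  finally show ?thesis
    by (simp add: M_def)
qed

section \<open>Configurations, and summing out their coordinates one at a time\<close>

definition cfg :: "nat \<Rightarrow> nat \<Rightarrow> (nat \<Rightarrow> nat) set" where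
  "cfg n q = {..<n} \<rightarrow>\<^sub>E {..<q}"

lemma finite_cfg [simp]: "finite (cfg n q)"
  by (simp add: cfg_def finite_PiE)

lemma cfg_upd: "f \<in> cfg n q \<Longrightarrow> i < n \<Longrightarrow> v < q \<Longrightarrow> f(i := v) \<in> cfg n q"
  by (auto simp: cfg_def PiE_iff extensional_def)

lemma cfg_less: "f \<in> cfg n q \<Longrightarrow> i < n \<Longrightarrow> f i < q"
  by (auto simp: cfg_def PiE_iff)

lemma card_cfg: "card (cfg n q) = q ^ n"
  by (simp add: cfg_def card_PiE)

text \<open>Exchanging the entry \<open>f i\<close> with the fresh value v is an involution on pairs
  of a configuration and a value: uniform resampling of one coordinate is reversible.\<close>

lemma sum_cfg_swap:
  assumes "i < n"
  shows "(\<Sum>f\<in>cfg n q. \<Sum>v<q. G f (f(i := v))) = (\<Sum>f\<in>cfg n q. \<Sum>v<q. G (f(i := v)) f)"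
  unfolding sum.cartesian_product
proof (rule sum.reindex_bij_witness[where i = "\<lambda>p. ((fst p)(i := snd p), fst p i)"
      and j = "\<lambda>p. ((fst p)(i := snd p), fst p i)"])
  fix p assume "p \<in> cfg n q \<times> {..<q}"
  then have p: "fst p \<in> cfg n q" "snd p < q"
    by auto
  show "((fst p)(i := snd p), fst p i) \<in> cfg n q \<times> {..<q}"
    using cfg_upd[OF p(1) assms p(2)] cfg_less[OF p(1) assms] by simp
  then show "((fst p)(i := snd p), fst p i) \<in> cfg n q \<times> {..<q}" .
qed (simp_all add: case_prod_unfold)

lemma sum_cfg_resample:
  fixes F :: "(nat \<Rightarrow> nat) \<Rightarrow> real"
  assumes "i < n"
  shows "(\<Sum>f\<in>cfg n q. \<Sum>v<q. F (f(i := v))) = real q * (\<Sum>f\<in>cfg n q. F f)"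
  using sum_cfg_swap[OF assms, of "\<lambda>f f'. F f'" q] by (simp add: sum_distrib_left)

text \<open>When coordinate \<open>\<sigma> t\<close> is summed out, the factors before t are
  constant and factor t contributes at most \<open>b t\<close>. Summing out is done by resampling,
  so every stage still sums over all of \<open>cfg n q\<close> and costs a factor q; this explains
  the powers of q in the induction.\<close>

lemma sum_prod_chain_le:
  fixes \<kappa> :: "nat \<Rightarrow> (nat \<Rightarrow> nat) \<Rightarrow> real"
  assumes q: "q > 0"
    and \<sigma>: "\<And>i. i < n \<Longrightarrow> \<sigma> i < n"
    and nonneg: "\<And>i f. i < n \<Longrightarrow> f \<in> cfg n q \<Longrightarrow> 0 \<le> \<kappa> i f"
    and indep: "\<And>i t f v. i < t \<Longrightarrow> t < n \<Longrightarrow> f \<in> cfg n q \<Longrightarrow> v < q \<Longrightarrow>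
      \<kappa> i (f(\<sigma> t := v)) = \<kappa> i f"
    and bound: "\<And>i f. i < n \<Longrightarrow> f \<in> cfg n q \<Longrightarrow> (\<Sum>v<q. \<kappa> i (f(\<sigma> i := v))) \<le> b i"
  shows "(\<Sum>f\<in>cfg n q. \<Prod>i<n. \<kappa> i f) \<le> (\<Prod>i<n. b i)"
proof -
  obtain f0 where f0: "f0 \<in> cfg n q"
    using q that[of "\<lambda>i\<in>{..<n}. 0"] by (auto simp: cfg_def)
  have b: "0 \<le> b i" if "i < n" for i
  proof -
    have "0 \<le> (\<Sum>v<q. \<kappa> i (f0(\<sigma> i := v)))"
      using f0 that by (intro sum_nonneg nonneg cfg_upd \<sigma>) auto
    also have "\<dots> \<le> b i"
      by (rule bound[OF that f0])
    finally show ?thesis .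
  qed
  have "t \<le> n \<Longrightarrow> real q ^ t * (\<Sum>f\<in>cfg n q. \<Prod>i<t. \<kappa> i f) \<le> real q ^ n * (\<Prod>i<t. b i)" for t
  proof (induction t)
    case 0
    then show ?case by (simp add: card_cfg)
  next
    case (Suc t)
    have "real q * (\<Sum>f\<in>cfg n q. \<Prod>i<Suc t. \<kappa> i f)
        = (\<Sum>f\<in>cfg n q. \<Sum>v<q. \<Prod>i<Suc t. \<kappa> i (f(\<sigma> t := v)))"
      using Suc.prems \<sigma>[of t]
      by (simp only: sum_cfg_resample[of "\<sigma> t" n "\<lambda>f. \<Prod>i<Suc t. \<kappa> i f" q])
    also have "\<dots> = (\<Sum>f\<in>cfg n q. (\<Prod>i<t. \<kappa> i f) * (\<Sum>v<q. \<kappa> t (f(\<sigma> t := v))))"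
    proof (rule sum.cong[OF refl])
      fix f assume f: "f \<in> cfg n q"
      have "(\<Prod>i<Suc t. \<kappa> i (f(\<sigma> t := v))) = (\<Prod>i<t. \<kappa> i f) * \<kappa> t (f(\<sigma> t := v))" if "v < q" for v
        unfolding prod.lessThan_Suc
        by (intro arg_cong2[where f = times] prod.cong refl indep) (use f that Suc.prems in auto)
      then show "(\<Sum>v<q. \<Prod>i<Suc t. \<kappa> i (f(\<sigma> t := v)))
          = (\<Prod>i<t. \<kappa> i f) * (\<Sum>v<q. \<kappa> t (f(\<sigma> t := v)))"
        by (simp add: sum_distrib_left del: prod.lessThan_Suc)
    qed
    also have "\<dots> \<le> (\<Sum>f\<in>cfg n q. (\<Prod>i<t. \<kappa> i f) * b t)"
    proof (rule sum_mono)
      fix f assume f: "f \<in> cfg n q"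
      have "0 \<le> (\<Prod>i<t. \<kappa> i f)"
        using f Suc.prems by (intro prod_nonneg ballI nonneg) auto
      then show "(\<Prod>i<t. \<kappa> i f) * (\<Sum>v<q. \<kappa> t (f(\<sigma> t := v))) \<le> (\<Prod>i<t. \<kappa> i f) * b t"
        using bound[of t f] f Suc.prems by (simp add: mult_left_mono)
    qed
    also have "\<dots> = (\<Sum>f\<in>cfg n q. \<Prod>i<t. \<kappa> i f) * b t"
      by (simp add: sum_distrib_right)
    finally have "real q ^ t * (real q * (\<Sum>f\<in>cfg n q. \<Prod>i<Suc t. \<kappa> i f))
        \<le> real q ^ t * ((\<Sum>f\<in>cfg n q. \<Prod>i<t. \<kappa> i f) * b t)"
      by (rule mult_left_mono) simp
    then have "real q ^ Suc t * (\<Sum>f\<in>cfg n q. \<Prod>i<Suc t. \<kappa> i f)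
        \<le> real q ^ t * (\<Sum>f\<in>cfg n q. \<Prod>i<t. \<kappa> i f) * b t"
      by (simp only: power_Suc mult_ac)
    also have "\<dots> \<le> real q ^ n * (\<Prod>i<t. b i) * b t"
      using mult_right_mono[OF Suc.IH b[of t]] Suc.prems by simp
    finally show ?case by (simp only: prod.lessThan_Suc mult.assoc)
  qed
  from this[of n] show ?thesis
    using q by simp
qed

text \<open>The exact counterpart for normalised kernels: only the coordinates from R on are summed
  out, and F, blind to them, passes through.\<close>

lemma sum_prod_chain_eq:
  fixes \<kappa> :: "nat \<Rightarrow> (nat \<Rightarrow> nat) \<Rightarrow> real"
  assumes q: "q > 0" and "R \<le> n"
    and indep: "\<And>i t f v. R \<le> i \<Longrightarrow> i < t \<Longrightarrow> t < n \<Longrightarrow> f \<in> cfg n q \<Longrightarrow> v < q \<Longrightarrow>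
      \<kappa> i (f(t := v)) = \<kappa> i f"
    and F: "\<And>t f v. R \<le> t \<Longrightarrow> t < n \<Longrightarrow> f \<in> cfg n q \<Longrightarrow> v < q \<Longrightarrow> F (f(t := v)) = F f"
    and one: "\<And>i f. R \<le> i \<Longrightarrow> i < n \<Longrightarrow> f \<in> cfg n q \<Longrightarrow> (\<Sum>v<q. \<kappa> i (f(i := v))) = 1"
  shows "real q ^ (n - R) * (\<Sum>f\<in>cfg n q. F f * (\<Prod>i\<in>{R..<n}. \<kappa> i f)) = (\<Sum>f\<in>cfg n q. F f)"
proof -
  have "R \<le> t \<Longrightarrow> t \<le> n \<Longrightarrow>
      real q ^ (t - R) * (\<Sum>f\<in>cfg n q. F f * (\<Prod>i\<in>{R..<t}. \<kappa> i f)) = (\<Sum>f\<in>cfg n q. F f)" for t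
  proof (induction t rule: dec_induct)
    case (step t)
    have "real q * (\<Sum>f\<in>cfg n q. F f * (\<Prod>i\<in>{R..<Suc t}. \<kappa> i f))
        = (\<Sum>f\<in>cfg n q. \<Sum>v<q. F (f(t := v)) * (\<Prod>i\<in>{R..<Suc t}. \<kappa> i (f(t := v))))"
      using step
      by (simp only: sum_cfg_resample[of t n "\<lambda>f. F f * (\<Prod>i\<in>{R..<Suc t}. \<kappa> i f)" q])
    also have "\<dots> = (\<Sum>f\<in>cfg n q. F f * (\<Prod>i\<in>{R..<t}. \<kappa> i f) * (\<Sum>v<q. \<kappa> t (f(t := v))))"
      using step by (intro sum.cong refl) (simp add: indep F sum_distrib_left mult_ac)
    also have "\<dots> = (\<Sum>f\<in>cfg n q. F f * (\<Prod>i\<in>{R..<t}. \<kappa> i f))"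
      using step by (intro sum.cong refl) (simp add: one)
    finally have "real q ^ (t - R) * (real q * (\<Sum>f\<in>cfg n q. F f * (\<Prod>i\<in>{R..<Suc t}. \<kappa> i f)))
        = (\<Sum>f\<in>cfg n q. F f)"
      using step by simp
    then show ?case
      using step by (simp add: Suc_diff_le mult_ac)
  qed simp
  from this[of n] show ?thesis using assms(2) by simp
qed

section \<open>The planted distribution\<close>

text \<open>Coordinates below \<open>R\<close> are the revealers, those from \<open>R\<close> to
  \<open>n - 1\<close> the testers; \<open>\<Gamma> c\<close> is the neighbourhood of c. The bound
  \<open>eps_s\<close> controls the normaliser and the second moment of one tester law,
  \<open>eps_T\<close> the chi-square cost of changing one revealer.\<close>

locale planted_model =
  fixes n q R s T :: nat and \<epsilon> :: real and g :: "nat \<Rightarrow> nat \<Rightarrow> real" and \<Gamma> :: "nat \<Rightarrow> nat set"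
  assumes q_pos: "q > 0"
    and R_le: "R \<le> n"
    and eps_pos: "0 < \<epsilon>"
    and eps_le: "\<epsilon> \<le> 1 / 10"
    and eps_s: "4 * real s * \<epsilon>\<^sup>2 \<le> 1"
    and eps_T: "25 * \<epsilon>\<^sup>2 * real T \<le> 1"
    and nbr: "\<And>c. \<Gamma> c \<subseteq> {..<R}"
    and card_nbr: "\<And>c. card (\<Gamma> c) \<le> s"
    and degree: "\<And>k. k < R \<Longrightarrow> card {c \<in> {R..<n}. k \<in> \<Gamma> c} \<le> T"
    and g_abs: "\<And>y v. \<bar>g y v\<bar> = 1"
    and g_row: "\<And>y. (\<Sum>v<q. g y v) = 0"
    and g_col: "\<And>v. (\<Sum>y<q. g y v) = 0"
    and g_bessel: "\<And>F. (\<Sum>y<q. (\<Sum>v<q. F v * g y v)\<^sup>2) \<le> 2 * real q * (\<Sum>v<q. (F v)\<^sup>2)"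
begin

definition dens :: "nat set \<Rightarrow> (nat \<Rightarrow> nat) \<Rightarrow> nat \<Rightarrow> real" where
  "dens G f v = (\<Prod>k\<in>G. 1 + \<epsilon> * g (f k) v)"

definition law :: "nat set \<Rightarrow> (nat \<Rightarrow> nat) \<Rightarrow> nat \<Rightarrow> real" where
  "law G f v = dens G f v / (\<Sum>v'<q. dens G f v')"

definition corr :: "nat set \<Rightarrow> nat \<Rightarrow> (nat \<Rightarrow> nat) \<Rightarrow> real" where
  "corr G y f = (\<Sum>v<q. law G f v * g y v)"

definition wt :: "nat \<Rightarrow> (nat \<Rightarrow> nat) \<Rightarrow> real" where
  "wt i f = (if i < R then 1 / real q else law (\<Gamma> i) f (f i))"

definition jp :: "(nat \<Rightarrow> nat) \<Rightarrow> real" where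
  "jp f = (\<Prod>i<n. wt i f)"

lemma g_cases: "g y v = 1 \<or> g y v = - 1"
  using g_abs[of y v] by linarith

lemma g_sq: "g y v * g y v = 1"
  using g_cases[of y v] by auto

lemma factor_bounds: "9 / 10 \<le> 1 + \<epsilon> * g y v" "1 + \<epsilon> * g y v \<le> 11 / 10"
  using g_cases[of y v] eps_pos eps_le by auto

lemma factor_pos: "0 < 1 + \<epsilon> * g y v"
  using factor_bounds(1)[of y v] by linarith

lemma dens_pos: "0 < dens G f v"
  unfolding dens_def by (intro prod_pos ballI factor_pos)

lemma dens_sum_pos: "0 < (\<Sum>v<q. dens G f v)"
  using q_pos by (intro sum_pos dens_pos) auto

lemma law_pos: "0 < law G f v"
  unfolding law_def by (intro divide_pos_pos dens_pos dens_sum_pos)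

lemma law_sum: "(\<Sum>v<q. law G f v) = 1"
  unfolding law_def using dens_sum_pos[of G f] by (simp flip: sum_divide_distrib)

lemma dens_upd: "i \<notin> G \<Longrightarrow> dens G (f(i := v)) = dens G f"
  unfolding dens_def by (intro ext prod.cong) auto

lemma law_upd: "i \<notin> G \<Longrightarrow> law G (f(i := v)) = law G f"
  unfolding law_def by (simp add: dens_upd fun_eq_iff)

lemma corr_upd: "i \<notin> G \<Longrightarrow> corr G y (f(i := v)) = corr G y f"
  unfolding corr_def by (simp add: law_upd)

lemma abs_corr_le: "\<bar>corr G y f\<bar> \<le> 1"
proof -
  have "\<bar>corr G y f\<bar> \<le> (\<Sum>v<q. \<bar>law G f v * g y v\<bar>)"
    unfolding corr_def by (rule sum_abs)
  also have "\<dots> = 1"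
    using law_pos by (simp add: abs_mult g_abs law_sum abs_of_pos)
  finally show ?thesis .
qed

text \<open>By ln (1 + x) >= x - 2 x^2 the product is at least 1 plus a linear term minus 2 s
  \<epsilon>^2, and the sum over v kills the linear term because the rows of g sum to zero. The
  bound holds for every f, so the normaliser costs no exceptional set.\<close>

lemma dens_sum_ge:
  assumes G: "G \<subseteq> {..<R}" "card G \<le> s"
  shows "real q / 2 \<le> (\<Sum>v<q. dens G f v)"
proof -
  have fin: "finite G"
    using G(1) finite_subset by blast
  have lower: "1 + (\<Sum>k\<in>G. \<epsilon> * g (f k) v - 2 * \<epsilon>\<^sup>2) \<le> dens G f v" for v
  proof -
    have "\<epsilon> * g y v - 2 * \<epsilon>\<^sup>2 \<le> ln (1 + \<epsilon> * g y v)" for y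
    proof -
      have "\<bar>\<epsilon> * g y v\<bar> \<le> 1 / 2"
        using eps_pos eps_le by (simp add: abs_mult g_abs)
      then have "\<bar>ln (1 + \<epsilon> * g y v) - \<epsilon> * g y v\<bar> \<le> 2 * (\<epsilon> * g y v)\<^sup>2"
        by (rule abs_ln_one_plus_x_minus_x_bound)
      moreover have "(\<epsilon> * g y v)\<^sup>2 = \<epsilon>\<^sup>2"
        using g_sq[of y v] by (simp add: power2_eq_square mult_ac)
      ultimately show ?thesis
        by simp
    qed
    then have "1 + (\<Sum>k\<in>G. \<epsilon> * g (f k) v - 2 * \<epsilon>\<^sup>2) \<le> 1 + (\<Sum>k\<in>G. ln (1 + \<epsilon> * g (f k) v))"
      by (simp add: sum_mono)
    also have "\<dots> \<le> exp (\<Sum>k\<in>G. ln (1 + \<epsilon> * g (f k) v))"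
      by (rule exp_ge_add_one_self)
    also have "\<dots> = dens G f v"
      unfolding dens_def exp_sum[OF fin] by (intro prod.cong refl exp_ln factor_pos)
    finally show ?thesis .
  qed
  have "real q / 2 \<le> real q - real q * (2 * (real s * \<epsilon>\<^sup>2))"
    using eps_s mult_left_mono[of "2 * (real s * \<epsilon>\<^sup>2)" "1 / 2" "real q"] by simp
  also have "\<dots> \<le> real q - real q * (2 * (real (card G) * \<epsilon>\<^sup>2))"
    using G(2) by (intro diff_left_mono mult_left_mono mult_right_mono) auto
  also have "\<dots> = real q + (\<Sum>k\<in>G. (\<Sum>v<q. \<epsilon> * g (f k) v - 2 * \<epsilon>\<^sup>2))"
    by (simp add: sum_subtractf g_row flip: sum_distrib_left)
  also have "\<dots> = (\<Sum>v<q. 1 + (\<Sum>k\<in>G. \<epsilon> * g (f k) v - 2 * \<epsilon>\<^sup>2))"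
    by (subst sum.swap) (simp add: sum.distrib)
  also have "\<dots> \<le> (\<Sum>v<q. dens G f v)"
    by (intro sum_mono lower)
  finally show ?thesis .
qed

text \<open>For uniform f the factors are independent over k, and each has mean square 1 +
  \<epsilon>^2 because the columns of g sum to zero.\<close>

lemma dens_second_moment:
  assumes G: "G \<subseteq> {..<R}" "card G \<le> s"
  shows "(\<Sum>f\<in>cfg n q. \<Sum>v<q. (dens G f v)\<^sup>2) \<le> 2 * real q ^ n * real q"
proof -
  have fin: "finite G" and Gn: "G \<subseteq> {..<n}"
    using G(1) R_le finite_subset by auto
  have "(\<Sum>f\<in>cfg n q. (dens G f v)\<^sup>2) \<le> 2 * real q ^ n" for v
  proof -
    define \<kappa> where "\<kappa> = (\<lambda>i (f::nat \<Rightarrow> nat). if i \<in> G then (1 + \<epsilon> * g (f i) v)\<^sup>2 else 1)"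
    define b where "b = (\<lambda>i. real q * (if i \<in> G then 1 + \<epsilon>\<^sup>2 else 1))"
    have "(dens G f v)\<^sup>2 = (\<Prod>i<n. \<kappa> i f)" for f
      unfolding dens_def prod_power_distrib \<kappa>_def
      using Gn by (simp add: prod.If_cases Int_absorb1)
    then have "(\<Sum>f\<in>cfg n q. (dens G f v)\<^sup>2) = (\<Sum>f\<in>cfg n q. \<Prod>i<n. \<kappa> i f)"
      by simp
    also have "\<dots> \<le> (\<Prod>i<n. b i)"
    proof (rule sum_prod_chain_le[where \<sigma> = "\<lambda>i. i"])
      fix i f assume "i < n" "f \<in> cfg n q"
      have "(\<Sum>y<q. (1 + \<epsilon> * g y v)\<^sup>2) = (\<Sum>y<q. 1 + \<epsilon>\<^sup>2 + 2 * \<epsilon> * g y v)"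
      proof (rule sum.cong[OF refl])
        fix y
        have "(1 + \<epsilon> * g y v)\<^sup>2 = 1 + \<epsilon>\<^sup>2 * (g y v * g y v) + 2 * \<epsilon> * g y v"
          by (simp add: power2_eq_square algebra_simps)
        then show "(1 + \<epsilon> * g y v)\<^sup>2 = 1 + \<epsilon>\<^sup>2 + 2 * \<epsilon> * g y v"
          by (simp add: g_sq)
      qed
      also have "\<dots> = real q * (1 + \<epsilon>\<^sup>2)"
        by (simp add: sum.distrib g_col algebra_simps flip: sum_distrib_left)
      finally show "(\<Sum>y<q. \<kappa> i (f(i := y))) \<le> b i"
        by (simp add: \<kappa>_def b_def)
    qed (auto simp: q_pos \<kappa>_def)
    also have "\<dots> = real q ^ n * (1 + \<epsilon>\<^sup>2) ^ card G"
      unfolding b_def prod.distrib using Gn by (simp add: prod.If_cases Int_absorb1)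
    also have "(1 + \<epsilon>\<^sup>2) ^ card G \<le> 2"
    proof -
      have "(1 + \<epsilon>\<^sup>2) ^ card G \<le> (1 + \<epsilon>\<^sup>2) ^ s"
        using G(2) by (intro power_increasing) auto
      also have "\<dots> \<le> exp (\<epsilon>\<^sup>2) ^ s"
        by (intro power_mono exp_ge_add_one_self) auto
      also have "\<dots> = exp (real s * \<epsilon>\<^sup>2)"
        by (simp add: exp_of_nat_mult)
      also have "\<dots> \<le> 1 + 2 * (real s * \<epsilon>\<^sup>2)"
        using exp_bound_lemma[of "real s * \<epsilon>\<^sup>2"] eps_s by simp
      also have "\<dots> \<le> 2"
        using eps_s by simp
      finally show ?thesis .
    qed
    finally show ?thesis
      using q_pos by (simp add: mult_ac)
  qed
  then have "(\<Sum>v<q. \<Sum>f\<in>cfg n q. (dens G f v)\<^sup>2) \<le> (\<Sum>v<q. 2 * real q ^ n)"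
    by (intro sum_mono) auto
  then show ?thesis
    by (subst sum.swap) (simp add: mult_ac)
qed

text \<open>Bessel bounds the sum over y by 2 q times the squared norm of the law, which is of order
  1 / q on average. So the correlation with a row chosen uniformly and independently of the law is
  typically of order at most 1 / sqrt q, far below \<epsilon> once q is large.\<close>

lemma corr_second_moment:
  assumes G: "G \<subseteq> {..<R}" "card G \<le> s"
  shows "(\<Sum>f\<in>cfg n q. \<Sum>y<q. (corr G y f)\<^sup>2) \<le> 16 * real q ^ n"
proof -
  have "(\<Sum>y<q. (corr G y f)\<^sup>2) \<le> 8 / real q * (\<Sum>v<q. (dens G f v)\<^sup>2)" for f
  proof -
    define Z where "Z = (\<Sum>v<q. dens G f v)"
    have Z: "real q / 2 \<le> Z" "0 < Z"
      unfolding Z_def by (rule dens_sum_ge[OF G], rule dens_sum_pos)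
    have "(\<Sum>y<q. (corr G y f)\<^sup>2) \<le> 2 * real q * (\<Sum>v<q. (law G f v)\<^sup>2)"
      unfolding corr_def by (rule g_bessel)
    also have "\<dots> = 2 * real q / Z\<^sup>2 * (\<Sum>v<q. (dens G f v)\<^sup>2)"
      unfolding law_def Z_def[symmetric] by (simp add: power_divide flip: sum_divide_distrib)
    also have "\<dots> \<le> 8 / real q * (\<Sum>v<q. (dens G f v)\<^sup>2)"
    proof (rule mult_right_mono)
      have "(real q / 2)\<^sup>2 \<le> Z\<^sup>2"
        using Z by (intro power_mono) auto
      then have "2 * real q * real q \<le> 8 * Z\<^sup>2"
        by (simp add: power2_eq_square)
      then show "2 * real q / Z\<^sup>2 \<le> 8 / real q"
        using q_pos Z by (simp add: field_simps)
    qed (simp add: sum_nonneg)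
    finally show ?thesis .
  qed
  then have "(\<Sum>f\<in>cfg n q. \<Sum>y<q. (corr G y f)\<^sup>2)
      \<le> 8 / real q * (\<Sum>f\<in>cfg n q. \<Sum>v<q. (dens G f v)\<^sup>2)"
    by (subst sum_distrib_left) (rule sum_mono)
  also have "\<dots> \<le> 8 / real q * (2 * real q ^ n * real q)"
    by (intro mult_left_mono dens_second_moment G) auto
  finally show ?thesis
    using q_pos by simp
qed

text \<open>Including the neighbour \<open>k\<close> acts on correlations like the addition of velocities,
  \<open>\<psi> \<mapsto> (\<psi> + \<epsilon>) / (1 + \<epsilon> \<psi>)\<close>.\<close>

lemma corr_self_ge:
  assumes "finite G" "k \<in> G"
  shows "\<epsilon> - 2 * \<bar>corr (G - {k}) (f k) f\<bar> \<le> corr G (f k) f"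
proof -
  define Z where "Z = (\<Sum>v<q. dens (G - {k}) f v)"
  define \<psi> where "\<psi> = corr (G - {k}) (f k) f"
  have Z: "Z > 0"
    unfolding Z_def by (rule dens_sum_pos)
  have dens: "dens G f v = dens (G - {k}) f v * (1 + \<epsilon> * g (f k) v)" for v
    unfolding dens_def using assms by (subst prod.remove[of G k]) (auto simp: mult_ac)
  have \<psi>: "(\<Sum>v<q. dens (G - {k}) f v * g (f k) v) = Z * \<psi>"
    unfolding \<psi>_def corr_def law_def Z_def[symmetric] using Z
    by (simp add: sum_distrib_left)
  have "(\<Sum>v<q. dens G f v) = Z + \<epsilon> * (\<Sum>v<q. dens (G - {k}) f v * g (f k) v)"
    unfolding dens Z_def by (simp add: sum.distrib sum_distrib_left algebra_simps)
  then have denom: "(\<Sum>v<q. dens G f v) = Z * (1 + \<epsilon> * \<psi>)"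
    unfolding \<psi> by (simp add: algebra_simps)
  have "(\<Sum>v<q. dens G f v * g (f k) v)
      = (\<Sum>v<q. dens (G - {k}) f v * g (f k) v + \<epsilon> * dens (G - {k}) f v)"
    unfolding dens by (intro sum.cong refl) (simp add: algebra_simps g_sq)
  also have "\<dots> = Z * \<psi> + \<epsilon> * Z"
    by (simp only: sum.distrib \<psi> Z_def sum_distrib_left[symmetric])
  finally have num: "(\<Sum>v<q. dens G f v * g (f k) v) = Z * (\<psi> + \<epsilon>)"
    by (simp add: algebra_simps)
  have "corr G (f k) f = (\<Sum>v<q. dens G f v * g (f k) v) / (\<Sum>v<q. dens G f v)"
    unfolding corr_def law_def by (simp add: sum_divide_distrib)
  then have eq: "corr G (f k) f = (\<psi> + \<epsilon>) / (1 + \<epsilon> * \<psi>)"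
    unfolding num denom using Z by simp
  have \<psi>1: "\<bar>\<psi>\<bar> \<le> 1"
    unfolding \<psi>_def by (rule abs_corr_le)
  then have e\<psi>: "\<bar>\<epsilon> * \<psi>\<bar> \<le> \<epsilon>"
    using eps_pos mult_left_mono[of "\<bar>\<psi>\<bar>" 1 \<epsilon>] by (simp add: abs_mult)
  then have pos: "1 + \<epsilon> * \<psi> > 0"
    using eps_le by (simp add: abs_le_iff)
  \<comment> \<open>Right side minus left side is \<psi> (3 - \<epsilon>^2 + 2 \<epsilon> \<psi>)
    for \<psi> >= 0 and -\<psi> (1 + \<epsilon>^2 + 2 \<epsilon> \<psi>) for \<psi> < 0; both are
    nonnegative because |\<epsilon> \<psi>| <= 1/10.\<close>
  have "(\<epsilon> - 2 * \<bar>\<psi>\<bar>) * (1 + \<epsilon> * \<psi>) \<le> \<psi> + \<epsilon>"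
  proof (cases "\<psi> \<ge> 0")
    case True
    have "\<epsilon> * \<epsilon> * \<psi> \<le> 1 * 1 * \<psi>"
      using True eps_pos eps_le by (intro mult_mono) auto
    moreover have "0 \<le> \<epsilon> * \<psi> * \<psi>"
      using True eps_pos by simp
    ultimately show ?thesis
      using True by (simp add: algebra_simps)
  next
    case False
    then have "\<epsilon> * \<epsilon> * \<psi> \<le> 0"
      using eps_pos by (simp add: mult_nonneg_nonpos)
    moreover have "\<epsilon> * \<psi> * \<psi> \<le> 1 / 10 * (- \<psi>)"
    proof -
      have "(- \<epsilon> * \<psi>) * (- \<psi>) \<le> 1 / 10 * (- \<psi>)"
        using False e\<psi> eps_le by (intro mult_right_mono) auto
      then show ?thesis by simp
    qed
    ultimately show ?thesis
      using False by (simp add: algebra_simps)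
  qed
  then show ?thesis
    unfolding eq \<psi>_def[symmetric] using pos by (simp add: le_divide_eq)
qed

section \<open>The joint law and summing out the testers\<close>

lemma finite_nbr: "finite (\<Gamma> c)"
  using nbr[of c] finite_subset by blast

lemma nbr_less: "k \<in> \<Gamma> c \<Longrightarrow> k < R"
  using nbr[of c] by auto

lemma wt_pos: "0 < wt i f"
  unfolding wt_def using q_pos law_pos by simp

lemma jp_pos: "0 < jp f"
  unfolding jp_def by (intro prod_pos ballI wt_pos)

lemma wt_upd_other: "i \<noteq> t \<Longrightarrow> t \<notin> \<Gamma> i \<or> i < R \<Longrightarrow> wt i (f(t := v)) = wt i f"
  unfolding wt_def by (auto simp: law_upd)

lemma wt_upd_tester: "R \<le> t \<Longrightarrow> i \<noteq> t \<Longrightarrow> wt i (f(t := v)) = wt i f"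
  using nbr_less[of t i] by (intro wt_upd_other) auto

lemma wt_upd_later: "i < t \<Longrightarrow> wt i (f(t := v)) = wt i f"
  using wt_upd_other[of i t f v] nbr_less[of t i] by (cases "i < R") auto

lemma wt_upd_self: "R \<le> i \<Longrightarrow> wt i (f(i := v)) = law (\<Gamma> i) f v"
  using law_upd[of i "\<Gamma> i" f v] nbr_less[of i i] unfolding wt_def by fastforce

text \<open>Testers depend on revealers only and each tester law has mass 1, so the testers sum out
  and leave the uniform law on the revealers. Expectations of functions of a neighbourhood thus
  reduce to the uniform second moments above.\<close>

lemma sum_jp_revealers:
  assumes F: "\<And>t f v. R \<le> t \<Longrightarrow> t < n \<Longrightarrow> f \<in> cfg n q \<Longrightarrow> v < q \<Longrightarrow> F (f(t := v)) = F f"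
  shows "(\<Sum>f\<in>cfg n q. jp f * F f) = (\<Sum>f\<in>cfg n q. F f) / real q ^ n"
proof -
  have split: "jp f = (1 / real q) ^ R * (\<Prod>i\<in>{R..<n}. wt i f)" for f
  proof -
    have "jp f = (\<Prod>i\<in>{..<R}. wt i f) * (\<Prod>i\<in>{R..<n}. wt i f)"
      unfolding jp_def using R_le
      by (subst prod.union_disjoint[symmetric]) (auto simp: ivl_disj_un)
    then show ?thesis
      by (simp add: wt_def)
  qed
  have "real q ^ (n - R) * (\<Sum>f\<in>cfg n q. F f * (\<Prod>i\<in>{R..<n}. wt i f)) = (\<Sum>f\<in>cfg n q. F f)"
    by (rule sum_prod_chain_eq)
       (use q_pos R_le F in \<open>auto simp: wt_upd_later wt_upd_self law_sum\<close>)
  then have "(\<Sum>f\<in>cfg n q. F f * (\<Prod>i\<in>{R..<n}. wt i f)) = (\<Sum>f\<in>cfg n q. F f) / real q ^ (n - R)"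
    using q_pos by (simp add: field_simps)
  moreover have "(\<Sum>f\<in>cfg n q. jp f * F f)
      = (1 / real q) ^ R * (\<Sum>f\<in>cfg n q. F f * (\<Prod>i\<in>{R..<n}. wt i f))"
    by (simp add: split sum_distrib_left mult_ac)
  moreover have "real q ^ n = real q ^ R * real q ^ (n - R)"
    using R_le by (simp flip: power_add)
  ultimately show ?thesis
    by (simp add: power_one_over field_simps)
qed

lemma sum_jp: "(\<Sum>f\<in>cfg n q. jp f) = 1"
  using sum_jp_revealers[of "\<lambda>_. 1"] q_pos by (simp add: card_cfg)

text \<open>A tester is a leaf: no other weight involves its value. Resampling it exposes its full
  law, against which g integrates to \<open>corr\<close>. The factor \<open>H\<close> can encode
  conditioning on any coordinates other than c.\<close>

lemma sum_jp_tester: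
  assumes c: "R \<le> c" "c < n"
    and H: "\<And>f v. f \<in> cfg n q \<Longrightarrow> v < q \<Longrightarrow> H (f(c := v)) = H f"
  shows "(\<Sum>f\<in>cfg n q. jp f * (H f * g y (f c))) = (\<Sum>f\<in>cfg n q. jp f * (H f * corr (\<Gamma> c) y f))"
proof -
  define rest where "rest = (\<lambda>f. \<Prod>i\<in>{..<n} - {c}. wt i f)"
  have jp: "jp (f(c := v)) = rest f * law (\<Gamma> c) f v" for f v
  proof -
    have "jp (f(c := v)) = wt c (f(c := v)) * (\<Prod>i\<in>{..<n} - {c}. wt i (f(c := v)))"
      unfolding jp_def using c by (subst prod.remove[of _ c]) auto
    also have "(\<Prod>i\<in>{..<n} - {c}. wt i (f(c := v))) = rest f"
      unfolding rest_def using c by (intro prod.cong refl wt_upd_tester) auto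
    finally show ?thesis
      unfolding wt_upd_self[OF c(1)] by (simp only: mult.commute)
  qed
  have c': "c \<notin> \<Gamma> c"
    using nbr_less[of c c] c by auto
  have "real q * (\<Sum>f\<in>cfg n q. jp f * (H f * g y (f c)))
      = (\<Sum>f\<in>cfg n q. \<Sum>v<q. jp (f(c := v)) * (H (f(c := v)) * g y ((f(c := v)) c)))"
    using c(2) by (simp only: sum_cfg_resample[of c n "\<lambda>f. jp f * (H f * g y (f c))" q])
  also have "\<dots> = (\<Sum>f\<in>cfg n q. rest f * (H f * corr (\<Gamma> c) y f))"
    unfolding corr_def sum_distrib_left
    by (intro sum.cong refl) (simp add: jp H mult_ac)
  also have "\<dots> = (\<Sum>f\<in>cfg n q. \<Sum>v<q. law (\<Gamma> c) f v * (rest f * (H f * corr (\<Gamma> c) y f)))"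
    unfolding sum_distrib_right[symmetric] law_sum by simp
  also have "\<dots> = (\<Sum>f\<in>cfg n q. \<Sum>v<q. jp (f(c := v)) * (H (f(c := v)) * corr (\<Gamma> c) y (f(c := v))))"
    by (intro sum.cong refl) (simp add: jp H corr_upd[OF c'] mult_ac)
  also have "\<dots> = real q * (\<Sum>f\<in>cfg n q. jp f * (H f * corr (\<Gamma> c) y f))"
    using c(2) by (rule sum_cfg_resample)
  finally show ?thesis
    using q_pos by simp
qed

section \<open>Conditional expectation given a set of coordinates\<close>

definition block :: "nat set \<Rightarrow> (nat \<Rightarrow> nat) \<Rightarrow> (nat \<Rightarrow> nat) set" where
  "block S f = {h \<in> cfg n q. \<forall>j\<in>S. h j = f j}"

text \<open>Here f plays two roles: its values on \<open>S\<close> name the conditioning event, and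
  summed against \<open>jp\<close> it is the random point at which the conditional expectation is
  evaluated. As \<open>jp\<close> is positive, the event of a configuration f is never null.\<close>

definition cexp :: "nat set \<Rightarrow> ((nat \<Rightarrow> nat) \<Rightarrow> real) \<Rightarrow> (nat \<Rightarrow> nat) \<Rightarrow> real" where
  "cexp S V f = (\<Sum>h\<in>block S f. jp h * V h) / (\<Sum>h\<in>block S f. jp h)"

lemma finite_block [simp]: "finite (block S f)"
  unfolding block_def by simp

lemma block_subset: "block S f \<subseteq> cfg n q"
  unfolding block_def by auto

lemma block_self: "f \<in> cfg n q \<Longrightarrow> f \<in> block S f"
  unfolding block_def by simp

lemma block_cong: "(\<And>j. j \<in> S \<Longrightarrow> f j = f' j) \<Longrightarrow> block S f = block S f'"
  unfolding block_def by auto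

lemma block_empty: "block {} f = cfg n q"
  unfolding block_def by simp

lemma block_mass_pos: "f \<in> cfg n q \<Longrightarrow> 0 < (\<Sum>h\<in>block S f. jp h)"
  using block_self[of f S] by (intro sum_pos jp_pos) auto

lemma cexp_cong:
  assumes "\<And>j. j \<in> S \<Longrightarrow> f j = f' j" and "\<And>h. h \<in> block S f \<Longrightarrow> V h = W h"
  shows "cexp S V f = cexp S W f'"
  unfolding cexp_def using assms block_cong[of S f f'] by (auto intro!: arg_cong2[where f = "(/)"] sum.cong)

lemma cexp_mono:
  assumes "\<And>h. h \<in> block S f \<Longrightarrow> V h \<le> W h"
  shows "cexp S V f \<le> cexp S W f"
  unfolding cexp_def
  by (intro divide_right_mono sum_mono mult_left_mono assms sum_nonneg) (auto intro: less_imp_le jp_pos)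

lemma cexp_affine:
  assumes "f \<in> cfg n q"
  shows "cexp S (\<lambda>h. a * V h + b) f = a * cexp S V f + b"
proof -
  have "(\<Sum>h\<in>block S f. jp h * (a * V h + b)) = a * (\<Sum>h\<in>block S f. jp h * V h) + b * (\<Sum>h\<in>block S f. jp h)"
    by (simp add: sum.distrib sum_distrib_left algebra_simps)
  then show ?thesis
    unfolding cexp_def using block_mass_pos[OF assms, of S] by (simp add: add_divide_distrib)
qed

lemma cexp_add: "cexp S (\<lambda>h. V h + W h) f = cexp S V f + cexp S W f"
  unfolding cexp_def by (simp add: sum.distrib distrib_left add_divide_distrib)

lemma cexp_nonneg: "(\<And>h. h \<in> block S f \<Longrightarrow> 0 \<le> V h) \<Longrightarrow> 0 \<le> cexp S V f"
  unfolding cexp_def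
  by (intro divide_nonneg_nonneg sum_nonneg mult_nonneg_nonneg) (auto intro: less_imp_le jp_pos)

lemma cexp_square_le:
  assumes "f \<in> cfg n q"
  shows "(cexp S V f)\<^sup>2 \<le> cexp S (\<lambda>h. (V h)\<^sup>2) f"
proof -
  define m where "m = cexp S V f"
  have "0 \<le> cexp S (\<lambda>h. (V h - m)\<^sup>2) f"
    by (rule cexp_nonneg) simp
  also have "(\<lambda>h. (V h - m)\<^sup>2) = (\<lambda>h. (V h)\<^sup>2 + ((- 2 * m) * V h + m\<^sup>2))"
    by (rule ext) (simp add: power2_eq_square algebra_simps)
  also have "cexp S \<dots> f = cexp S (\<lambda>h. (V h)\<^sup>2) f + ((- 2 * m) * m + m\<^sup>2)"
    unfolding cexp_add[where V = "\<lambda>h. (V h)\<^sup>2"] cexp_affine[OF assms, where V = V] m_def[symmetric] ..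
  finally show ?thesis
    by (simp add: m_def[symmetric] power2_eq_square)
qed

lemma cexp_empty: "cexp {} V f = (\<Sum>h\<in>cfg n q. jp h * V h)"
  unfolding cexp_def block_empty sum_jp by simp

lemma sum_jp_square_le: "(\<Sum>f\<in>cfg n q. jp f * V f)\<^sup>2 \<le> (\<Sum>f\<in>cfg n q. jp f * (V f)\<^sup>2)"
proof -
  obtain f0 where "f0 \<in> cfg n q"
    using sum_jp by fastforce
  from cexp_square_le[OF this, of "{}" V] show ?thesis
    unfolding cexp_empty .
qed

lemma cexp_tower: "(\<Sum>f\<in>cfg n q. jp f * cexp S V f) = (\<Sum>f\<in>cfg n q. jp f * V f)"
proof -
  define P where "P = (\<lambda>f. \<Sum>h\<in>block S f. jp h)"
  have "(\<Sum>f\<in>cfg n q. jp f * cexp S V f)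
      = (\<Sum>f\<in>cfg n q. \<Sum>h\<in>cfg n q. if \<forall>j\<in>S. h j = f j then jp f * (jp h * V h) / P f else 0)"
  proof (rule sum.cong[OF refl])
    fix f
    have "jp f * cexp S V f = (\<Sum>h\<in>block S f. jp f * (jp h * V h) / P f)"
      unfolding cexp_def P_def by (simp add: sum_distrib_left sum_divide_distrib)
    also have "\<dots> = (\<Sum>h\<in>cfg n q. if \<forall>j\<in>S. h j = f j then jp f * (jp h * V h) / P f else 0)"
      unfolding block_def by (rule sum.inter_filter) simp
    finally show "jp f * cexp S V f
        = (\<Sum>h\<in>cfg n q. if \<forall>j\<in>S. h j = f j then jp f * (jp h * V h) / P f else 0)" .
  qed
  also have "\<dots> = (\<Sum>h\<in>cfg n q. \<Sum>f\<in>cfg n q. if \<forall>j\<in>S. h j = f j then jp f * (jp h * V h) / P f else 0)"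
    by (rule sum.swap)
  also have "\<dots> = (\<Sum>h\<in>cfg n q. jp h * V h)"
  proof (rule sum.cong[OF refl])
    fix h assume h: "h \<in> cfg n q"
    have "(\<Sum>f\<in>cfg n q. if \<forall>j\<in>S. h j = f j then jp f * (jp h * V h) / P f else 0)
        = (\<Sum>f\<in>block S h. jp f * (jp h * V h) / P f)"
      unfolding block_def by (subst sum.inter_filter) (auto intro!: sum.cong)
    also have "\<dots> = (\<Sum>f\<in>block S h. jp f * (jp h * V h / P h))"
    proof (rule sum.cong[OF refl])
      fix f assume "f \<in> block S h"
      then have "P f = P h"
        unfolding P_def by (intro sum.cong block_cong refl) (auto simp: block_def)
      then show "jp f * (jp h * V h) / P f = jp f * (jp h * V h / P h)"
        by simp
    qed
    also have "\<dots> = P h * (jp h * V h / P h)"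
      unfolding P_def by (rule sum_distrib_right[symmetric])
    also have "\<dots> = jp h * V h"
      using block_mass_pos[OF h, of S] by (simp add: P_def)
    finally show "(\<Sum>f\<in>cfg n q. if \<forall>j\<in>S. h j = f j then jp f * (jp h * V h) / P f else 0) = jp h * V h" .
  qed
  finally show ?thesis .
qed

lemma sum_jp_markov:
  assumes "\<And>f. f \<in> cfg n q \<Longrightarrow> 0 \<le> V f" "0 < t"
  shows "(\<Sum>f | f \<in> cfg n q \<and> t \<le> V f. jp f) \<le> (\<Sum>f\<in>cfg n q. jp f * V f) / t"
proof -
  have "t * (\<Sum>f | f \<in> cfg n q \<and> t \<le> V f. jp f) \<le> (\<Sum>f | f \<in> cfg n q \<and> t \<le> V f. jp f * V f)"
    unfolding sum_distrib_left
  proof (rule sum_mono)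
    fix f assume "f \<in> {f. f \<in> cfg n q \<and> t \<le> V f}"
    then show "t * jp f \<le> jp f * V f"
      using jp_pos[of f] by (simp add: mult.commute)
  qed
  also have "\<dots> \<le> (\<Sum>f\<in>cfg n q. jp f * V f)"
    using assms(1) by (intro sum_mono2) (auto intro: mult_nonneg_nonneg less_imp_le jp_pos)
  finally show ?thesis
    using assms(2) by (simp add: le_divide_eq mult.commute)
qed

text \<open>\<open>sum_jp_tester\<close> with the indicator of the conditioning event as
  \<open>H\<close>. The set S may mix revealers with other testers.\<close>

lemma cexp_tester:
  assumes "R \<le> c" "c < n" "c \<notin> S"
  shows "cexp S (\<lambda>h. g y (h c)) f = cexp S (corr (\<Gamma> c) y) f"
proof -
  define H where "H = (\<lambda>h. if \<forall>j\<in>S. h j = f j then 1 else 0 :: real)"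
  have eq: "(\<Sum>h\<in>block S f. jp h * V h) = (\<Sum>h\<in>cfg n q. jp h * (H h * V h))" for V
    unfolding block_def H_def by (subst sum.inter_filter) (auto intro!: sum.cong)
  have "(\<Sum>h\<in>cfg n q. jp h * (H h * g y (h c))) = (\<Sum>h\<in>cfg n q. jp h * (H h * corr (\<Gamma> c) y h))"
  proof (rule sum_jp_tester[OF assms(1,2)])
    fix h v
    have "(\<forall>j\<in>S. (h(c := v)) j = f j) \<longleftrightarrow> (\<forall>j\<in>S. h j = f j)"
      using assms(3) by (intro ball_cong) auto
    then show "H (h(c := v)) = H h"
      unfolding H_def by simp
  qed
  then show ?thesis
    unfolding cexp_def eq by simp
qed

section \<open>Correlation with a revealed neighbour\<close>

lemma inverse_q_sqrt: "x\<^sup>2 \<le> a\<^sup>2 / real q \<Longrightarrow> 0 \<le> a \<Longrightarrow> x \<le> a / sqrt (real q)"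
  by (rule power2_le_imp_le) (simp_all add: power_divide)

text \<open>Leaving k out of the neighbourhood makes the law independent of the value at k, so
  Bessel bounds the root mean square of the residual correlation \<open>V\<close> by 4 / sqrt q. By
  \<open>corr_self_ge\<close> the correlation given S is at least \<epsilon> minus twice the
  conditional mean of \<open>V\<close>, and Markov at level \<epsilon> / 4 gives the constant
  16.\<close>

lemma prob_correlation_small:
  assumes c: "R \<le> c" "c < n" "c \<notin> S" and k: "k \<in> S" "k \<in> \<Gamma> c"
  shows "(\<Sum>f | f \<in> cfg n q \<and> cexp S (\<lambda>h. g (f k) (h c)) f < \<epsilon> / 2. jp f) \<le> 16 / (\<epsilon> * sqrt (real q))"
proof -
  define G where "G = \<Gamma> c - {k}"
  define V where "V = (\<lambda>h. \<bar>corr G (h k) h\<bar>)"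
  have kn: "k < n" "k < R"
    using nbr_less[OF k(2)] R_le by auto
  have G: "G \<subseteq> {..<R}" "card G \<le> s" "k \<notin> G"
    using nbr[of c] card_nbr[of c] card_mono[of "\<Gamma> c" G] finite_nbr[of c] by (auto simp: G_def)
  have lower: "\<epsilon> - 2 * cexp S V f \<le> cexp S (\<lambda>h. g (f k) (h c)) f" if f: "f \<in> cfg n q" for f
  proof -
    have "\<epsilon> - 2 * cexp S V f = cexp S (\<lambda>h. (- 2) * V h + \<epsilon>) f"
      unfolding cexp_affine[OF f, where V = V] by simp
    also have "\<dots> \<le> cexp S (corr (\<Gamma> c) (f k)) f"
    proof (rule cexp_mono)
      fix h assume "h \<in> block S f"
      then have "h k = f k"
        using k(1) by (simp add: block_def)
      then show "- 2 * V h + \<epsilon> \<le> corr (\<Gamma> c) (f k) h"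
        using corr_self_ge[OF finite_nbr k(2), of h] by (simp add: V_def G_def)
    qed
    also have "\<dots> = cexp S (\<lambda>h. g (f k) (h c)) f"
      by (simp add: cexp_tester[OF c])
    finally show ?thesis .
  qed
  have V0: "0 \<le> cexp S V f" for f
    by (rule cexp_nonneg) (simp add: V_def)
  have "(\<Sum>f | f \<in> cfg n q \<and> cexp S (\<lambda>h. g (f k) (h c)) f < \<epsilon> / 2. jp f)
      \<le> (\<Sum>f | f \<in> cfg n q \<and> \<epsilon> / 4 \<le> cexp S V f. jp f)"
  proof (rule sum_mono2)
    show "{f. f \<in> cfg n q \<and> cexp S (\<lambda>h. g (f k) (h c)) f < \<epsilon> / 2}
        \<subseteq> {f. f \<in> cfg n q \<and> \<epsilon> / 4 \<le> cexp S V f}"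
      using lower by force
  qed (auto intro: less_imp_le jp_pos)
  also have "\<dots> \<le> (\<Sum>f\<in>cfg n q. jp f * cexp S V f) / (\<epsilon> / 4)"
    using V0 eps_pos by (intro sum_jp_markov) auto
  also have "\<dots> = (\<Sum>f\<in>cfg n q. jp f * V f) / (\<epsilon> / 4)"
    by (simp only: cexp_tower)
  also have "\<dots> \<le> (4 / sqrt (real q)) / (\<epsilon> / 4)"
  proof (rule divide_right_mono)
    have "(\<Sum>f\<in>cfg n q. jp f * V f)\<^sup>2 \<le> (\<Sum>f\<in>cfg n q. jp f * (V f)\<^sup>2)"
      by (rule sum_jp_square_le)
    also have "\<dots> = (\<Sum>f\<in>cfg n q. (V f)\<^sup>2) / real q ^ n"
    proof (rule sum_jp_revealers)
      fix t f v assume t: "R \<le> t"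
      then have "t \<notin> G" "t \<noteq> k"
        using G(1) kn by auto
      then show "(V (f(t := v)))\<^sup>2 = (V f)\<^sup>2"
        by (simp add: V_def corr_upd)
    qed
    \<comment> \<open>The uniform value at k is resampled and becomes the free row index y of the
      Bessel sum.\<close>
    also have "\<dots> = (\<Sum>f\<in>cfg n q. \<Sum>y<q. (V (f(k := y)))\<^sup>2) / (real q * real q ^ n)"
      using q_pos kn by (simp add: sum_cfg_resample[of k n "\<lambda>f. (V f)\<^sup>2" q])
    also have "\<dots> = (\<Sum>f\<in>cfg n q. \<Sum>y<q. (corr G y f)\<^sup>2) / (real q * real q ^ n)"
      by (simp add: V_def corr_upd[OF G(3)])
    also have "\<dots> \<le> (16 * real q ^ n) / (real q * real q ^ n)"
      by (intro divide_right_mono corr_second_moment G) simp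
    also have "\<dots> = 4\<^sup>2 / real q"
      using q_pos by simp
    finally show "(\<Sum>f\<in>cfg n q. jp f * V f) \<le> 4 / sqrt (real q)"
      by (rule inverse_q_sqrt) simp
  qed (use eps_pos in auto)
  finally show ?thesis
    by (simp add: mult_ac)
qed

section \<open>Changing one revealer, and correlation with an unrevealed neighbour\<close>

lemma law_upd_bounds:
  assumes "finite G"
  shows "law G f v \<le> (1 + 5 * \<epsilon>) * law G (f(k := y)) v"
    and "(1 - 5 * \<epsilon>) * law G (f(k := y)) v \<le> law G f v"
proof -
  define f' where "f' = f(k := y)"
  have dens: "(1 - \<epsilon>) * dens G f v \<le> (1 + \<epsilon>) * dens G f' v"
      "(1 - \<epsilon>) * dens G f' v \<le> (1 + \<epsilon>) * dens G f v" for v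
  proof (atomize (full), cases "k \<in> G")
    case True
    define d where "d = dens (G - {k}) f v"
    have d: "0 \<le> d"
      unfolding d_def using dens_pos[of "G - {k}" f v] by simp
    have "dens (G - {k}) f' v = d"
      unfolding d_def f'_def by (simp add: dens_upd)
    moreover have "dens G h v = (1 + \<epsilon> * g (h k) v) * dens (G - {k}) h v" for h
      unfolding dens_def using True assms by (rule prod.remove[rotated])
    ultimately have eq: "dens G f v = (1 + \<epsilon> * g (f k) v) * d" "dens G f' v = (1 + \<epsilon> * g y v) * d"
      by (simp_all add: d_def f'_def)
    have "(1 - \<epsilon>) * (1 + \<epsilon> * g z v) \<le> (1 + \<epsilon>) * (1 + \<epsilon> * g z' v)" for z z'
      using g_cases[of z v] g_cases[of z' v] eps_pos eps_le by (auto simp: algebra_simps)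
    from mult_right_mono[OF this d] show "(1 - \<epsilon>) * dens G f v \<le> (1 + \<epsilon>) * dens G f' v \<and>
        (1 - \<epsilon>) * dens G f' v \<le> (1 + \<epsilon>) * dens G f v"
      by (simp add: eq mult.assoc)
  next
    case False
    then show "(1 - \<epsilon>) * dens G f v \<le> (1 + \<epsilon>) * dens G f' v \<and>
        (1 - \<epsilon>) * dens G f' v \<le> (1 + \<epsilon>) * dens G f v"
      using dens_pos[of G f v] eps_pos by (simp add: f'_def dens_upd)
  qed
  define Z Z' where "Z = (\<Sum>v<q. dens G f v)" and "Z' = (\<Sum>v<q. dens G f' v)"
  have Z: "0 < Z" "0 < Z'"
    unfolding Z_def Z'_def by (rule dens_sum_pos)+
  have ZZ: "(1 - \<epsilon>) * Z \<le> (1 + \<epsilon>) * Z'" "(1 - \<epsilon>) * Z' \<le> (1 + \<epsilon>) * Z"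
    unfolding Z_def Z'_def sum_distrib_left by (intro sum_mono dens)+
  define a a' where "a = dens G f v" and "a' = dens G f' v"
  have a: "0 < a" "0 < a'" "(1 - \<epsilon>) * a \<le> (1 + \<epsilon>) * a'" "(1 - \<epsilon>) * a' \<le> (1 + \<epsilon>) * a"
    unfolding a_def a'_def using dens_pos dens by auto
  have e: "0 < 1 - \<epsilon>" "0 < 1 + \<epsilon>"
    using eps_pos eps_le by auto
  \<comment> \<open>The ratio of the densities and that of the normalisers both lie between (1 -
    \<epsilon>) / (1 + \<epsilon>) and its inverse; for \<epsilon> <= 1/10 the square of this
    inverse is at most 1 + 5 \<epsilon>.\<close>
  have e2: "(1 + \<epsilon>)\<^sup>2 \<le> (1 + 5 * \<epsilon>) * (1 - \<epsilon>)\<^sup>2" "(1 - 5 * \<epsilon>) * (1 + \<epsilon>)\<^sup>2 \<le> (1 - \<epsilon>)\<^sup>2"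
  proof -
    have "10 * (\<epsilon> * \<epsilon>) \<le> \<epsilon>"
      using mult_right_mono[OF eps_le, of \<epsilon>] eps_pos by simp
    moreover have "0 < \<epsilon> * \<epsilon>" "0 < \<epsilon> * \<epsilon> * \<epsilon>"
      using eps_pos by simp_all
    moreover have "(1 + \<epsilon>)\<^sup>2 = 1 + 2 * \<epsilon> + \<epsilon> * \<epsilon>" "(1 - \<epsilon>)\<^sup>2 = 1 - 2 * \<epsilon> + \<epsilon> * \<epsilon>"
      "(1 + 5 * \<epsilon>) * (1 - \<epsilon>)\<^sup>2 = 1 + 3 * \<epsilon> - 9 * (\<epsilon> * \<epsilon>) + 5 * (\<epsilon> * \<epsilon> * \<epsilon>)"
      "(1 - 5 * \<epsilon>) * (1 + \<epsilon>)\<^sup>2 = 1 - 3 * \<epsilon> - 9 * (\<epsilon> * \<epsilon>) - 5 * (\<epsilon> * \<epsilon> * \<epsilon>)"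
      by (simp_all add: power2_eq_square algebra_simps)
    ultimately show "(1 + \<epsilon>)\<^sup>2 \<le> (1 + 5 * \<epsilon>) * (1 - \<epsilon>)\<^sup>2" "(1 - 5 * \<epsilon>) * (1 + \<epsilon>)\<^sup>2 \<le> (1 - \<epsilon>)\<^sup>2"
      using eps_pos by linarith+
  qed
  have "(1 - \<epsilon>)\<^sup>2 * (a * Z') = ((1 - \<epsilon>) * a) * ((1 - \<epsilon>) * Z')"
    by (simp add: power2_eq_square)
  also have "\<dots> \<le> ((1 + \<epsilon>) * a') * ((1 + \<epsilon>) * Z)"
    using a Z e ZZ by (intro mult_mono[of "(1 - \<epsilon>) * _"]) auto
  also have "\<dots> = (1 + \<epsilon>)\<^sup>2 * (a' * Z)"
    by (simp add: power2_eq_square)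
  also have "\<dots> \<le> (1 + 5 * \<epsilon>) * (1 - \<epsilon>)\<^sup>2 * (a' * Z)"
    using e2(1) a Z by (intro mult_right_mono) auto
  finally have "(1 - \<epsilon>)\<^sup>2 * (a * Z') \<le> (1 - \<epsilon>)\<^sup>2 * ((1 + 5 * \<epsilon>) * (a' * Z))"
    by (simp add: mult_ac)
  then have "a * Z' \<le> (1 + 5 * \<epsilon>) * (a' * Z)"
    using e by (simp add: mult_le_cancel_left_pos)
  then have "a / Z \<le> (1 + 5 * \<epsilon>) * (a' / Z')"
    using Z by (simp add: field_simps)
  then show "law G f v \<le> (1 + 5 * \<epsilon>) * law G (f(k := y)) v"
    unfolding law_def a_def a'_def Z_def Z'_def f'_def .
  have "(1 + \<epsilon>)\<^sup>2 * ((1 - 5 * \<epsilon>) * (a' * Z)) = ((1 - 5 * \<epsilon>) * (1 + \<epsilon>)\<^sup>2) * (a' * Z)"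
    by simp
  also have "\<dots> \<le> (1 - \<epsilon>)\<^sup>2 * (a' * Z)"
    using e2(2) a Z by (intro mult_right_mono) auto
  also have "\<dots> = ((1 - \<epsilon>) * a') * ((1 - \<epsilon>) * Z)"
    by (simp add: power2_eq_square)
  also have "\<dots> \<le> ((1 + \<epsilon>) * a) * ((1 + \<epsilon>) * Z')"
    using a Z e ZZ by (intro mult_mono[of "(1 - \<epsilon>) * _"]) auto
  also have "\<dots> = (1 + \<epsilon>)\<^sup>2 * (a * Z')"
    by (simp add: power2_eq_square)
  finally have "(1 - 5 * \<epsilon>) * (a' * Z) \<le> a * Z'"
    using e by (simp add: mult_le_cancel_left_pos)
  then have "(1 - 5 * \<epsilon>) * (a' / Z') \<le> a / Z"
    using Z by (simp add: field_simps)
  then show "(1 - 5 * \<epsilon>) * law G (f(k := y)) v \<le> law G f v"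
    unfolding law_def a_def a'_def Z_def Z'_def f'_def .
qed

text \<open>The sum is 1 plus the chi-square divergence of the two laws, and a relative error of 5
  \<epsilon> bounds that divergence by its square.\<close>

lemma law_chi_square:
  assumes "finite G"
  shows "(\<Sum>v<q. (law G f v)\<^sup>2 / law G (f(k := y)) v) \<le> 1 + 25 * \<epsilon>\<^sup>2"
proof -
  define l l' where "l = law G f" and "l' = law G (f(k := y))"
  have pt: "(l v)\<^sup>2 / l' v \<le> 25 * \<epsilon>\<^sup>2 * l' v + 2 * l v - l' v" for v
  proof -
    have pos: "0 < l' v"
      unfolding l'_def by (rule law_pos)
    have "\<bar>l v - l' v\<bar> \<le> 5 * \<epsilon> * l' v"
      using law_upd_bounds[OF assms, where f = f and v = v and k = k and y = y] unfolding l_def l'_def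
      by (simp add: abs_le_iff algebra_simps)
    then have "(l v - l' v)\<^sup>2 \<le> (5 * \<epsilon> * l' v)\<^sup>2"
      using power_mono[of "\<bar>l v - l' v\<bar>" "5 * \<epsilon> * l' v" 2] by simp
    then have "(l v)\<^sup>2 \<le> (25 * \<epsilon>\<^sup>2 * l' v + 2 * l v - l' v) * l' v"
      by (simp add: power2_eq_square algebra_simps)
    then show ?thesis
      using pos by (simp add: divide_le_eq)
  qed
  have "(\<Sum>v<q. (l v)\<^sup>2 / l' v) \<le> (\<Sum>v<q. 25 * \<epsilon>\<^sup>2 * l' v + 2 * l v - l' v)"
    by (intro sum_mono pt)
  also have "\<dots> = 25 * \<epsilon>\<^sup>2 * (\<Sum>v<q. l' v) + 2 * (\<Sum>v<q. l v) - (\<Sum>v<q. l' v)"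
    by (simp only: sum.distrib sum_subtractf sum_distrib_left)
  also have "\<dots> = 1 + 25 * \<epsilon>\<^sup>2"
    unfolding l_def l'_def law_sum by simp
  finally show ?thesis
    unfolding l_def l'_def .
qed

text \<open>\<open>jp (f(k := y))\<close> is the weight of f when the testers see y at k, whatever
  \<open>f k\<close> is. The ratio factorises over the coordinates; only the testers adjacent to k,
  at most T of them, have a bound above 1, and \<open>eps_T\<close> keeps the product below
  e.\<close>

lemma jp_chi_square:
  assumes k: "k < R" and y: "y < q"
  shows "(\<Sum>f\<in>cfg n q. (jp f)\<^sup>2 / jp (f(k := y))) \<le> exp 1"
proof -
  define \<kappa> where "\<kappa> = (\<lambda>i f. (wt i f)\<^sup>2 / wt i (f(k := y)))"
  define A where "A = {c \<in> {R..<n}. k \<in> \<Gamma> c}"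
  define b where "b = (\<lambda>i. if i \<in> A then 1 + 25 * \<epsilon>\<^sup>2 else 1)"
  have "(\<Sum>f\<in>cfg n q. (jp f)\<^sup>2 / jp (f(k := y))) = (\<Sum>f\<in>cfg n q. \<Prod>i<n. \<kappa> i f)"
    unfolding jp_def \<kappa>_def by (simp add: prod_dividef prod_power_distrib)
  also have "\<dots> \<le> (\<Prod>i<n. b i)"
  proof (rule sum_prod_chain_le[where \<sigma> = "\<lambda>i. i"])
    show "0 \<le> \<kappa> i f" for i f
      unfolding \<kappa>_def using less_imp_le[OF wt_pos] by simp
    show "\<kappa> i (f(t := v)) = \<kappa> i f" if "i < t" for i t f v
    proof (cases "i < R")
      case True
      then show ?thesis by (simp add: \<kappa>_def wt_def)
    next
      case False
      then have "t \<noteq> k"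
        using that k by auto
      then show ?thesis
        using that by (simp add: \<kappa>_def fun_upd_twist wt_upd_later)
    qed
    fix i f assume i: "i < n" and f: "f \<in> cfg n q"
    show "(\<Sum>v<q. \<kappa> i (f(i := v))) \<le> b i"
    proof (cases "i < R")
      case True
      then show ?thesis
        using q_pos by (simp add: \<kappa>_def wt_def b_def A_def power2_eq_square)
    next
      case False
      then have ik: "i \<noteq> k" and iR: "R \<le> i"
        using k by auto
      then have eq: "\<kappa> i (f(i := v)) = (law (\<Gamma> i) f v)\<^sup>2 / law (\<Gamma> i) (f(k := y)) v" for v
        unfolding \<kappa>_def using fun_upd_twist[OF ik, of f v y] by (simp add: wt_upd_self)
      show ?thesis
      proof (cases "k \<in> \<Gamma> i")
        case True
        then show ?thesis
          unfolding eq using iR i law_chi_square[OF finite_nbr, of i f k y] by (simp add: b_def A_def)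
      next
        case False
        then show ?thesis
          unfolding eq using iR i law_pos[of "\<Gamma> i" f]
          by (simp add: b_def A_def law_upd power2_eq_square law_sum less_imp_neq[symmetric])
      qed
    qed
  qed (use q_pos in auto)
  also have "\<dots> = (1 + 25 * \<epsilon>\<^sup>2) ^ card A"
  proof -
    have "{..<n} \<inter> A = A"
      by (auto simp: A_def)
    then show ?thesis
      unfolding b_def by (simp add: prod.If_cases)
  qed
  also have "\<dots> \<le> (1 + 25 * \<epsilon>\<^sup>2) ^ T"
    using degree[OF k] unfolding A_def by (intro power_increasing) auto
  also have "\<dots> \<le> exp (25 * \<epsilon>\<^sup>2) ^ T"
    by (intro power_mono exp_ge_add_one_self) auto
  also have "\<dots> = exp (25 * \<epsilon>\<^sup>2 * real T)"
    by (simp add: exp_of_nat_mult mult.commute)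
  also have "\<dots> \<le> exp 1"
    using eps_T by simp
  finally show ?thesis .
qed

text \<open>An unrevealed neighbour \<open>k\<close> is nearly uniform given the revealed coordinates. Its posterior is
  compared with the uniform law by resampling it and applying the Cauchy--Schwarz inequality; the
  cost is the chi-square divergence above.\<close>

lemma prob_correlation_large:
  assumes c: "R \<le> c" "c < n" "c \<notin> S" and k: "k < R" "k \<notin> S"
  shows "(\<Sum>f | f \<in> cfg n q \<and> \<epsilon> / 4 \<le> cexp S (\<lambda>h. g (f k) (h c)) f. jp f) \<le> 32 / (\<epsilon> * sqrt (real q))"
proof -
  define A where "A = (\<lambda>y. cexp S (corr (\<Gamma> c) y))"
  define \<phi> where "\<phi> = (\<lambda>f. \<bar>A (f k) f\<bar>)"
  define B where "B = (\<Sum>f\<in>cfg n q. jp f * \<phi> f)"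
  have kn: "k < n"
    using k R_le by simp
  have A_upd: "A y (f(k := v)) = A y f" for y f v
    unfolding A_def by (rule cexp_cong) (use k in auto)
  \<comment> \<open>The split of \<open>jp f\<close> puts the resampled weight into the first
    factor, to be undone by reversibility, and leaves the chi-square sum of
    \<open>jp_chi_square\<close> in the second.\<close>
  have "(\<Sum>f\<in>cfg n q. \<Sum>y<q. jp f * \<phi> f)\<^sup>2
      = (\<Sum>(f, y)\<in>cfg n q \<times> {..<q}. (sqrt (jp (f(k := y))) * \<phi> f) * (jp f / sqrt (jp (f(k := y)))))\<^sup>2"
    unfolding sum.cartesian_product
    by (intro arg_cong[where f = "\<lambda>x. x\<^sup>2"] sum.cong refl) (auto simp: less_imp_neq[OF jp_pos, symmetric])
  also have "\<dots> = (\<Sum>p\<in>cfg n q \<times> {..<q}. (sqrt (jp ((fst p)(k := snd p))) * \<phi> (fst p))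
      * (jp (fst p) / sqrt (jp ((fst p)(k := snd p)))))\<^sup>2"
    by (simp add: case_prod_unfold)
  also have "\<dots> \<le> (\<Sum>p\<in>cfg n q \<times> {..<q}. (sqrt (jp ((fst p)(k := snd p))) * \<phi> (fst p))\<^sup>2)
      * (\<Sum>p\<in>cfg n q \<times> {..<q}. (jp (fst p) / sqrt (jp ((fst p)(k := snd p))))\<^sup>2)"
    by (rule Cauchy_Schwarz_ineq_sum)
  also have "(\<Sum>p\<in>cfg n q \<times> {..<q}. (sqrt (jp ((fst p)(k := snd p))) * \<phi> (fst p))\<^sup>2)
      = (\<Sum>f\<in>cfg n q. \<Sum>y<q. jp (f(k := y)) * (\<phi> f)\<^sup>2)"
    unfolding sum.cartesian_product
    by (intro sum.cong refl) (simp add: case_prod_unfold power_mult_distrib less_imp_le[OF jp_pos])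
  also have "(\<Sum>p\<in>cfg n q \<times> {..<q}. (jp (fst p) / sqrt (jp ((fst p)(k := snd p))))\<^sup>2)
      = (\<Sum>f\<in>cfg n q. \<Sum>y<q. (jp f)\<^sup>2 / jp (f(k := y)))"
    unfolding sum.cartesian_product
    by (intro sum.cong refl) (simp add: case_prod_unfold power_divide less_imp_le[OF jp_pos])
  \<comment> \<open>Exchanging y with the value at k frees the row index: \<open>A\<close> ignores
    \<open>f k\<close> because k is not in S, so y now ranges over all rows and Bessel
    applies.\<close>
  also have "(\<Sum>f\<in>cfg n q. \<Sum>y<q. jp (f(k := y)) * (\<phi> f)\<^sup>2)
      = (\<Sum>f\<in>cfg n q. \<Sum>y<q. jp f * (\<phi> (f(k := y)))\<^sup>2)"
    using sum_cfg_swap[OF kn, of "\<lambda>f f'. jp f' * (\<phi> f)\<^sup>2" q] by simp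
  also have "\<dots> = (\<Sum>f\<in>cfg n q. \<Sum>y<q. jp f * (A y f)\<^sup>2)"
    by (simp add: \<phi>_def A_upd)
  finally have CS: "(\<Sum>f\<in>cfg n q. \<Sum>y<q. jp f * \<phi> f)\<^sup>2
      \<le> (\<Sum>f\<in>cfg n q. \<Sum>y<q. jp f * (A y f)\<^sup>2) * (\<Sum>f\<in>cfg n q. \<Sum>y<q. (jp f)\<^sup>2 / jp (f(k := y)))" .
  have first: "(\<Sum>f\<in>cfg n q. \<Sum>y<q. jp f * (A y f)\<^sup>2) \<le> 16"
  proof -
    have "(\<Sum>f\<in>cfg n q. \<Sum>y<q. jp f * (A y f)\<^sup>2)
        \<le> (\<Sum>f\<in>cfg n q. \<Sum>y<q. jp f * cexp S (\<lambda>h. (corr (\<Gamma> c) y h)\<^sup>2) f)"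
      unfolding A_def by (intro sum_mono mult_left_mono cexp_square_le less_imp_le[OF jp_pos])
    also have "\<dots> = (\<Sum>y<q. \<Sum>f\<in>cfg n q. jp f * (corr (\<Gamma> c) y f)\<^sup>2)"
      by (subst sum.swap) (simp only: cexp_tower)
    also have "\<dots> = (\<Sum>f\<in>cfg n q. jp f * (\<Sum>y<q. (corr (\<Gamma> c) y f)\<^sup>2))"
      by (subst sum.swap) (simp only: sum_distrib_left)
    also have "\<dots> = (\<Sum>f\<in>cfg n q. \<Sum>y<q. (corr (\<Gamma> c) y f)\<^sup>2) / real q ^ n"
    proof (rule sum_jp_revealers)
      fix t f v assume t: "R \<le> t"
      then have "t \<notin> \<Gamma> c"
        using nbr_less[of t c] by auto
      then show "(\<Sum>y<q. (corr (\<Gamma> c) y (f(t := v)))\<^sup>2) = (\<Sum>y<q. (corr (\<Gamma> c) y f)\<^sup>2)"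
        by (simp add: corr_upd)
    qed
    also have "\<dots> \<le> 16 * real q ^ n / real q ^ n"
      by (intro divide_right_mono corr_second_moment nbr card_nbr) simp
    finally show ?thesis
      using q_pos by simp
  qed
  have second: "(\<Sum>f\<in>cfg n q. \<Sum>y<q. (jp f)\<^sup>2 / jp (f(k := y))) \<le> real q * 4"
  proof -
    have "(\<Sum>f\<in>cfg n q. \<Sum>y<q. (jp f)\<^sup>2 / jp (f(k := y))) \<le> (\<Sum>y<q. exp 1)"
      by (subst sum.swap) (intro sum_mono jp_chi_square k, simp)
    also have "\<dots> \<le> (\<Sum>y<q. 4)"
      using exp_le by (intro sum_mono) simp
    finally show ?thesis by simp
  qed
  have "(real q * B)\<^sup>2 = (\<Sum>f\<in>cfg n q. \<Sum>y<q. jp f * \<phi> f)\<^sup>2"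
    unfolding B_def by (simp add: sum_distrib_left)
  also have "\<dots> \<le> 16 * (real q * 4)"
    by (rule order_trans[OF CS]) (intro mult_mono first second sum_nonneg divide_nonneg_nonneg less_imp_le[OF jp_pos], simp_all)
  finally have "B\<^sup>2 \<le> 8\<^sup>2 / real q"
    using q_pos by (simp add: power2_eq_square field_simps)
  then have B: "B \<le> 8 / sqrt (real q)"
    by (rule inverse_q_sqrt) simp
  have "(\<Sum>f | f \<in> cfg n q \<and> \<epsilon> / 4 \<le> cexp S (\<lambda>h. g (f k) (h c)) f. jp f)
      \<le> (\<Sum>f | f \<in> cfg n q \<and> \<epsilon> / 4 \<le> \<phi> f. jp f)"
    by (rule sum_mono2) (auto simp: \<phi>_def A_def cexp_tester[OF c] intro: less_imp_le jp_pos)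
  also have "\<dots> \<le> B / (\<epsilon> / 4)"
    unfolding B_def using eps_pos by (intro sum_jp_markov) (auto simp: \<phi>_def)
  also have "\<dots> \<le> (8 / sqrt (real q)) / (\<epsilon> / 4)"
    using B eps_pos by (intro divide_right_mono) auto
  finally show ?thesis
    by (simp add: mult_ac)
qed

end

section \<open>The law of the coupler\<close>

lemma measure_PiM_Collect:
  assumes "\<And>i. prob_space (M i)" "J \<subseteq> I" "finite J" "\<And>i. i \<in> J \<Longrightarrow> X i \<in> sets (M i)"
  shows "measure (PiM I M) {x \<in> space (PiM I M). \<forall>i\<in>J. x i \<in> X i} = (\<Prod>i\<in>J. measure (M i) (X i))"
proof -
  interpret product_prob_space M I
    using assms(1) unfolding product_prob_space_def product_prob_space_axioms_def product_sigma_finite_def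
    by (auto intro: prob_space_imp_sigma_finite)
  have "{x \<in> space (PiM I M). \<forall>i\<in>J. x i \<in> X i} = prod_emb I M J (Pi\<^sub>E J X)"
    unfolding prod_emb_def using assms(2) by (auto simp: space_PiM Pi_iff)
  then show ?thesis
    using measure_PiM_emb[OF assms(2-4)] by simp
qed

lemma is_dist_on_le_1: "is_dist_on q \<nu> \<Longrightarrow> \<nu> v \<le> 1"
proof (cases "v < q")
  case True
  assume "is_dist_on q \<nu>"
  then show ?thesis
    using member_le_sum[of v "{..<q}" \<nu>] True by (auto simp: is_dist_on_def)
qed (auto simp: is_dist_on_def)

definition seed_pair :: "nat \<Rightarrow> (nat \<times> real) measure" where
  "seed_pair q = uniform_count_measure {..<q} \<Otimes>\<^sub>M uniform_measure lborel {0..1}"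

lemma seed_space_eq: "seed_space q = PiM UNIV (\<lambda>_. seed_pair q)"
  unfolding seed_space_def seed_pair_def ..

lemma space_seed_pair: "space (seed_pair q) = {..<q} \<times> UNIV"
  unfolding seed_pair_def by (simp add: space_pair_measure space_uniform_count_measure)

lemma prob_space_uniform_unit: "prob_space (uniform_measure lborel {0..1::real})"
  by (intro prob_space_uniform_measure) auto

lemma prob_space_seed_pair: "q > 0 \<Longrightarrow> prob_space (seed_pair q)"
  unfolding seed_pair_def
  by (intro prob_space_pair prob_space_uniform_unit prob_space_uniform_count_measure) auto

lemma prob_space_seed: "q > 0 \<Longrightarrow> prob_space (seed_space q)"
  unfolding seed_space_eq by (intro prob_space_PiM prob_space_seed_pair)

lemma measurable_fst_seed_pair: "fst \<in> seed_pair q \<rightarrow>\<^sub>M count_space UNIV"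
proof -
  have "fst \<in> seed_pair q \<rightarrow>\<^sub>M uniform_count_measure {..<q}"
    unfolding seed_pair_def by (rule measurable_fst)
  moreover have "(\<lambda>x. x) \<in> uniform_count_measure {..<q} \<rightarrow>\<^sub>M count_space UNIV"
    by (auto simp: measurable_def sets_uniform_count_measure space_uniform_count_measure)
  ultimately show ?thesis
    by (rule measurable_compose)
qed

lemma measurable_snd_seed_pair: "snd \<in> seed_pair q \<rightarrow>\<^sub>M borel"
proof -
  have "snd \<in> seed_pair q \<rightarrow>\<^sub>M uniform_measure lborel {0..1}"
    unfolding seed_pair_def by (rule measurable_snd)
  then show ?thesis
    by (simp cong: measurable_cong_sets)
qed

definition accept :: "nat \<Rightarrow> (nat \<Rightarrow> real) \<Rightarrow> nat set \<Rightarrow> (nat \<times> real) set" where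
  "accept q \<nu> V = {z \<in> space (seed_pair q). fst z \<in> V \<and> snd z \<le> \<nu> (fst z)}"

lemma accept_sets [measurable]: "accept q \<nu> V \<in> sets (seed_pair q)"
proof -
  note [measurable] = measurable_fst_seed_pair measurable_snd_seed_pair
  have [measurable]: "(\<lambda>z. \<nu> (fst z)) \<in> seed_pair q \<rightarrow>\<^sub>M borel"
    by (rule measurable_compose[OF measurable_fst_seed_pair]) simp
  show ?thesis
    unfolding accept_def by measurable
qed

lemma measure_accept_single:
  assumes \<nu>: "is_dist_on q \<nu>" and v: "v < q"
  shows "measure (seed_pair q) (accept q \<nu> {v}) = \<nu> v / real q"
proof -
  have q: "q > 0"
    using v by simp
  interpret U: prob_space "uniform_measure lborel {0..1::real}"
    by (rule prob_space_uniform_unit)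
  interpret C: prob_space "uniform_count_measure {..<q}"
    using q by (intro prob_space_uniform_count_measure) auto
  interpret P: pair_prob_space "uniform_count_measure {..<q}" "uniform_measure lborel {0..1::real}" ..
  have "accept q \<nu> {v} = {v} \<times> {..\<nu> v}"
    using v by (auto simp: accept_def space_seed_pair)
  then have "measure (seed_pair q) (accept q \<nu> {v})
      = measure (uniform_count_measure {..<q}) {v} * measure (uniform_measure lborel {0..1}) {..\<nu> v}"
    unfolding seed_pair_def using v
    by (simp add: measure_def U.emeasure_pair_measure_Times sets_uniform_count_measure enn2real_mult)
  also have "measure (uniform_count_measure {..<q}) {v} = 1 / real q"
    using v by (simp add: measure_uniform_count_measure)
  also have "measure (uniform_measure lborel {0..1::real}) {..\<nu> v} = \<nu> v"
  proof -
    have "{0..1} \<inter> {..\<nu> v} = {0..\<nu> v}"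
      using is_dist_on_le_1[OF \<nu>, of v] by auto
    then show ?thesis
      using \<nu> by (simp add: is_dist_on_def)
  qed
  finally show ?thesis
    by simp
qed

lemma measure_accept:
  assumes \<nu>: "is_dist_on q \<nu>" and q: "q > 0"
  shows "measure (seed_pair q) (accept q \<nu> UNIV) = 1 / real q"
proof -
  interpret prob_space "seed_pair q"
    by (rule prob_space_seed_pair[OF q])
  have "accept q \<nu> UNIV = (\<Union>v<q. accept q \<nu> {v})"
    by (auto simp: accept_def space_seed_pair)
  also have "measure (seed_pair q) \<dots> = (\<Sum>v<q. measure (seed_pair q) (accept q \<nu> {v}))"
  proof (rule finite_measure_finite_Union)
    show "(\<lambda>v. accept q \<nu> {v}) ` {..<q} \<subseteq> events"
      using accept_sets by auto
  qed (auto simp: disjoint_family_on_def accept_def)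
  also have "\<dots> = (\<Sum>v<q. \<nu> v / real q)"
    by (intro sum.cong refl measure_accept_single[OF \<nu>]) auto
  also have "\<dots> = 1 / real q"
    using \<nu> by (simp add: is_dist_on_def flip: sum_divide_distrib)
  finally show ?thesis .
qed

lemma measurable_min_coupler: "min_coupler \<nu> \<in> seed_space q \<rightarrow>\<^sub>M count_space UNIV"
proof -
  have comp: "(\<lambda>r. r k) \<in> seed_space q \<rightarrow>\<^sub>M seed_pair q" for k
    unfolding seed_space_eq by (rule measurable_component_singleton) simp
  have coord: "(\<lambda>r. fst (r k)) \<in> seed_space q \<rightarrow>\<^sub>M count_space UNIV" for k
    by (rule measurable_compose[OF comp measurable_fst_seed_pair])
  have height: "(\<lambda>r. snd (r k)) \<in> seed_space q \<rightarrow>\<^sub>M borel" for k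
    by (rule measurable_compose[OF comp measurable_snd_seed_pair])
  have "\<nu> \<in> count_space UNIV \<rightarrow>\<^sub>M borel"
    by simp
  note level = measurable_compose[OF coord this]
  have pred [measurable]: "Measurable.pred (seed_space q) (\<lambda>r. snd (r k) \<le> \<nu> (fst (r k)))" for k
    unfolding pred_def by (rule borel_measurable_le[OF height level])
  have index: "(\<lambda>r. LEAST k. snd (r k) \<le> \<nu> (fst (r k))) \<in> seed_space q \<rightarrow>\<^sub>M count_space UNIV"
    by (rule measurable_Least[OF pred])
  have "Measurable.pred (seed_space q) (\<lambda>r. \<exists>k. snd (r k) \<le> \<nu> (fst (r k)))"
    by (rule pred_intros_countable(2)[OF pred])
  then show ?thesis
    unfolding min_coupler_def
    by (intro measurable_If measurable_compose_countable[where f = "\<lambda>k r. fst (r k)", OF coord index])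
       (auto simp: pred_def)
qed

lemma min_coupler_less: "r \<in> space (seed_space q) \<Longrightarrow> q > 0 \<Longrightarrow> min_coupler \<nu> r < q"
  unfolding min_coupler_def seed_space_eq
  by (auto simp: space_PiM space_seed_pair PiE_iff mem_Times_iff)

text \<open>\<open>E k\<close> is the event that the first accepted pair has index k and value v,
  after k rejections of probability \<rho> each; these masses form a geometric series with total
  \<open>\<nu> v\<close>. \<open>F K\<close> holds the runs without acceptance among the first K
  pairs, among them those with the default output 0, and its mass tends to 0.\<close>

lemma measure_min_coupler_le:
  assumes \<nu>: "is_dist_on q \<nu>" and v: "v < q"
  shows "measure (seed_space q) {r \<in> space (seed_space q). min_coupler \<nu> r = v} \<le> \<nu> v"
proof -
  have q: "q > 0"
    using v by simp
  interpret S: prob_space "seed_space q"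
    by (rule prob_space_seed[OF q])
  interpret Q: prob_space "seed_pair q"
    by (rule prob_space_seed_pair[OF q])
  define A B where "A = accept q \<nu> UNIV" and "B = space (seed_pair q) - A"
  define \<rho> where "\<rho> = 1 - 1 / real q"
  have [measurable]: "A \<in> sets (seed_pair q)" "B \<in> sets (seed_pair q)"
    unfolding A_def B_def by measurable
  have mB: "measure (seed_pair q) B = \<rho>"
    unfolding B_def \<rho>_def using Q.prob_compl[of A] measure_accept[OF \<nu> q] by (simp add: A_def)
  have \<rho>: "0 \<le> \<rho>" "\<rho> < 1"
    unfolding \<rho>_def using q by (auto simp: field_simps)
  define E where "E = (\<lambda>k. {r \<in> space (seed_space q). \<forall>j\<in>{..k}. r j \<in> (if j = k then accept q \<nu> {v} else B)})"
  define F where "F = (\<lambda>K. {r \<in> space (seed_space q). \<forall>j\<in>{..<K}. r j \<in> B})"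
  have E: "measure (seed_space q) (E k) = \<rho> ^ k * (\<nu> v / real q)" for k
  proof -
    have "measure (seed_space q) (E k) = (\<Prod>j\<in>{..k}. measure (seed_pair q) (if j = k then accept q \<nu> {v} else B))"
      unfolding E_def seed_space_eq by (intro measure_PiM_Collect prob_space_seed_pair q) auto
    also have "\<dots> = (\<Prod>j<k. measure (seed_pair q) B) * measure (seed_pair q) (accept q \<nu> {v})"
      unfolding lessThan_Suc_atMost[symmetric] prod.lessThan_Suc by simp
    finally show ?thesis
      by (simp add: mB measure_accept_single[OF \<nu> v])
  qed
  have F: "measure (seed_space q) (F K) = \<rho> ^ K" for K
    unfolding F_def seed_space_eq
    by (subst measure_PiM_Collect) (auto simp: mB prob_space_seed_pair q)
  have EF [measurable]: "E k \<in> sets (seed_space q)" "F k \<in> sets (seed_space q)" for k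
  proof -
    have [measurable]: "(if j = k then accept q \<nu> {v} else B) \<in> sets (seed_pair q)" for j
      by simp
    show "E k \<in> sets (seed_space q)" "F k \<in> sets (seed_space q)"
      unfolding E_def F_def seed_space_eq by measurable
  qed
  have bound: "measure (seed_space q) {r \<in> space (seed_space q). min_coupler \<nu> r = v} \<le> \<nu> v + \<rho> ^ K" for K
  proof -
    have "{r \<in> space (seed_space q). min_coupler \<nu> r = v} \<subseteq> (\<Union>k<K. E k) \<union> F K"
    proof
      fix r assume "r \<in> {r \<in> space (seed_space q). min_coupler \<nu> r = v}"
      then have r: "r \<in> space (seed_space q)" and out: "min_coupler \<nu> r = v"
        by auto
      have rk: "r k \<in> space (seed_pair q)" for k
        using r by (auto simp: seed_space_eq space_PiM)
      show "r \<in> (\<Union>k<K. E k) \<union> F K"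
      proof (cases "\<exists>k<K. snd (r k) \<le> \<nu> (fst (r k))")
        case True
        define m where "m = (LEAST k. snd (r k) \<le> \<nu> (fst (r k)))"
        have m: "snd (r m) \<le> \<nu> (fst (r m))" "m < K"
          unfolding m_def using True by (auto intro: LeastI Least_le le_less_trans)
        have "fst (r m) = v"
          using out True by (auto simp: min_coupler_def m_def split: if_splits)
        moreover have "\<not> snd (r j) \<le> \<nu> (fst (r j))" if "j < m" for j
          using not_less_Least[of j] that unfolding m_def by blast
        ultimately have "r \<in> E m"
          using r rk m(1) by (auto simp: E_def B_def A_def accept_def)
        then show ?thesis
          using m(2) by blast
      next
        case False
        then have "r \<in> F K"
          using r rk by (auto simp: F_def B_def A_def accept_def)
        then show ?thesis ..
      qed
    qed
    then have "measure (seed_space q) {r \<in> space (seed_space q). min_coupler \<nu> r = v}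
        \<le> measure (seed_space q) ((\<Union>k<K. E k) \<union> F K)"
      by (intro S.finite_measure_mono) auto
    also have "\<dots> \<le> measure (seed_space q) (\<Union>k<K. E k) + measure (seed_space q) (F K)"
      by (intro measure_Un_le) auto
    also have "measure (seed_space q) (\<Union>k<K. E k) \<le> (\<Sum>k<K. measure (seed_space q) (E k))"
      by (intro S.finite_measure_subadditive_finite) auto
    also have "\<dots> = \<nu> v * ((1 - \<rho>) * (\<Sum>k<K. \<rho> ^ k))"
      unfolding E \<rho>_def by (simp add: sum_distrib_left mult_ac)
    also have "(1 - \<rho>) * (\<Sum>k<K. \<rho> ^ k) = 1 - \<rho> ^ K"
      using one_diff_power_eq[of \<rho> K] by simp
    also have "\<nu> v * (1 - \<rho> ^ K) \<le> \<nu> v * 1"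
      using \<nu> \<rho> by (intro mult_left_mono) (auto simp: is_dist_on_def)
    finally show ?thesis
      by (simp add: F)
  qed
  have "(\<lambda>K. \<nu> v + \<rho> ^ K) \<longlonglongrightarrow> \<nu> v + 0"
    using \<rho> by (intro tendsto_intros LIMSEQ_power_zero) auto
  then show ?thesis
    using bound by (intro LIMSEQ_le_const[where X = "\<lambda>K. \<nu> v + \<rho> ^ K"]) auto
qed

section \<open>The sampler in terms of the sequential output\<close>

lemma cond_law_cong:
  assumes "\<And>j. j \<in> S \<Longrightarrow> \<tau> j = \<tau>' j"
  shows "cond_law \<mu> dflt i S \<tau> = cond_law \<mu> dflt i S \<tau>'"
proof -
  have cyl: "{xs. \<forall>j\<in>S. xs ! j = \<tau> j} = {xs. \<forall>j\<in>S. xs ! j = \<tau>' j}"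
    using assms by auto
  have "{xs. xs ! i = v \<and> (\<forall>j\<in>S. xs ! j = \<tau> j)} = {xs. xs ! i = v \<and> (\<forall>j\<in>S. xs ! j = \<tau>' j)}" for v
    using assms by auto
  then show ?thesis
    unfolding cond_law_def fun_eq_iff by (simp only: cyl) simp
qed

lemma is_dist_on_cond_law:
  assumes supp: "set_pmf \<mu> \<subseteq> cube q n" and dflt: "is_dist_on q dflt" and i: "i < n"
  shows "is_dist_on q (cond_law \<mu> dflt i S \<tau>)"
proof -
  define C where "C = {xs. \<forall>j\<in>S. xs ! j = \<tau> j}"
  define A where "A = (\<lambda>v. {xs. xs ! i = v \<and> (\<forall>j\<in>S. xs ! j = \<tau> j)})"
  show ?thesis
  proof (cases "measure_pmf.prob \<mu> C = 0")
    case True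
    then show ?thesis
      using dflt unfolding cond_law_def C_def Let_def by simp
  next
    case False
    then have law: "cond_law \<mu> dflt i S \<tau> = (\<lambda>v. measure_pmf.prob \<mu> (A v) / measure_pmf.prob \<mu> C)"
      by (simp add: cond_law_def C_def A_def fun_eq_iff)
    have lt: "xs ! i < q" if "xs \<in> set_pmf \<mu>" for xs
    proof -
      have "length xs = n" "set xs \<subseteq> {..<q}"
        using that supp by (auto simp: cube_def)
      then show ?thesis
        using nth_mem[of i xs] i by (metis lessThan_iff subsetD)
    qed
    have "measure_pmf.prob \<mu> (A v) = 0" if "q \<le> v" for v
      using lt that by (force simp: A_def measure_pmf_zero_iff)
    moreover have "(\<Sum>v<q. measure_pmf.prob \<mu> (A v)) = measure_pmf.prob \<mu> C"
    proof -
      have "(\<Sum>v<q. measure_pmf.prob \<mu> (A v)) = measure_pmf.prob \<mu> (\<Union>v<q. A v)"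
        by (intro measure_pmf.finite_measure_finite_Union[symmetric])
           (auto simp: disjoint_family_on_def A_def)
      also have "\<dots> = measure_pmf.prob \<mu> ((\<Union>v<q. A v) \<inter> set_pmf \<mu>)"
        by (simp add: measure_Int_set_pmf)
      also have "(\<Union>v<q. A v) \<inter> set_pmf \<mu> = C \<inter> set_pmf \<mu>"
        using lt by (auto simp: A_def C_def)
      finally show ?thesis
        by (simp add: measure_Int_set_pmf)
    qed
    ultimately show ?thesis
      unfolding law is_dist_on_def using False by (simp flip: sum_divide_distrib)
  qed
qed

locale sampler =
  fixes n q :: nat and \<mu> :: "nat list pmf" and dflt :: "nat \<Rightarrow> real" and \<sigma> :: "nat \<Rightarrow> nat"
  assumes q_pos: "q > 0"
    and supp: "set_pmf \<mu> \<subseteq> cube q n"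
    and dflt: "is_dist_on q dflt"
    and perm: "\<sigma> permutes {..<n}"
begin

text \<open>Both \<open>a\<close> and \<open>i\<close> are positions in the order \<sigma>, not
  coordinates.\<close>

definition nu :: "nat \<Rightarrow> nat \<Rightarrow> (nat \<Rightarrow> nat) \<Rightarrow> nat \<Rightarrow> real" where
  "nu a i x = cond_law \<mu> dflt (\<sigma> i) (\<sigma> ` {..<a}) x"

primrec sequential :: "(nat \<Rightarrow> nat \<Rightarrow> nat \<times> real) \<Rightarrow> nat \<Rightarrow> nat \<Rightarrow> nat" where
  "sequential u 0 = (\<lambda>_. undefined)"
| "sequential u (Suc i) = (sequential u i)(\<sigma> i := min_coupler (nu i i (sequential u i)) (u i))"

text \<open>The output of the purely sequential run with the same seeds. It is the fixed reference
  for all rounds: an entry is called final below when it agrees with it.\<close>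

definition xstar :: "(nat \<Rightarrow> nat \<Rightarrow> nat \<times> real) \<Rightarrow> nat \<Rightarrow> nat" where
  "xstar u = sequential u n"

definition mism :: "(nat \<Rightarrow> nat \<Rightarrow> nat \<times> real) \<Rightarrow> nat \<Rightarrow> nat \<Rightarrow> bool" where
  "mism u a i \<longleftrightarrow> min_coupler (nu a i (xstar u)) (u i) \<noteq> xstar u (\<sigma> i)"

lemma perm_less: "i < n \<Longrightarrow> \<sigma> i < n"
  using permutes_in_image[OF perm, of i] by simp

lemma perm_inj: "\<sigma> i = \<sigma> j \<longleftrightarrow> i = j"
  using permutes_inj[OF perm] by (auto dest: injD)

lemma perm_surj: "c < n \<Longrightarrow> \<exists>i<n. c = \<sigma> i"
  using permutes_image[OF perm] by (metis imageE lessThan_iff)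

lemma nu_cong: "(\<And>j. j < a \<Longrightarrow> x (\<sigma> j) = x' (\<sigma> j)) \<Longrightarrow> nu a i x = nu a i x'"
  unfolding nu_def by (rule cond_law_cong) auto

lemma nu_dist: "i < n \<Longrightarrow> is_dist_on q (nu a i x)"
  unfolding nu_def by (intro is_dist_on_cond_law[OF supp dflt] perm_less)

lemma nu_nonneg: "i < n \<Longrightarrow> 0 \<le> nu a i x v"
  using nu_dist by (auto simp: is_dist_on_def)

lemma nu_sum: "i < n \<Longrightarrow> (\<Sum>v<q. nu a i x v) = 1"
  using nu_dist by (auto simp: is_dist_on_def)

lemma sequential_stable: "i < m \<Longrightarrow> m \<le> m' \<Longrightarrow> sequential u m' (\<sigma> i) = sequential u m (\<sigma> i)"
  by (rotate_tac, induction m' rule: dec_induct) (auto simp: perm_inj)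

lemma xstar_step:
  assumes "i < n"
  shows "xstar u (\<sigma> i) = min_coupler (nu i i (xstar u)) (u i)"
proof -
  have "nu i i (sequential u i) = nu i i (xstar u)"
    unfolding xstar_def using assms by (intro nu_cong) (simp add: sequential_stable[of _ i n])
  moreover have "xstar u (\<sigma> i) = sequential u (Suc i) (\<sigma> i)"
    unfolding xstar_def using assms by (intro sequential_stable) auto
  ultimately show ?thesis
    by simp
qed

lemma xstar_cfg:
  assumes u: "u \<in> space (PiM {..<n} (\<lambda>_. seed_space q))"
  shows "xstar u \<in> cfg n q"
proof -
  have "xstar u c < q" if "c < n" for c
  proof -
    obtain i where "i < n" "c = \<sigma> i"
      using perm_surj \<open>c < n\<close> by blast
    then show ?thesis
      using u q_pos by (auto simp: xstar_step space_PiM PiE_iff intro!: min_coupler_less)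
  qed
  moreover have "m \<le> n \<Longrightarrow> n \<le> c \<Longrightarrow> sequential u m c = undefined" for m c
  proof (induction m)
    case (Suc m)
    then show ?case
      using perm_less[of m] by auto
  qed simp
  ultimately show ?thesis
    by (auto simp: cfg_def PiE_iff extensional_def xstar_def)
qed

text \<open>The equations of \<open>xstar_step\<close> are triangular in the order \<sigma>, so
  their solution is unique. Hence the event that \<open>xstar u\<close> is f becomes a separate
  condition on each seed.\<close>

lemma xstar_eqI:
  assumes u: "u \<in> space (PiM {..<n} (\<lambda>_. seed_space q))" and f: "f \<in> cfg n q"
    and step: "\<And>j. j < n \<Longrightarrow> min_coupler (nu j j f) (u j) = f (\<sigma> j)"
  shows "xstar u = f"
proof -
  have eq: "j < n \<Longrightarrow> xstar u (\<sigma> j) = f (\<sigma> j)" for j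
  proof (induction j rule: less_induct)
    case (less j)
    then have "nu j j (xstar u) = nu j j f"
      by (intro nu_cong) auto
    then show ?case
      using less.prems step[of j] by (simp add: xstar_step)
  qed
  have "xstar u c = f c" if "c < n" for c
    using perm_surj[OF that] eq by auto
  then show ?thesis
    using xstar_cfg[OF u] f unfolding cfg_def by (intro PiE_ext) auto
qed

text \<open>\<open>Suc\<close> turns the 0-indexed first mismatch into a number of final positions:
  the mismatched position is itself corrected within the round.\<close>

definition stp :: "(nat \<Rightarrow> nat \<Rightarrow> nat \<times> real) \<Rightarrow> nat \<Rightarrow> nat" where
  "stp u a = Suc (LEAST i. i < n \<and> mism u a i)"

definition halts :: "(nat \<Rightarrow> nat \<Rightarrow> nat \<times> real) \<Rightarrow> nat \<Rightarrow> bool" where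
  "halts u a \<longleftrightarrow> (\<forall>i<n. \<not> mism u a i) \<or> stp u a = n"

text \<open>If the first a entries of x are final, y is exactly the guess examined by
  \<open>mism\<close>. Up to and including the first mismatch, x' is computed from final entries of
  y and so is final; hence y and x' first differ at the first mismatch.\<close>

lemma round_analysis:
  assumes x: "\<And>j. j < a \<Longrightarrow> x (\<sigma> j) = xstar u (\<sigma> j)"
    and round: "sampler_round \<mu> dflt n \<sigma> u a x = (y, x')"
  shows "i < n \<Longrightarrow> (\<And>j. j < i \<Longrightarrow> \<not> mism u a j) \<Longrightarrow> x' (\<sigma> i) = xstar u (\<sigma> i)"
    and "((\<forall>c<n. x' c = y c) \<or> Suc (LEAST i. y (\<sigma> i) \<noteq> x' (\<sigma> i)) = n) \<longleftrightarrow> halts u a"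
    and "\<exists>i<n. mism u a i \<Longrightarrow> Suc (LEAST i. y (\<sigma> i) \<noteq> x' (\<sigma> i)) = stp u a"
proof -
  have pos: "the_inv_into {..<n} \<sigma> (\<sigma> i) = i" if "i < n" for i
    using that permutes_inj_on[OF perm] by (simp add: the_inv_into_f_f)
  have y: "y (\<sigma> i) = min_coupler (nu a i (xstar u)) (u i)" if "i < n" for i
  proof -
    have "y (\<sigma> i) = min_coupler (nu a i x) (u i)"
      using round that by (auto simp: sampler_round_def Let_def pos nu_def)
    also have "nu a i x = nu a i (xstar u)"
      by (intro nu_cong x)
    finally show ?thesis .
  qed
  have x': "x' (\<sigma> i) = min_coupler (nu i i y) (u i)" if "i < n" for i
    using round that by (auto simp: sampler_round_def Let_def pos nu_def)
  have ystar: "y (\<sigma> i) = xstar u (\<sigma> i) \<longleftrightarrow> \<not> mism u a i" if "i < n" for i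
    using y[OF that] by (auto simp: mism_def)
  have x'star: "x' (\<sigma> i) = xstar u (\<sigma> i)" if "i < n" "\<And>j. j < i \<Longrightarrow> \<not> mism u a j" for i
  proof -
    have "nu i i y = nu i i (xstar u)"
      using that ystar by (intro nu_cong) auto
    then show ?thesis
      using that by (simp add: x' xstar_step)
  qed
  then show "i < n \<Longrightarrow> (\<And>j. j < i \<Longrightarrow> \<not> mism u a j) \<Longrightarrow> x' (\<sigma> i) = xstar u (\<sigma> i)" .
  show step: "Suc (LEAST i. y (\<sigma> i) \<noteq> x' (\<sigma> i)) = stp u a" if "\<exists>i<n. mism u a i"
  proof -
    define f where "f = (LEAST i. i < n \<and> mism u a i)"
    have f: "f < n" "mism u a f"
      unfolding f_def using LeastI_ex[of "\<lambda>i. i < n \<and> mism u a i"] that by auto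
    have before: "\<not> mism u a j" if "j < f" for j
      using not_less_Least[of j "\<lambda>i. i < n \<and> mism u a i"] that f(1) unfolding f_def by auto
    have "(LEAST i. y (\<sigma> i) \<noteq> x' (\<sigma> i)) = f"
    proof (rule Least_equality)
      show "y (\<sigma> f) \<noteq> x' (\<sigma> f)"
        using ystar[OF f(1)] x'star[OF f(1) before] f(2) by auto
    next
      fix i assume i: "y (\<sigma> i) \<noteq> x' (\<sigma> i)"
      show "f \<le> i"
      proof (rule ccontr)
        assume "\<not> f \<le> i"
        then have "i < n" "\<And>j. j \<le> i \<Longrightarrow> \<not> mism u a j"
          using f(1) before by auto
        then show False
          using i ystar[of i] x'star[of i] by auto
      qed
    qed
    then show ?thesis
      unfolding stp_def f_def by simp
  qed
  show "((\<forall>c<n. x' c = y c) \<or> Suc (LEAST i. y (\<sigma> i) \<noteq> x' (\<sigma> i)) = n) \<longleftrightarrow> halts u a"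
  proof (cases "\<exists>i<n. mism u a i")
    case True
    define f where "f = (LEAST i. i < n \<and> mism u a i)"
    have f: "f < n" "mism u a f"
      unfolding f_def using LeastI_ex[of "\<lambda>i. i < n \<and> mism u a i"] True by auto
    have before: "\<not> mism u a j" if "j < f" for j
      using not_less_Least[of j "\<lambda>i. i < n \<and> mism u a i"] that f(1) unfolding f_def by auto
    have "x' (\<sigma> f) \<noteq> y (\<sigma> f)"
      using ystar[OF f(1)] x'star[OF f(1) before] f(2) by auto
    then have "\<not> (\<forall>c<n. x' c = y c)"
      using perm_less[OF f(1)] by auto
    then show ?thesis
      using step[OF True] True by (auto simp: halts_def)
  next
    case False
    have "x' c = y c" if "c < n" for c
      using perm_surj[OF that] False x'star ystar by (metis less_trans)
    then show ?thesis
      using False by (auto simp: halts_def)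
  qed
qed

lemma stp_less: "\<exists>i<n. mism u a i \<Longrightarrow> stp u a \<le> n \<and> (\<forall>j. Suc j < stp u a \<longrightarrow> \<not> mism u a j)"
proof -
  assume ex: "\<exists>i<n. mism u a i"
  define f where "f = (LEAST i. i < n \<and> mism u a i)"
  have f: "f < n"
    unfolding f_def using LeastI_ex[of "\<lambda>i. i < n \<and> mism u a i"] ex by auto
  have "\<not> mism u a j" if "j < f" for j
    using not_less_Least[of j "\<lambda>i. i < n \<and> mism u a i"] that f unfolding f_def by auto
  then show ?thesis
    using f by (auto simp: stp_def f_def[symmetric])
qed

text \<open>The invariant is that the first a entries of x are final. As long as no round halts
  there is a mismatch, so the least element in \<open>stp\<close> exists; a = 0 makes the invariant
  hold at the start for any x.\<close>

lemma sampler_state_eq: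
  "(\<And>s. s < t \<Longrightarrow> \<not> halts u ((stp u ^^ s) 0)) \<Longrightarrow>
   \<exists>x. sampler_state \<mu> dflt n \<sigma> u t = ((stp u ^^ t) 0, x) \<and>
     (\<forall>j<(stp u ^^ t) 0. x (\<sigma> j) = xstar u (\<sigma> j))"
proof (induction t)
  case (Suc t)
  define a where "a = (stp u ^^ t) 0"
  obtain x where st: "sampler_state \<mu> dflt n \<sigma> u t = (a, x)"
      and x: "\<And>j. j < a \<Longrightarrow> x (\<sigma> j) = xstar u (\<sigma> j)"
    using Suc.IH Suc.prems by (auto simp: a_def)
  obtain y x' where round: "sampler_round \<mu> dflt n \<sigma> u a x = (y, x')"
    by fastforce
  have ex: "\<exists>i<n. mism u a i"
    using Suc.prems[of t] by (auto simp: halts_def a_def)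
  have "x' (\<sigma> j) = xstar u (\<sigma> j)" if "j < stp u a" for j
    using that stp_less[OF ex] by (intro round_analysis(1)[OF x round]) auto
  then show ?case
    using st round round_analysis(3)[OF x round ex] by (auto simp: a_def[symmetric])
qed simp

lemma stops_at_iff:
  assumes "\<And>s. s < t \<Longrightarrow> \<not> halts u ((stp u ^^ s) 0)"
  shows "sampler_stops_at \<mu> dflt n \<sigma> u (Suc t) \<longleftrightarrow> halts u ((stp u ^^ t) 0)"
proof -
  define a where "a = (stp u ^^ t) 0"
  obtain x where st: "sampler_state \<mu> dflt n \<sigma> u t = (a, x)"
      and x: "\<And>j. j < a \<Longrightarrow> x (\<sigma> j) = xstar u (\<sigma> j)"
    using sampler_state_eq[of t u] assms by (auto simp: a_def)
  obtain y x' where round: "sampler_round \<mu> dflt n \<sigma> u a x = (y, x')"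
    by fastforce
  show ?thesis
    using round_analysis(2)[OF x round] st round by (simp add: sampler_stops_at_def a_def[symmetric])
qed

text \<open>\<open>stops_at_iff\<close> is available only while no earlier round has halted, hence
  the strong induction. Round \<open>Suc t\<close> starts after t steps, hence the shift of the
  index.\<close>

lemma rounds_at_least_iff:
  "sampler_rounds_at_least \<mu> dflt n \<sigma> u K \<longleftrightarrow> (\<forall>t. real (Suc t) < K \<longrightarrow> \<not> halts u ((stp u ^^ t) 0))"
proof
  assume K: "sampler_rounds_at_least \<mu> dflt n \<sigma> u K"
  show "\<forall>t. real (Suc t) < K \<longrightarrow> \<not> halts u ((stp u ^^ t) 0)"
  proof
    fix t show "real (Suc t) < K \<longrightarrow> \<not> halts u ((stp u ^^ t) 0)"
    proof (induction t rule: less_induct)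
      case (less t)
      show ?case
      proof
        assume t: "real (Suc t) < K"
        then have "sampler_stops_at \<mu> dflt n \<sigma> u (Suc t) \<longleftrightarrow> halts u ((stp u ^^ t) 0)"
          using less by (intro stops_at_iff) auto
        then show "\<not> halts u ((stp u ^^ t) 0)"
          using K t by (auto simp: sampler_rounds_at_least_def)
      qed
    qed
  qed
next
  assume H: "\<forall>t. real (Suc t) < K \<longrightarrow> \<not> halts u ((stp u ^^ t) 0)"
  show "sampler_rounds_at_least \<mu> dflt n \<sigma> u K"
    unfolding sampler_rounds_at_least_def
  proof (intro allI impI)
    fix t assume t: "real t < K"
    show "\<not> sampler_stops_at \<mu> dflt n \<sigma> u t"
    proof (cases t)
      case 0
      then show ?thesis by (simp add: sampler_stops_at_def)
    next
      case (Suc s)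
      then show ?thesis
        using H t by (subst Suc, subst stops_at_iff) auto
    qed
  qed
qed

text \<open>A round moves its start by at most m, so t rounds reach at most t * m. While the next
  start is still at most H < n, there is a mismatch and the new start is not n, so neither halting
  condition holds.\<close>

lemma rounds_at_leastI:
  assumes mism: "\<And>a. a \<le> H \<Longrightarrow> \<exists>i<a + m. i < n \<and> mism u a i"
    and H: "H < n" and K: "K * real m \<le> real H"
  shows "sampler_rounds_at_least \<mu> dflt n \<sigma> u K"
  unfolding rounds_at_least_iff
proof (intro allI impI)
  have step: "stp u a \<le> a + m" if a: "a \<le> H" for a
  proof -
    obtain i where "i < a + m" "i < n \<and> mism u a i"
      using mism[OF a] by auto
    then show ?thesis
      unfolding stp_def using Least_le[of "\<lambda>i. i < n \<and> mism u a i" i] by simp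
  qed
  have bound: "t * m \<le> H \<Longrightarrow> (stp u ^^ t) 0 \<le> t * m" for t
  proof (induction t)
    case (Suc t)
    then show ?case
      using step[of "(stp u ^^ t) 0"] by simp
  qed simp
  fix t assume "real (Suc t) < K"
  then have "real (Suc t) * real m \<le> real H"
    using K mult_right_mono[of "real (Suc t)" K "real m"] by simp
  then have tm: "Suc t * m \<le> H"
    unfolding of_nat_mult[symmetric] of_nat_le_iff .
  then have a: "(stp u ^^ t) 0 \<le> t * m" "(stp u ^^ t) 0 \<le> H"
    using bound[of t] by auto
  have "stp u ((stp u ^^ t) 0) \<le> H"
    using step[OF a(2)] a(1) tm by simp
  then show "\<not> halts u ((stp u ^^ t) 0)"
    using mism[OF a(2)] H by (auto simp: halts_def)
qed

section \<open>Measurability, and seeds that produce no mismatch\<close>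

lemma measurable_component_min_coupler:
  "i < n \<Longrightarrow> (\<lambda>u. min_coupler \<nu> (u i)) \<in> PiM {..<n} (\<lambda>_. seed_space q) \<rightarrow>\<^sub>M count_space UNIV"
  by (rule measurable_compose[where f = "\<lambda>u. u i", OF _ measurable_min_coupler])
     (rule measurable_component_singleton, simp)

text \<open>\<open>xstar\<close> takes values in the finite set \<open>cfg n q\<close>. Splitting by
  its value through the fixed-point equations leaves finitely many conditions on single
  seeds.\<close>

lemma measurable_mism [measurable]:
  assumes i: "i < n"
  shows "Measurable.pred (PiM {..<n} (\<lambda>_. seed_space q)) (\<lambda>u. mism u a i)"
proof -
  let ?M = "PiM {..<n} (\<lambda>_. seed_space q)"
  note [measurable] = measurable_component_min_coupler
  have "{u \<in> space ?M. mism u a i} = (\<Union>f\<in>cfg n q.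
      {u \<in> space ?M. (\<forall>j\<in>{..<n}. min_coupler (nu j j f) (u j) = f (\<sigma> j)) \<and>
        min_coupler (nu a i f) (u i) \<noteq> f (\<sigma> i)})"
  proof (intro equalityI subsetI)
    fix u assume "u \<in> {u \<in> space ?M. mism u a i}"
    then show "u \<in> (\<Union>f\<in>cfg n q. {u \<in> space ?M. (\<forall>j\<in>{..<n}. min_coupler (nu j j f) (u j) = f (\<sigma> j)) \<and>
        min_coupler (nu a i f) (u i) \<noteq> f (\<sigma> i)})"
      using xstar_cfg[of u] by (auto simp: mism_def xstar_step intro!: bexI[of _ "xstar u"])
  next
    fix u assume "u \<in> (\<Union>f\<in>cfg n q. {u \<in> space ?M. (\<forall>j\<in>{..<n}. min_coupler (nu j j f) (u j) = f (\<sigma> j)) \<and>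
        min_coupler (nu a i f) (u i) \<noteq> f (\<sigma> i)})"
    then show "u \<in> {u \<in> space ?M. mism u a i}"
      using xstar_eqI[of u] by (auto simp: mism_def)
  qed
  also have "\<dots> \<in> sets ?M"
  proof (rule sets.finite_UN)
    fix f
    have eq: "{u \<in> space ?M. min_coupler \<nu> (u j) = v} \<in> sets ?M" if "j < n" for j \<nu> v
      using measurable_sets[OF measurable_component_min_coupler[OF that, of \<nu>], of "{v}"]
      by (simp add: vimage_def Int_def conj_commute)
    show "{u \<in> space ?M. (\<forall>j\<in>{..<n}. min_coupler (nu j j f) (u j) = f (\<sigma> j)) \<and>
        min_coupler (nu a i f) (u i) \<noteq> f (\<sigma> i)} \<in> sets ?M"
      by (intro sets.sets_Collect_conj sets.sets_Collect_finite_All' sets.sets_Collect_neg eq i)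
         (use i in auto)
  qed simp
  finally show ?thesis
    by (simp add: pred_def)
qed

lemma measurable_rounds:
  "{u \<in> space (PiM {..<n} (\<lambda>_. seed_space q)). sampler_rounds_at_least \<mu> dflt n \<sigma> u K}
     \<in> sets (PiM {..<n} (\<lambda>_. seed_space q))"
proof -
  let ?M = "PiM {..<n} (\<lambda>_. seed_space q)"
  have [measurable]: "Measurable.pred ?M (\<lambda>u. i < n \<and> mism u a i)" for a i
    by (cases "i < n") simp_all
  have stp: "(\<lambda>u. stp u a) \<in> ?M \<rightarrow>\<^sub>M count_space UNIV" for a
    unfolding stp_def by measurable
  have state: "(\<lambda>u. (stp u ^^ t) 0) \<in> ?M \<rightarrow>\<^sub>M count_space UNIV" for t
  proof (induction t)
    case (Suc t)
    show ?case
      using measurable_compose_countable[where f = "\<lambda>a u. stp u a", OF stp Suc] by simp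
  qed simp
  have halts: "Measurable.pred ?M (\<lambda>u. halts u a)" for a
  proof -
    have [measurable]: "Measurable.pred ?M (\<lambda>u. stp u a = n)"
      using stp[of a] by measurable
    have "(\<lambda>u. halts u a) = (\<lambda>u. (\<forall>i. \<not> (i < n \<and> mism u a i)) \<or> stp u a = n)"
      by (auto simp: halts_def fun_eq_iff)
    then show ?thesis
      by simp
  qed
  have [measurable]: "Measurable.pred ?M (\<lambda>u. halts u ((stp u ^^ t) 0))" for t
    using measurable_compose_countable[where f = "\<lambda>a u. halts u a", OF halts state] .
  show ?thesis
    unfolding rounds_at_least_iff by measurable
qed

definition coupled :: "nat \<Rightarrow> nat set \<Rightarrow> nat \<Rightarrow> (nat \<Rightarrow> nat) \<Rightarrow> real" where
  "coupled a W i f = (if i \<in> W then min (nu i i f (f (\<sigma> i))) (nu a i f (f (\<sigma> i)))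
     else nu i i f (f (\<sigma> i)))"

text \<open>The output \<open>xstar\<close> equals \<open>f\<close> without a mismatch on \<open>W\<close> only if each seed independently
  lands in a set of measure at most \<open>coupled a W i f\<close>.\<close>

lemma measure_no_mism_le:
  assumes W: "W \<subseteq> {..<n}"
  shows "measure (PiM {..<n} (\<lambda>_. seed_space q))
      {u \<in> space (PiM {..<n} (\<lambda>_. seed_space q)). \<forall>i\<in>W. \<not> mism u a i}
    \<le> (\<Sum>f\<in>cfg n q. \<Prod>i<n. coupled a W i f)"
proof -
  let ?M = "PiM {..<n} (\<lambda>_. seed_space q)"
  interpret S: prob_space "seed_space q"
    by (rule prob_space_seed[OF q_pos])
  interpret M: prob_space ?M
    by (intro prob_space_PiM prob_space_seed q_pos)
  \<comment> \<open>For a position in W, one and the same seed must produce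
    \<open>f (\<sigma> i)\<close> from both laws, so the probability is at most the smaller of the
    two.\<close>
  define X where "X = (\<lambda>f i. {r \<in> space (seed_space q). min_coupler (nu i i f) r = f (\<sigma> i) \<and>
    (i \<in> W \<longrightarrow> min_coupler (nu a i f) r = f (\<sigma> i))})"
  have single [measurable]: "{r \<in> space (seed_space q). min_coupler \<nu> r = v} \<in> sets (seed_space q)" for \<nu> v
    using measurable_sets[OF measurable_min_coupler, of "{v}"]
    by (simp add: vimage_def Int_def conj_commute)
  have X: "X f i \<in> sets (seed_space q)" for f i
    unfolding X_def by (intro sets.sets_Collect_conj sets.sets_Collect_imp single) auto
  define Y where "Y = (\<lambda>f. {u \<in> space ?M. \<forall>i\<in>{..<n}. u i \<in> X f i})"
  have Y: "Y f \<in> sets ?M" for f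
    unfolding Y_def using X by measurable
  have "{u \<in> space ?M. \<forall>i\<in>W. \<not> mism u a i} \<subseteq> (\<Union>f\<in>cfg n q. Y f)"
  proof
    fix u assume u: "u \<in> {u \<in> space ?M. \<forall>i\<in>W. \<not> mism u a i}"
    then have "u \<in> Y (xstar u)"
      by (auto simp: Y_def X_def mism_def xstar_step space_PiM PiE_iff)
    then show "u \<in> (\<Union>f\<in>cfg n q. Y f)"
      using xstar_cfg[of u] u by blast
  qed
  then have "measure ?M {u \<in> space ?M. \<forall>i\<in>W. \<not> mism u a i} \<le> measure ?M (\<Union>f\<in>cfg n q. Y f)"
    using Y by (intro M.finite_measure_mono) auto
  also have "\<dots> \<le> (\<Sum>f\<in>cfg n q. measure ?M (Y f))"
    using Y by (intro M.finite_measure_subadditive_finite) auto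
  also have "\<dots> \<le> (\<Sum>f\<in>cfg n q. \<Prod>i<n. coupled a W i f)"
  proof (rule sum_mono)
    fix f assume f: "f \<in> cfg n q"
    have "measure ?M (Y f) = (\<Prod>i<n. measure (seed_space q) (X f i))"
      unfolding Y_def by (intro measure_PiM_Collect prob_space_seed q_pos X) auto
    also have "\<dots> \<le> (\<Prod>i<n. coupled a W i f)"
    proof (rule prod_mono)
      fix i assume "i \<in> {..<n}"
      then have i: "i < n" by simp
      have "f (\<sigma> i) < q"
        using cfg_less[OF f perm_less[OF i]] .
      then have le: "measure (seed_space q) {r \<in> space (seed_space q). min_coupler (nu b i f) r = f (\<sigma> i)}
          \<le> nu b i f (f (\<sigma> i))" for b
        by (intro measure_min_coupler_le nu_dist i)
      have "measure (seed_space q) (X f i) \<le> nu i i f (f (\<sigma> i))"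
        by (rule order_trans[OF _ le]) (auto simp: X_def intro!: S.finite_measure_mono)
      moreover have "measure (seed_space q) (X f i) \<le> nu a i f (f (\<sigma> i))" if "i \<in> W"
        by (rule order_trans[OF _ le]) (use that in \<open>auto simp: X_def intro!: S.finite_measure_mono\<close>)
      ultimately show "0 \<le> measure (seed_space q) (X f i) \<and> measure (seed_space q) (X f i) \<le> coupled a W i f"
        by (simp add: coupled_def)
    qed
    finally show "measure ?M (Y f) \<le> (\<Prod>i<n. coupled a W i f)" .
  qed
  finally show ?thesis .
qed

end

section \<open>Coupling windows of the planted distribution\<close>

context planted_model
begin

definition planted :: "nat list pmf" where
  "planted = map_pmf (\<lambda>f. map f [0..<n]) (embed_pmf (\<lambda>f. if f \<in> cfg n q then jp f else 0))"

lemma pmf_embed_jp: "pmf (embed_pmf (\<lambda>f. if f \<in> cfg n q then jp f else 0)) f = (if f \<in> cfg n q then jp f else 0)"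
proof (rule pmf_embed_pmf)
  show "0 \<le> (if f \<in> cfg n q then jp f else 0)" for f
    using jp_pos[of f] by auto
  have "(\<integral>\<^sup>+ f. ennreal (if f \<in> cfg n q then jp f else 0) \<partial>count_space UNIV)
      = (\<Sum>f\<in>cfg n q. ennreal (if f \<in> cfg n q then jp f else 0))"
    by (rule nn_integral_count_space') auto
  also have "\<dots> = (\<Sum>f\<in>cfg n q. ennreal (jp f))"
    by (rule sum.cong) auto
  also have "\<dots> = 1"
    using jp_pos by (subst sum_ennreal) (auto simp: sum_jp less_imp_le)
  finally show "(\<integral>\<^sup>+ f. ennreal (if f \<in> cfg n q then jp f else 0) \<partial>count_space UNIV) = 1" .
qed

lemma prob_planted:
  "measure_pmf.prob planted A = (\<Sum>h | h \<in> cfg n q \<and> map h [0..<n] \<in> A. jp h)"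
proof -
  let ?p = "embed_pmf (\<lambda>f. if f \<in> cfg n q then jp f else 0)"
  let ?B = "(\<lambda>f. map f [0..<n]) -` A"
  have set: "set_pmf ?p = cfg n q"
    unfolding set_pmf_eq pmf_embed_jp using less_imp_neq[OF jp_pos] by auto
  have "measure_pmf.prob planted A = measure_pmf.prob ?p (?B \<inter> set_pmf ?p)"
    unfolding planted_def by (simp add: measure_Int_set_pmf)
  also have "\<dots> = (\<Sum>h\<in>?B \<inter> cfg n q. pmf ?p h)"
    unfolding set by (intro measure_measure_pmf_finite) simp
  also have "\<dots> = (\<Sum>h | h \<in> cfg n q \<and> map h [0..<n] \<in> A. jp h)"
    by (rule sum.cong) (auto simp: pmf_embed_jp)
  finally show ?thesis .
qed

lemma set_planted: "set_pmf planted \<subseteq> cube q n"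
proof -
  have "set_pmf (embed_pmf (\<lambda>f. if f \<in> cfg n q then jp f else 0)) \<subseteq> cfg n q"
    by (auto simp: set_pmf_eq pmf_embed_jp split: if_splits)
  then have "\<exists>f\<in>cfg n q. xs = map f [0..<n]" if "xs \<in> set_pmf planted" for xs
    using that unfolding planted_def by auto
  then show ?thesis
    using cfg_less by (fastforce simp: cube_def)
qed

text \<open>The conditioning event of a configuration has positive mass, so the \<open>dflt\<close>
  branch is never taken; this makes the result uniform in \<open>dflt\<close>.\<close>

lemma cond_law_planted:
  assumes f: "f \<in> cfg n q" and S: "S \<subseteq> {..<n}" and c: "c < n"
  shows "cond_law planted dflt c S f v = cexp S (\<lambda>h. if h c = v then 1 else 0) f"
proof -
  have nth: "map h [0..<n] ! j = h j" if "j < n" for h :: "nat \<Rightarrow> nat" and j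
    using that by simp
  have B: "(\<forall>j\<in>S. map h [0..<n] ! j = f j) \<longleftrightarrow> (\<forall>j\<in>S. h j = f j)" for h :: "nat \<Rightarrow> nat"
    using S nth by (intro ball_cong) auto
  have "measure_pmf.prob planted {xs. \<forall>j\<in>S. xs ! j = f j} = (\<Sum>h\<in>block S f. jp h)"
    unfolding prob_planted mem_Collect_eq B block_def ..
  moreover have "measure_pmf.prob planted {xs. xs ! c = v \<and> (\<forall>j\<in>S. xs ! j = f j)}
      = (\<Sum>h\<in>block S f. jp h * (if h c = v then 1 else 0))"
    unfolding prob_planted mem_Collect_eq B block_def nth[OF c]
    by (simp add: sum.inter_filter[symmetric] if_distrib cong: if_cong)
       (intro sum.cong, auto)
  ultimately show ?thesis
    unfolding cond_law_def cexp_def Let_def using block_mass_pos[OF f, of S] by simp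
qed

lemma sum_cond_law_planted:
  assumes f: "f \<in> cfg n q" and S: "S \<subseteq> {..<n}" and c: "c < n"
  shows "(\<Sum>v<q. G v * cond_law planted dflt c S f v) = cexp S (\<lambda>h. G (h c)) f"
proof -
  have "(\<Sum>v<q. G v * cond_law planted dflt c S f v)
      = (\<Sum>h\<in>block S f. jp h * (\<Sum>v<q. G v * (if h c = v then 1 else 0))) / (\<Sum>h\<in>block S f. jp h)"
    unfolding cond_law_planted[OF assms] cexp_def
    by (simp only: times_divide_eq_right sum_divide_distrib[symmetric] sum_distrib_left)
       (subst sum.swap, simp only: mult.left_commute)
  also have "\<dots> = cexp S (\<lambda>h. G (h c)) f"
  proof -
    have "(\<Sum>v<q. G v * (if h c = v then 1 else 0)) = G (h c)" if "h \<in> block S f" for h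
      using that cfg_less[of h n q c] c block_subset[of S f]
      by (auto simp: if_distrib[of "\<lambda>x. _ * x"] cong: if_cong)
    then show ?thesis
      unfolding cexp_def by simp
  qed
  finally show ?thesis .
qed

end

locale planted_sampler = planted_model +
  fixes dflt :: "nat \<Rightarrow> real" and \<sigma> :: "nat \<Rightarrow> nat"
  assumes dflt: "is_dist_on q dflt" and perm: "\<sigma> permutes {..<n}"
begin

sublocale sampler n q planted dflt \<sigma>
  by unfold_locales (rule q_pos set_planted dflt perm)+

lemma nu_upd: "a \<le> t \<Longrightarrow> nu a i (f(\<sigma> t := v)) = nu a i f"
  by (rule nu_cong) (auto simp: perm_inj)

text \<open>The chain rule in the order \<sigma>: \<open>M i\<close> is the probability of the first
  i values, and the ratios telescope.\<close>

lemma prod_nu_eq_jp: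
  assumes f: "f \<in> cfg n q"
  shows "(\<Prod>i<n. nu i i f (f (\<sigma> i))) = jp f"
proof -
  define M where "M = (\<lambda>i. \<Sum>h\<in>block (\<sigma> ` {..<i}) f. jp h)"
  have pos: "M i > 0" for i
    unfolding M_def by (rule block_mass_pos[OF f])
  have "nu i i f (f (\<sigma> i)) = M (Suc i) / M i" if i: "i < n" for i
  proof -
    have "block (\<sigma> ` {..<Suc i}) f = {h \<in> block (\<sigma> ` {..<i}) f. h (\<sigma> i) = f (\<sigma> i)}"
      by (auto simp: block_def lessThan_Suc)
    then have "M (Suc i) = (\<Sum>h\<in>block (\<sigma> ` {..<i}) f. jp h * (if h (\<sigma> i) = f (\<sigma> i) then 1 else 0))"
      unfolding M_def by (simp add: sum.inter_filter if_distrib[of "\<lambda>x. _ * x"] cong: if_cong)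
    then show ?thesis
      unfolding nu_def using i
      by (subst cond_law_planted) (auto simp: f perm_less cexp_def M_def)
  qed
  then have "(\<Prod>i<n. nu i i f (f (\<sigma> i))) = (\<Prod>i<n. M (Suc i) / M i)"
    by simp
  also have "\<dots> = M n / M 0"
    using pos by (intro prod_lessThan_telescope) (simp add: less_imp_neq[symmetric])
  also have "M 0 = 1"
    unfolding M_def by (simp add: block_empty sum_jp)
  also have "M n = jp f"
  proof -
    have "block (\<sigma> ` {..<n}) f = {f}"
      unfolding permutes_image[OF perm] using f
      by (auto simp: block_def cfg_def intro: PiE_ext)
    then show ?thesis
      by (simp add: M_def)
  qed
  finally show ?thesis
    by simp
qed

text \<open>A sum of minima is 1 minus the total variation distance: the law of position i given all
  its predecessors is at distance at least \<epsilon> / 8 from its law given the first a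
  positions.\<close>

definition separated :: "nat \<Rightarrow> nat \<Rightarrow> (nat \<Rightarrow> nat) \<Rightarrow> bool" where
  "separated a i f \<longleftrightarrow> (\<Sum>v<q. min (nu i i f v) (nu a i f v)) \<le> 1 - \<epsilon> / 8"

text \<open>The row \<open>g (f k)\<close> of a neighbour k revealed between a and i is a
  sign-valued test function. Outside two exceptional sets, of sizes 16 and 32 over \<epsilon> sqrt
  q, its means under the two laws differ by at least \<epsilon> / 2 - \<epsilon> / 4, and total
  variation is at least half of that.\<close>

lemma prob_not_separated:
  assumes i: "i < n" "R \<le> \<sigma> i" and j: "a \<le> j" "j < i" "\<sigma> j \<in> \<Gamma> (\<sigma> i)"
  shows "(\<Sum>f | f \<in> cfg n q \<and> \<not> separated a i f. jp f) \<le> 48 / (\<epsilon> * sqrt (real q))"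
proof -
  define c k S S' where "c = \<sigma> i" and "k = \<sigma> j" and "S = \<sigma> ` {..<a}" and "S' = \<sigma> ` {..<i}"
  have c: "R \<le> c" "c < n" "c \<notin> S" "c \<notin> S'"
    using i j by (auto simp: c_def S_def S'_def perm_inj perm_less)
  have k: "k \<in> S'" "k \<notin> S" "k \<in> \<Gamma> c" "k < R"
    using i j nbr_less[of k c] by (auto simp: c_def k_def S_def S'_def perm_inj)
  have S: "S \<subseteq> {..<n}" "S' \<subseteq> {..<n}"
    unfolding S_def S'_def using i j by (auto intro!: perm_less)
  define P Q where "P = {f. f \<in> cfg n q \<and> cexp S' (\<lambda>h. g (f k) (h c)) f < \<epsilon> / 2}"
    and "Q = {f. f \<in> cfg n q \<and> \<epsilon> / 4 \<le> cexp S (\<lambda>h. g (f k) (h c)) f}"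
  have "f \<in> P \<union> Q" if f: "f \<in> cfg n q" and ns: "\<not> separated a i f" for f
  proof (rule ccontr)
    assume PQ: "f \<notin> P \<union> Q"
    let ?s = "\<lambda>v. g (f k) v"
    have corr: "(\<Sum>v<q. ?s v * nu i i f v) = cexp S' (\<lambda>h. ?s (h c)) f"
      "(\<Sum>v<q. ?s v * nu a i f v) = cexp S (\<lambda>h. ?s (h c)) f"
      unfolding nu_def S_def[symmetric] S'_def[symmetric] c_def[symmetric]
      by (intro sum_cond_law_planted f S c)+
    \<comment> \<open>The right-hand summand equals \<open>nu a i f v\<close> where the sign is 1
      and \<open>nu i i f v\<close> where it is -1.\<close>
    have "(\<Sum>v<q. min (nu i i f v) (nu a i f v))
        \<le> (\<Sum>v<q. 1 / 2 * nu i i f v + 1 / 2 * nu a i f v + 1 / 2 * (?s v * nu a i f v) - 1 / 2 * (?s v * nu i i f v))"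
    proof (rule sum_mono)
      fix v
      show "min (nu i i f v) (nu a i f v) \<le> 1 / 2 * nu i i f v + 1 / 2 * nu a i f v
          + 1 / 2 * (?s v * nu a i f v) - 1 / 2 * (?s v * nu i i f v)"
        using g_cases[of "f k" v] by (elim disjE) auto
    qed
    also have "\<dots> = 1 + 1 / 2 * cexp S (\<lambda>h. ?s (h c)) f - 1 / 2 * cexp S' (\<lambda>h. ?s (h c)) f"
      unfolding sum.distrib sum_subtractf sum_distrib_left[symmetric] corr using i by (simp add: nu_sum)
    also have "\<dots> \<le> 1 - \<epsilon> / 8"
      using PQ f by (auto simp: P_def Q_def)
    finally show False
      using ns by (simp add: separated_def)
  qed
  then have "(\<Sum>f | f \<in> cfg n q \<and> \<not> separated a i f. jp f) \<le> (\<Sum>f\<in>P \<union> Q. jp f)"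
    by (intro sum_mono2) (auto simp: P_def Q_def intro: less_imp_le jp_pos)
  also have "\<dots> \<le> (\<Sum>f\<in>P. jp f) + (\<Sum>f\<in>Q. jp f)"
    using sum_nonneg[of "P \<inter> Q" jp] less_imp_le[OF jp_pos]
    by (subst sum_Un) (auto simp: P_def Q_def)
  also have "\<dots> \<le> 16 / (\<epsilon> * sqrt (real q)) + 32 / (\<epsilon> * sqrt (real q))"
    unfolding P_def Q_def
    by (intro add_mono prob_correlation_small prob_correlation_large c k)
  finally show ?thesis
    by (simp add: add_divide_distrib[symmetric])
qed

text \<open>Separation fails on a small set, but the chain bound needs every f. So the factor of a
  position is set to 0 where its separation fails; the chain survives because
  \<open>separated a i\<close> depends only on values earlier than i in the order. The
  configurations lost are charged to \<open>jp\<close>, which dominates the product of coupled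
  factors, by a union bound over W.\<close>

lemma sum_coupled_le:
  assumes W: "W \<subseteq> {..<n}"
    and tester: "\<And>i. i \<in> W \<Longrightarrow> R \<le> \<sigma> i"
    and revealer: "\<And>i. i \<in> W \<Longrightarrow> \<exists>j. a \<le> j \<and> j < i \<and> \<sigma> j \<in> \<Gamma> (\<sigma> i)"
  shows "(\<Sum>f\<in>cfg n q. \<Prod>i<n. coupled a W i f)
    \<le> real (card W) * (48 / (\<epsilon> * sqrt (real q))) + (1 - \<epsilon> / 8) ^ card W"
proof -
  have finW: "finite W"
    using W finite_subset by blast
  define \<kappa> where "\<kappa> = (\<lambda>i f. if i \<in> W \<and> \<not> separated a i f then 0 else coupled a W i f)"
  have coupled0: "0 \<le> coupled a W i f" "coupled a W i f \<le> nu i i f (f (\<sigma> i))" if "i < n" for i f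
    using that by (auto simp: coupled_def nu_nonneg)
  have \<kappa>0: "0 \<le> \<kappa> i f" if "i < n" for i f
    using coupled0[OF that] by (simp add: \<kappa>_def)
  have nu_upd': "nu i i (f(\<sigma> t := v)) = nu i i f" "i \<in> W \<Longrightarrow> nu a i (f(\<sigma> t := v)) = nu a i f"
    if "i \<le> t" for i t f v
    using revealer[of i] that by (auto intro!: nu_upd)
  then have sep: "i \<in> W \<Longrightarrow> separated a i (f(\<sigma> t := v)) = separated a i f" if "i \<le> t" for i t f v
    using that by (simp add: separated_def)
  have "(\<Prod>i<n. coupled a W i f)
      \<le> (\<Sum>i\<in>W. if \<not> separated a i f then jp f else 0) + (\<Prod>i<n. \<kappa> i f)" if f: "f \<in> cfg n q" for f
  proof (cases "\<forall>i\<in>W. separated a i f")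
    case True
    then have "(\<Prod>i<n. coupled a W i f) = (\<Prod>i<n. \<kappa> i f)"
      by (intro prod.cong) (auto simp: \<kappa>_def)
    then show ?thesis
      using jp_pos[of f] by (auto intro: sum_nonneg)
  next
    case False
    then obtain i where i: "i \<in> W" "\<not> separated a i f"
      by blast
    have "(\<Prod>i<n. coupled a W i f) \<le> (\<Prod>i<n. nu i i f (f (\<sigma> i)))"
      by (intro prod_mono) (auto intro: coupled0)
    also have "\<dots> = jp f"
      by (rule prod_nu_eq_jp[OF f])
    also have "\<dots> \<le> (\<Sum>i\<in>W. if \<not> separated a i f then jp f else 0)"
      using member_le_sum[of i W "\<lambda>i. if \<not> separated a i f then jp f else 0"] i finW jp_pos[of f] by auto
    also have "\<dots> \<le> (\<Sum>i\<in>W. if \<not> separated a i f then jp f else 0) + (\<Prod>i<n. \<kappa> i f)"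
      using prod_nonneg[of "{..<n}" "\<lambda>i. \<kappa> i f"] \<kappa>0 by simp
    finally show ?thesis .
  qed
  then have "(\<Sum>f\<in>cfg n q. \<Prod>i<n. coupled a W i f)
      \<le> (\<Sum>f\<in>cfg n q. (\<Sum>i\<in>W. if \<not> separated a i f then jp f else 0) + (\<Prod>i<n. \<kappa> i f))"
    by (rule sum_mono)
  also have "\<dots> = (\<Sum>i\<in>W. \<Sum>f | f \<in> cfg n q \<and> \<not> separated a i f. jp f) + (\<Sum>f\<in>cfg n q. \<Prod>i<n. \<kappa> i f)"
    unfolding sum.distrib by (subst sum.swap) (simp add: sum.inter_filter)
  also have "\<dots> \<le> (\<Sum>i\<in>W. 48 / (\<epsilon> * sqrt (real q))) + (\<Prod>i<n. if i \<in> W then 1 - \<epsilon> / 8 else 1)"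
  proof (intro add_mono sum_mono)
    fix i assume i: "i \<in> W"
    then show "(\<Sum>f | f \<in> cfg n q \<and> \<not> separated a i f. jp f) \<le> 48 / (\<epsilon> * sqrt (real q))"
      using W tester revealer[OF i] by (auto intro!: prob_not_separated)
  next
    show "(\<Sum>f\<in>cfg n q. \<Prod>i<n. \<kappa> i f) \<le> (\<Prod>i<n. if i \<in> W then 1 - \<epsilon> / 8 else 1)"
    proof (rule sum_prod_chain_le[where \<sigma> = \<sigma>])
      show "\<kappa> i (f(\<sigma> t := v)) = \<kappa> i f" if "i < t" for i t f v
        using that nu_upd'[of i t f v] sep[of i t f v] perm_inj[of i t] by (auto simp: \<kappa>_def coupled_def)
      fix i f assume i: "i < n"
      show "(\<Sum>v<q. \<kappa> i (f(\<sigma> i := v))) \<le> (if i \<in> W then 1 - \<epsilon> / 8 else 1)"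
      proof (cases "i \<in> W")
        case True
        have "(\<Sum>v<q. \<kappa> i (f(\<sigma> i := v))) = (if separated a i f then \<Sum>v<q. min (nu i i f v) (nu a i f v) else 0)"
          using True by (simp add: \<kappa>_def coupled_def nu_upd' sep)
        then show ?thesis
          using True eps_le by (simp add: separated_def)
      next
        case False
        then show ?thesis
          using nu_sum[OF i, of i f] by (simp add: \<kappa>_def coupled_def nu_upd')
      qed
    qed (use q_pos perm_less \<kappa>0 in auto)
  qed
  also have "(\<Prod>i<n. if i \<in> W then 1 - \<epsilon> / 8 else 1) = (1 - \<epsilon> / 8) ^ card W"
    using W by (simp add: prod.If_cases Int_absorb1)
  finally show ?thesis
    by simp
qed

end

section \<open>Random orders\<close>

text \<open>Sampling without replacement is dominated by sampling with replacement. Given that P is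
  mapped into A, all positions outside P are equally likely to land in A, by a transposition, and
  those in P do so surely; hence the average over all n positions, card A / n, bounds the chance of
  a new one.\<close>

lemma card_permutes_into_le:
  assumes "P \<subseteq> {..<n}" "A \<subseteq> {..<n}" "n > 0"
  shows "real (card {\<sigma>. \<sigma> permutes {..<n} \<and> (\<forall>i\<in>P. \<sigma> i \<in> A)})
    \<le> fact n * (real (card A) / real n) ^ card P"
proof -
  define B where "B = (\<lambda>P. {\<sigma>. \<sigma> permutes {..<n} \<and> (\<forall>i\<in>P. \<sigma> i \<in> A)})"
  have finB: "finite (B P)" for P
    unfolding B_def by (rule finite_subset[OF _ finite_permutations[of "{..<n}"]]) auto
  have "finite P"
    using assms(1) finite_subset by blast
  from this assms(1) have "real (card (B P)) \<le> fact n * (real (card A) / real n) ^ card P"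
  proof (induction P rule: finite_induct)
    case empty
    then show ?case
      by (simp add: B_def card_permutations)
  next
    case (insert p P)
    have le: "card (B (insert p P)) \<le> card {\<sigma> \<in> B P. \<sigma> p' \<in> A}" if p': "p' < n" for p'
    proof (cases "p' \<in> P")
      case True
      then have "{\<sigma> \<in> B P. \<sigma> p' \<in> A} = B P"
        by (auto simp: B_def)
      then show ?thesis
        using finB by (auto intro!: card_mono simp: B_def)
    next
      case False
      let ?t = "Transposition.transpose p p'"
      have t: "?t permutes {..<n}"
        using insert.prems p' by (intro permutes_swap_id) auto
      have "card (B (insert p P)) \<le> card {\<sigma> \<in> B P. \<sigma> p' \<in> A}"
      proof (rule card_inj_on_le[where f = "\<lambda>\<sigma>. \<sigma> \<circ> ?t"])
        show "inj_on (\<lambda>\<sigma>. \<sigma> \<circ> ?t) (B (insert p P))"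
        proof (rule inj_onI)
          fix \<sigma> \<sigma>' assume "\<sigma> \<circ> ?t = \<sigma>' \<circ> ?t"
          then have "(\<sigma> \<circ> ?t) \<circ> ?t = (\<sigma>' \<circ> ?t) \<circ> ?t"
            by simp
          then show "\<sigma> = \<sigma>'"
            by (simp add: comp_assoc)
        qed
        have "?t i = i" if "i \<in> P" for i
          using that False insert.hyps by (auto simp: Transposition.transpose_def)
        then show "(\<lambda>\<sigma>. \<sigma> \<circ> ?t) ` B (insert p P) \<subseteq> {\<sigma> \<in> B P. \<sigma> p' \<in> A}"
          using permutes_compose[OF t] by (auto simp: B_def)
        show "finite {\<sigma> \<in> B P. \<sigma> p' \<in> A}"
          using finB by simp
      qed
      then show ?thesis .
    qed
    have "n * card (B (insert p P)) \<le> (\<Sum>p'<n. card {\<sigma> \<in> B P. \<sigma> p' \<in> A})"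
      using sum_mono[of "{..<n}" "\<lambda>_. card (B (insert p P))"] le by simp
    also have "\<dots> = (\<Sum>p'<n. \<Sum>\<sigma>\<in>B P. if \<sigma> p' \<in> A then 1 else 0)"
      using finB by (simp add: sum.If_cases Int_def)
    also have "\<dots> = (\<Sum>\<sigma>\<in>B P. \<Sum>p'<n. if \<sigma> p' \<in> A then 1 else 0)"
      by (rule sum.swap)
    also have "\<dots> = (\<Sum>\<sigma>\<in>B P. card A)"
    proof (rule sum.cong[OF refl])
      fix \<sigma> assume "\<sigma> \<in> B P"
      then have \<sigma>: "\<sigma> permutes {..<n}"
        by (simp add: B_def)
      have "(\<Sum>p'<n. if \<sigma> p' \<in> A then 1 else 0) = card {p' \<in> {..<n}. \<sigma> p' \<in> A}"
        by (simp add: sum.If_cases Int_def)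
      also have "{p' \<in> {..<n}. \<sigma> p' \<in> A} = \<sigma> -` A"
        using assms(2) permutes_in_image[OF \<sigma>] by auto
      also have "card (\<sigma> -` A) = card A"
        using permutes_inj[OF \<sigma>] permutes_surj[OF \<sigma>] by (intro card_vimage_inj) auto
      finally show "(\<Sum>p'<n. if \<sigma> p' \<in> A then 1 else 0) = card A" .
    qed
    finally have "real n * real (card (B (insert p P))) \<le> real (card A) * real (card (B P))"
      by (simp add: mult.commute flip: of_nat_mult)
    then have "real (card (B (insert p P))) \<le> real (card A) / real n * real (card (B P))"
      using assms(3) by (simp add: field_simps)
    also have "\<dots> \<le> real (card A) / real n * (fact n * (real (card A) / real n) ^ card P)"
      using insert by (intro mult_left_mono) auto
    finally show ?case
      using insert.hyps by (simp add: mult_ac)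
  qed
  then show ?thesis
    unfolding B_def .
qed

text \<open>Fubini over orders and seeds. For a fixed order the failure bound is a sum over starts,
  where a bad start costs 1 and any other \<beta>; averaging it over orders term by term gives
  \<gamma> + \<beta> per start.\<close>

lemma measure_sampler_space_ge:
  fixes G :: "(nat \<Rightarrow> nat) \<Rightarrow> (nat \<Rightarrow> nat \<Rightarrow> nat \<times> real) \<Rightarrow> bool" and bad :: "(nat \<Rightarrow> nat) \<Rightarrow> 'a \<Rightarrow> bool"
  assumes q: "q > 0" and fin: "finite I"
    and sets: "\<And>\<sigma>. \<sigma> permutes {..<n} \<Longrightarrow>
      {u \<in> space (PiM {..<n} (\<lambda>_. seed_space q)). G \<sigma> u} \<in> sets (PiM {..<n} (\<lambda>_. seed_space q))"
    and prob: "\<And>\<sigma>. \<sigma> permutes {..<n} \<Longrightarrow>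
      1 - (\<Sum>a\<in>I. if bad \<sigma> a then 1 else \<beta>)
        \<le> measure (PiM {..<n} (\<lambda>_. seed_space q)) {u \<in> space (PiM {..<n} (\<lambda>_. seed_space q)). G \<sigma> u}"
    and bad: "\<And>a. a \<in> I \<Longrightarrow> real (card {\<sigma>. \<sigma> permutes {..<n} \<and> bad \<sigma> a}) \<le> fact n * \<gamma>"
    and \<beta>: "0 \<le> \<beta>"
  shows "1 - real (card I) * (\<gamma> + \<beta>)
    \<le> measure (sampler_space n q) {\<omega> \<in> space (sampler_space n q). G (fst \<omega>) (snd \<omega>)}"
proof -
  let ?M = "PiM {..<n} (\<lambda>_. seed_space q)" and ?S = "{\<sigma>. \<sigma> permutes {..<n}}"
  let ?C = "uniform_count_measure ?S"
  have finS: "finite ?S" and neS: "?S \<noteq> {}" and cardS: "card ?S = fact n"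
    by (auto simp: finite_permutations card_permutations intro: permutes_id)
  interpret M: prob_space ?M
    by (intro prob_space_PiM prob_space_seed q)
  interpret C: prob_space ?C
    by (rule prob_space_uniform_count_measure[OF finS neS])
  interpret P: pair_prob_space ?C ?M ..
  define U where "U = (\<lambda>\<sigma>. {u \<in> space ?M. G \<sigma> u})"
  have U: "{\<sigma>} \<times> U \<sigma> \<in> Sigma_Algebra.sets (?C \<Otimes>\<^sub>M ?M)" if "\<sigma> \<in> ?S" for \<sigma>
    using that sets[of \<sigma>] by (intro pair_measureI) (auto simp: U_def sets_uniform_count_measure)
  have "{\<omega> \<in> space (sampler_space n q). G (fst \<omega>) (snd \<omega>)} = (\<Union>\<sigma>\<in>?S. {\<sigma>} \<times> U \<sigma>)"
    by (auto simp: sampler_space_def space_pair_measure space_uniform_count_measure U_def)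
  then have "measure (sampler_space n q) {\<omega> \<in> space (sampler_space n q). G (fst \<omega>) (snd \<omega>)}
      = (\<Sum>\<sigma>\<in>?S. measure (?C \<Otimes>\<^sub>M ?M) ({\<sigma>} \<times> U \<sigma>))"
    unfolding sampler_space_def using U finS
    by (simp only:) (intro P.finite_measure_finite_Union, auto simp: disjoint_family_on_def)
  also have "\<dots> = (\<Sum>\<sigma>\<in>?S. measure ?M (U \<sigma>) / fact n)"
  proof (rule sum.cong[OF refl])
    fix \<sigma> assume \<sigma>: "\<sigma> \<in> ?S"
    have "measure (?C \<Otimes>\<^sub>M ?M) ({\<sigma>} \<times> U \<sigma>) = measure ?C {\<sigma>} * measure ?M (U \<sigma>)"
      using \<sigma> sets[of \<sigma>]
      by (simp add: measure_def M.emeasure_pair_measure_Times sets_uniform_count_measure enn2real_mult U_def)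
    also have "measure ?C {\<sigma>} = 1 / fact n"
      using \<sigma> finS by (subst measure_uniform_count_measure) (auto simp: cardS)
    finally show "measure (?C \<Otimes>\<^sub>M ?M) ({\<sigma>} \<times> U \<sigma>) = measure ?M (U \<sigma>) / fact n"
      by simp
  qed
  also have "\<dots> \<ge> (\<Sum>\<sigma>\<in>?S. (1 - (\<Sum>a\<in>I. if bad \<sigma> a then 1 else \<beta>)) / fact n)"
    using prob by (intro sum_mono divide_right_mono) (auto simp: U_def)
  also have "(\<Sum>\<sigma>\<in>?S. (1 - (\<Sum>a\<in>I. if bad \<sigma> a then 1 else \<beta>)) / fact n)
      = 1 - (\<Sum>a\<in>I. \<Sum>\<sigma>\<in>?S. if bad \<sigma> a then 1 else \<beta>) / fact n"
    by (subst sum.swap) (simp add: sum_subtractf cardS diff_divide_distrib flip: sum_divide_distrib)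
  also have "\<dots> \<ge> 1 - (\<Sum>a\<in>I. fact n * (\<gamma> + \<beta>)) / fact n"
  proof (intro diff_left_mono divide_right_mono sum_mono)
    fix a assume a: "a \<in> I"
    have "(\<Sum>\<sigma>\<in>?S. if bad \<sigma> a then 1 else \<beta>) \<le> (\<Sum>\<sigma>\<in>?S. (if bad \<sigma> a then 1 else 0) + \<beta>)"
      using \<beta> by (intro sum_mono) auto
    also have "\<dots> = real (card {\<sigma>. \<sigma> permutes {..<n} \<and> bad \<sigma> a}) + fact n * \<beta>"
      using finS by (simp add: sum.distrib cardS sum.If_cases Int_def)
    also have "\<dots> \<le> fact n * (\<gamma> + \<beta>)"
      using bad[OF a] by (simp add: distrib_left)
    finally show "(\<Sum>\<sigma>\<in>?S. if bad \<sigma> a then 1 else \<beta>) \<le> fact n * (\<gamma> + \<beta>)" .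
  qed simp
  also have "1 - (\<Sum>a\<in>I. fact n * (\<gamma> + \<beta>)) / fact n = 1 - real (card I) * (\<gamma> + \<beta>)"
    by simp
  finally show ?thesis .
qed

lemma card_mod_class:
  assumes "b < (L::nat)"
  shows "card {k. k < L * M \<and> k mod L = b} = M"
proof -
  have "{k. k < L * M \<and> k mod L = b} = (\<lambda>x. L * x + b) ` {..<M}"
  proof (intro equalityI subsetI)
    fix k assume "k \<in> {k. k < L * M \<and> k mod L = b}"
    then have "k = L * (k div L) + b" "k div L < M"
      using assms by (auto simp: less_mult_imp_div_less mult.commute mod_mult_div_eq[symmetric])
    then show "k \<in> (\<lambda>x. L * x + b) ` {..<M}"
      by blast
  next
    fix k assume "k \<in> (\<lambda>x. L * x + b) ` {..<M}"
    then obtain x where x: "k = L * x + b" "x < M"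
      by auto
    have "L * x + b < L * Suc x"
      using assms by simp
    also have "\<dots> \<le> L * M"
      using x(2) by (intro mult_le_mono2) simp
    finally show "k \<in> {k. k < L * M \<and> k mod L = b}"
      using x assms by simp
  qed
  moreover have "inj_on (\<lambda>x. L * x + b) {..<M}"
    using assms by (intro inj_onI) auto
  ultimately show ?thesis
    by (simp add: card_image)
qed

text \<open>The first L^3 coordinates are the revealers, split by residue mod L into L classes of
  size L^2; a tester is joined to the class of its own residue. There are thus only L distinct
  neighbourhoods to be met by a window. The lower bound on n makes revealers at most 1/64 of all
  coordinates.\<close>

locale grouped =
  fixes n L d :: nat
  assumes L_pos: "L > 0" and n_lower: "64 * L ^ 3 \<le> n" and n_upper: "n \<le> 512 * L ^ 3"
begin

definition group :: "nat \<Rightarrow> nat set" where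
  "group c = {k. k < L ^ 3 \<and> k mod L = c mod L}"

lemma card_group: "card (group c) = L ^ 2"
  using card_mod_class[of "c mod L" L "L ^ 2"] L_pos by (simp add: group_def power3_eq_cube power2_eq_square mult.assoc)

lemma group_subset: "group c \<subseteq> {..<L ^ 3}"
  by (auto simp: group_def)

lemma L3_le: "L ^ 3 \<le> n"
  using n_lower by simp

lemma model: "planted_model n (2 * 2 ^ d) (L ^ 3) (L ^ 2) (513 * L ^ 2) (1 / (128 * real L))
    (signed_sylvester d) group"
proof
  show "card {c \<in> {L ^ 3..<n}. k \<in> group c} \<le> 513 * L ^ 2" for k
  proof -
    have "{c \<in> {L ^ 3..<n}. k \<in> group c} \<subseteq> {c. c < L * (n div L + 1) \<and> c mod L = k mod L}"
    proof
      fix c assume "c \<in> {c \<in> {L ^ 3..<n}. k \<in> group c}"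
      moreover have "n < L * (n div L + 1)"
        using L_pos dividend_less_times_div[of L n] by simp
      ultimately show "c \<in> {c. c < L * (n div L + 1) \<and> c mod L = k mod L}"
        by (auto simp: group_def)
    qed
    then have "card {c \<in> {L ^ 3..<n}. k \<in> group c} \<le> card {c. c < L * (n div L + 1) \<and> c mod L = k mod L}"
      by (intro card_mono) auto
    also have "\<dots> = n div L + 1"
      using L_pos by (intro card_mod_class) simp
    also have "n div L \<le> (512 * L ^ 2 * L) div L"
      using n_upper by (intro div_le_mono) (simp add: power3_eq_cube power2_eq_square)
    also have "512 * L ^ 2 * L div L + 1 \<le> 513 * L ^ 2"
      using L_pos by simp
    finally show ?thesis by simp
  qed
  \<comment> \<open>The last condition amounts to 25 * 513 = 12825 <= 128^2 = 16384; this is the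
    origin of 128 in \<epsilon>.\<close>
  show "1 / (128 * real L) \<le> 1 / 10" "4 * real (L ^ 2) * (1 / (128 * real L))\<^sup>2 \<le> 1"
    "25 * (1 / (128 * real L))\<^sup>2 * real (513 * L ^ 2) \<le> 1"
    using L_pos by (auto simp: field_simps power2_eq_square)
  show "(\<Sum>v<2 * 2 ^ d. signed_sylvester d y v) = 0" "(\<Sum>v<2 * 2 ^ d. signed_sylvester d v y) = 0" for y
    by (rule signed_sylvester_row, rule signed_sylvester_col)
  show "(\<Sum>y<2 * 2 ^ d. (\<Sum>v<2 * 2 ^ d. F v * signed_sylvester d y v)\<^sup>2)
      \<le> 2 * real (2 * 2 ^ d) * (\<Sum>v<2 * 2 ^ d. (F v)\<^sup>2)" for F
    by (rule signed_sylvester_bessel)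
qed (use L_pos L3_le group_subset in \<open>auto simp: card_group abs_signed_sylvester\<close>)

sublocale planted_model n "2 * 2 ^ d" "L ^ 3" "L ^ 2" "513 * L ^ 2" "1 / (128 * real L)"
  "signed_sylvester d" group
  by (rule model)

text \<open>A window has 3 w positions: in the first w every class must show a revealer, and of the
  following 2 w at least w must be testers. The first part thus provides an earlier neighbour for
  every tester of the second.\<close>

definition bad_order :: "nat \<Rightarrow> (nat \<Rightarrow> nat) \<Rightarrow> nat \<Rightarrow> bool" where
  "bad_order w \<sigma> a \<longleftrightarrow> (\<exists>b<L. \<forall>j\<in>{a..<a + w}. \<not> (\<sigma> j < L ^ 3 \<and> \<sigma> j mod L = b)) \<or>
     card {i \<in> {a + w..<a + 3 * w}. L ^ 3 \<le> \<sigma> i} < w"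

text \<open>Missing a class sends w given positions into a set of density 1 - L^2 / n. A shortage of
  testers leaves w revealers among the last 2 w positions: at most 4^w choices of positions, each of
  probability at most (1 / 64)^w.\<close>

lemma card_bad_order:
  assumes aw: "a + 3 * w \<le> n"
  shows "real (card {\<sigma>. \<sigma> permutes {..<n} \<and> bad_order w \<sigma> a})
    \<le> fact n * (real L * (1 - real (L ^ 2) / real n) ^ w + (1 / 16) ^ w)"
proof -
  have n: "n > 0"
    using n_lower L_pos by (metis gr0I le_zero_eq mult_is_0 power_not_zero zero_neq_numeral)
  define A where "A = (\<lambda>b. {..<n} - {k. k < L ^ 3 \<and> k mod L = b})"
  define V where "V = (\<lambda>P A. {\<sigma>. \<sigma> permutes {..<n} \<and> (\<forall>i\<in>P. \<sigma> i \<in> A)})"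
  define Q where "Q = {P. P \<subseteq> {a + w..<a + 3 * w} \<and> card P = w}"
  have finV: "finite (V P A')" for P A'
    unfolding V_def by (rule finite_subset[OF _ finite_permutations[of "{..<n}"]]) auto
  have finQ: "finite Q"
    unfolding Q_def by (rule finite_subset[of _ "Pow {a + w..<a + 3 * w}"]) auto
  have cardQ: "card Q \<le> 4 ^ w"
  proof -
    have "card Q \<le> card (Pow {a + w..<a + 3 * w})"
      unfolding Q_def by (intro card_mono) auto
    also have "\<dots> = 2 ^ (2 * w)"
      by (simp add: card_Pow)
    finally show ?thesis
      by (simp add: power_mult)
  qed
  have "{\<sigma>. \<sigma> permutes {..<n} \<and> bad_order w \<sigma> a}
      \<subseteq> (\<Union>b<L. V {a..<a + w} (A b)) \<union> (\<Union>P\<in>Q. V P {..<L ^ 3})"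
  proof
    fix \<sigma> assume "\<sigma> \<in> {\<sigma>. \<sigma> permutes {..<n} \<and> bad_order w \<sigma> a}"
    then have \<sigma>: "\<sigma> permutes {..<n}" and bo: "bad_order w \<sigma> a"
      by auto
    from bo[unfolded bad_order_def] show "\<sigma> \<in> (\<Union>b<L. V {a..<a + w} (A b)) \<union> (\<Union>P\<in>Q. V P {..<L ^ 3})"
    proof
      assume "\<exists>b<L. \<forall>j\<in>{a..<a + w}. \<not> (\<sigma> j < L ^ 3 \<and> \<sigma> j mod L = b)"
      then obtain b where b: "b < L" "\<forall>j\<in>{a..<a + w}. \<not> (\<sigma> j < L ^ 3 \<and> \<sigma> j mod L = b)"
        by blast
      have "\<sigma> j < n" if "j \<in> {a..<a + w}" for j
        using that aw permutes_in_image[OF \<sigma>, of j] by simp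
      then have "\<sigma> \<in> V {a..<a + w} (A b)"
        using \<sigma> b(2) by (auto simp: V_def A_def)
      then show ?thesis
        using b(1) by blast
    next
      let ?W = "{i \<in> {a + w..<a + 3 * w}. L ^ 3 \<le> \<sigma> i}" and ?W' = "{i \<in> {a + w..<a + 3 * w}. \<sigma> i < L ^ 3}"
      assume "card ?W < w"
      moreover have "card ?W + card ?W' = card {a + w..<a + 3 * w}"
      proof -
        have "card (?W \<union> ?W') = card ?W + card ?W'"
          by (rule card_Un_disjoint) auto
        also have "?W \<union> ?W' = {a + w..<a + 3 * w}"
          by auto
        finally show ?thesis ..
      qed
      ultimately have "w \<le> card ?W'"
        by simp
      then obtain P where "P \<subseteq> ?W'" "card P = w"
        by (rule obtain_subset_with_card_n)
      then have "P \<in> Q" "\<sigma> \<in> V P {..<L ^ 3}"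
        using \<sigma> by (auto simp: Q_def V_def)
      then show ?thesis
        by blast
    qed
  qed
  then have "card {\<sigma>. \<sigma> permutes {..<n} \<and> bad_order w \<sigma> a}
      \<le> card ((\<Union>b<L. V {a..<a + w} (A b)) \<union> (\<Union>P\<in>Q. V P {..<L ^ 3}))"
    using finV finQ by (intro card_mono) auto
  also have "\<dots> \<le> card (\<Union>b<L. V {a..<a + w} (A b)) + card (\<Union>P\<in>Q. V P {..<L ^ 3})"
    by (rule card_Un_le)
  also have "\<dots> \<le> (\<Sum>b<L. card (V {a..<a + w} (A b))) + (\<Sum>P\<in>Q. card (V P {..<L ^ 3}))"
    using finQ by (intro add_mono card_UN_le) auto
  finally have "real (card {\<sigma>. \<sigma> permutes {..<n} \<and> bad_order w \<sigma> a})
      \<le> (\<Sum>b<L. real (card (V {a..<a + w} (A b)))) + (\<Sum>P\<in>Q. real (card (V P {..<L ^ 3})))"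
    by (simp flip: of_nat_sum of_nat_add)
  also have "\<dots> \<le> (\<Sum>b<L. fact n * (1 - real (L ^ 2) / real n) ^ w) + (\<Sum>P\<in>Q. fact n * (1 / 64) ^ w)"
  proof (intro add_mono sum_mono)
    fix b assume "b \<in> {..<L}"
    then have b: "b < L" by simp
    have sub: "{a..<a + w} \<subseteq> {..<n}"
      using aw by auto
    have "card {k. k < L ^ 3 \<and> k mod L = b} = L ^ 2"
      using card_mod_class[OF b, of "L ^ 2"] by (simp add: power3_eq_cube power2_eq_square mult.assoc)
    then have cA: "card (A b) = n - L ^ 2"
      unfolding A_def using L3_le by (subst card_Diff_subset) auto
    have "L ^ 2 \<le> L ^ 3"
      using L_pos by (intro power_increasing) auto
    then have "real (card (A b)) / real n = 1 - real (L ^ 2) / real n"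
      using n L3_le by (simp add: cA of_nat_diff diff_divide_distrib)
    then show "real (card (V {a..<a + w} (A b))) \<le> fact n * (1 - real (L ^ 2) / real n) ^ w"
      using card_permutes_into_le[of "{a..<a + w}" n "A b"] sub n by (simp add: V_def A_def)
  next
    fix P assume "P \<in> Q"
    then have P: "P \<subseteq> {..<n}" "card P = w"
      using aw by (auto simp: Q_def)
    have "real (card (V P {..<L ^ 3})) \<le> fact n * (real (L ^ 3) / real n) ^ w"
      using card_permutes_into_le[of P n "{..<L ^ 3}"] P n L3_le by (auto simp: V_def)
    also have "\<dots> \<le> fact n * (1 / 64) ^ w"
    proof (intro mult_left_mono power_mono)
      have "64 * real (L ^ 3) \<le> real n"
        using n_lower by (metis of_nat_le_iff of_nat_mult of_nat_numeral)
      then show "real (L ^ 3) / real n \<le> 1 / 64"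
        using n by (simp add: field_simps)
    qed auto
    finally show "real (card (V P {..<L ^ 3})) \<le> fact n * (1 / 64) ^ w" .
  qed
  also have "\<dots> = fact n * (real L * (1 - real (L ^ 2) / real n) ^ w + real (card Q) * (1 / 64) ^ w)"
    by (simp add: algebra_simps)
  also have "\<dots> \<le> fact n * (real L * (1 - real (L ^ 2) / real n) ^ w + 4 ^ w * (1 / 64) ^ w)"
  proof (intro mult_left_mono add_left_mono mult_right_mono)
    have "real (card Q) \<le> real (4 ^ w)"
      using cardQ by (rule of_nat_mono)
    then show "real (card Q) \<le> 4 ^ w"
      by simp
  qed auto
  also have "(4::real) ^ w * (1 / 64) ^ w = (1 / 16) ^ w"
    by (simp flip: power_mult_distrib)
  finally show ?thesis .
qed

text \<open>Too few rounds means that some start a <= H has no mismatch in its window, and the union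
  runs over these H + 1 starts. With \<epsilon> = 1 / (128 L), \<open>sum_coupled_le\<close> gives
  48 * 128 = 6144 and \<epsilon> / 8 = 1 / (1024 L).\<close>

lemma measure_rounds_ge:
  assumes dist: "is_dist_on (2 * 2 ^ d) dflt" and H: "H < n" "H + 3 * w \<le> n" "K * real (3 * w) \<le> real H"
  shows "1 - real (Suc H) * (real L * (1 - real (L ^ 2) / real n) ^ w + (1 / 16) ^ w
      + (real (2 * w) * (6144 * real L / sqrt (2 * 2 ^ d)) + (1 - 1 / (1024 * real L)) ^ w))
    \<le> measure (sampler_space n (2 * 2 ^ d)) {\<omega> \<in> space (sampler_space n (2 * 2 ^ d)).
        sampler_rounds_at_least planted dflt n (fst \<omega>) (snd \<omega>) K}"
proof -
  define \<beta> where "\<beta> = real (2 * w) * (6144 * real L / sqrt (2 * 2 ^ d)) + (1 - 1 / (1024 * real L)) ^ w"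
  define \<gamma> where "\<gamma> = real L * (1 - real (L ^ 2) / real n) ^ w + (1 / 16) ^ w"
  let ?M = "PiM {..<n} (\<lambda>_. seed_space (2 * 2 ^ d))"
  have r: "0 \<le> 1 - 1 / (1024 * real L)" "1 - 1 / (1024 * real L) \<le> 1"
    using L_pos by (auto simp: field_simps)
  have \<beta>: "0 \<le> \<beta>"
    unfolding \<beta>_def using r by (intro add_nonneg_nonneg mult_nonneg_nonneg) auto
  have "1 - real (card {..H}) * (\<gamma> + \<beta>) \<le> measure (sampler_space n (2 * 2 ^ d))
      {\<omega> \<in> space (sampler_space n (2 * 2 ^ d)). sampler_rounds_at_least planted dflt n (fst \<omega>) (snd \<omega>) K}"
  proof (rule measure_sampler_space_ge[where bad = "bad_order w"])
    fix \<sigma> assume \<sigma>: "\<sigma> permutes {..<n}"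
    interpret planted_sampler n "2 * 2 ^ d" "L ^ 3" "L ^ 2" "513 * L ^ 2" "1 / (128 * real L)"
      "signed_sylvester d" group dflt \<sigma>
      by unfold_locales (rule dist, rule \<sigma>)
    interpret M: prob_space ?M
      by (intro prob_space_PiM prob_space_seed) simp
    let ?G = "{u \<in> space ?M. sampler_rounds_at_least planted dflt n \<sigma> u K}"
    show G: "?G \<in> sets ?M"
      by (rule measurable_rounds)
    define N where "N = (\<lambda>a. {u \<in> space ?M. \<forall>i\<in>{a..<a + 3 * w}. \<not> mism u a i})"
    have N: "N a \<in> sets ?M" if "a \<le> H" for a
    proof -
      have "Measurable.pred ?M (\<lambda>u. mism u a i)" if "i \<in> {a..<a + 3 * w}" for i
        using that \<open>a \<le> H\<close> H by (intro measurable_mism) auto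
      then show ?thesis
        unfolding N_def by measurable
    qed
    have Nle: "measure ?M (N a) \<le> (if bad_order w \<sigma> a then 1 else \<beta>)" if a: "a \<le> H" for a
    proof (cases "bad_order w \<sigma> a")
      case False
      define W where "W = {i \<in> {a + w..<a + 3 * w}. L ^ 3 \<le> \<sigma> i}"
      have W: "W \<subseteq> {..<n}" "w \<le> card W"
        using False a H by (auto simp: W_def bad_order_def)
      have "card W \<le> card {a + w..<a + 3 * w}"
        unfolding W_def by (intro card_mono) auto
      then have W2: "card W \<le> 2 * w"
        by simp
      have "measure ?M (N a) \<le> measure ?M {u \<in> space ?M. \<forall>i\<in>W. \<not> mism u a i}"
      proof (rule M.finite_measure_mono)
        have "Measurable.pred ?M (\<lambda>u. mism u a i)" if "i \<in> W" for i
          using that W by (intro measurable_mism) auto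
        moreover have "finite W"
          using W finite_subset by blast
        ultimately show "{u \<in> space ?M. \<forall>i\<in>W. \<not> mism u a i} \<in> M.events"
          by measurable
      qed (auto simp: N_def W_def)
      also have "\<dots> \<le> (\<Sum>f\<in>cfg n (2 * 2 ^ d). \<Prod>i<n. coupled a W i f)"
        by (rule measure_no_mism_le[OF W(1)])
      also have "\<dots> \<le> real (card W) * (48 / (1 / (128 * real L) * sqrt (real (2 * 2 ^ d))))
          + (1 - 1 / (128 * real L) / 8) ^ card W"
      proof (rule sum_coupled_le[OF W(1)])
        fix i assume i: "i \<in> W"
        then show "L ^ 3 \<le> \<sigma> i"
          by (simp add: W_def)
        have "\<sigma> i mod L < L"
          using L_pos by simp
        then obtain j where "j \<in> {a..<a + w}" "\<sigma> j < L ^ 3" "\<sigma> j mod L = \<sigma> i mod L"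
          using False by (auto simp: bad_order_def)
        then show "\<exists>j. a \<le> j \<and> j < i \<and> \<sigma> j \<in> group (\<sigma> i)"
          using i by (auto simp: W_def group_def)
      qed
      also have "\<dots> \<le> \<beta>"
      proof -
        have "(1 - 1 / (1024 * real L)) ^ card W \<le> (1 - 1 / (1024 * real L)) ^ w"
          using W(2) r by (intro power_decreasing) auto
        moreover have "real (card W) * (6144 * real L / sqrt (2 * 2 ^ d)) \<le> real (2 * w) * (6144 * real L / sqrt (2 * 2 ^ d))"
          using W2 by (intro mult_right_mono) auto
        ultimately show ?thesis
          unfolding \<beta>_def by (simp add: mult_ac)
      qed
      finally show ?thesis
        using False by simp
    qed (simp add: M.prob_le_1)
    have "space ?M - ?G \<subseteq> (\<Union>a\<le>H. N a)"
    proof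
      fix u assume u: "u \<in> space ?M - ?G"
      have "\<exists>a\<le>H. \<not> (\<exists>i<a + 3 * w. i < n \<and> mism u a i)"
      proof (rule ccontr)
        assume "\<not> (\<exists>a\<le>H. \<not> (\<exists>i<a + 3 * w. i < n \<and> mism u a i))"
        then have "sampler_rounds_at_least planted dflt n \<sigma> u K"
          by (intro rounds_at_leastI[where H = H and m = "3 * w"] H) blast
        then show False
          using u by simp
      qed
      then obtain a where a: "a \<le> H" "\<And>i. i < a + 3 * w \<Longrightarrow> i < n \<Longrightarrow> \<not> mism u a i"
        by blast
      have "u \<in> N a"
        unfolding N_def using u a H by simp
      then show "u \<in> (\<Union>a\<le>H. N a)"
        using a(1) by blast
    qed
    then have "measure ?M (space ?M - ?G) \<le> measure ?M (\<Union>a\<le>H. N a)"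
      using N by (intro M.finite_measure_mono sets.finite_UN) auto
    also have "\<dots> \<le> (\<Sum>a\<le>H. measure ?M (N a))"
      using N by (intro M.finite_measure_subadditive_finite) auto
    also have "\<dots> \<le> (\<Sum>a\<le>H. if bad_order w \<sigma> a then 1 else \<beta>)"
      by (intro sum_mono Nle) simp
    finally show "1 - (\<Sum>a\<le>H. if bad_order w \<sigma> a then 1 else \<beta>) \<le> measure ?M ?G"
      using M.prob_compl[OF G] by simp
  next
    fix a assume "a \<in> {..H}"
    then show "real (card {\<sigma>. \<sigma> permutes {..<n} \<and> bad_order w \<sigma> a}) \<le> fact n * \<gamma>"
      unfolding \<gamma>_def using H by (intro card_bad_order) auto
  qed (use \<beta> in auto)
  then show ?thesis
    by (simp add: \<beta>_def \<gamma>_def)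
qed

end

section \<open>Asymptotics\<close>

lemma one_minus_power_le:
  fixes x :: real
  assumes "0 \<le> x" "x \<le> 1" "real k * ln (real n) \<le> x * real w" "n > 0"
  shows "(1 - x) ^ w \<le> 1 / real n ^ k"
proof -
  have "(1 - x) ^ w \<le> exp (- x) ^ w"
    using assms(1,2) exp_ge_add_one_self[of "- x"] by (intro power_mono) auto
  also have "\<dots> = exp (- (x * real w))"
    by (simp add: mult.commute flip: exp_of_nat_mult)
  also have "\<dots> \<le> exp (- (real k * ln (real n)))"
    using assms(3) by simp
  also have "\<dots> = 1 / real n ^ k"
    using assms(4) by (simp add: exp_minus exp_of_nat_mult inverse_eq_divide)
  finally show ?thesis .
qed

text \<open>The third condition makes a window fit behind position n / 2, the fourth bounds the
  total failure probability, whose main term is of order n^(-1/3) log n. The constant is 3146496 = 2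
  * 4097 / 4 * 6144 / 4.\<close>

lemma eventually_large:
  "eventually (\<lambda>n. 64 \<le> real n \<and> 1 \<le> ln (real n) \<and>
     3 * (4097 * (real n powr (1 / 3) / 4) * ln (real n)) \<le> real n / 2 \<and>
     real n * (3 / real n ^ 4 + 3146496 * (real n powr (1 / 3))\<^sup>2 * ln (real n) / real n ^ 2) \<le> 1 / 100) sequentially"
  by (intro eventually_conj; real_asymp)

theorem theorem6p1:
  shows "\<exists>c>0. \<exists>N. \<forall>n\<ge>N. \<exists>(q::nat) (\<mu>::nat list pmf).
    q \<le> n ^ 5 \<and> set_pmf \<mu> \<subseteq> cube q n \<and>
    (\<forall>dflt. is_dist_on q dflt \<longrightarrow>
       measure (sampler_space n q)
         {\<omega> \<in> space (sampler_space n q).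
            sampler_rounds_at_least \<mu> dflt n (fst \<omega>) (snd \<omega>)
              (c * real n powr (2/3) / ln (real n))} \<ge> 0.99)"
proof -
  obtain N where N: "\<And>n. n \<ge> N \<Longrightarrow> 64 \<le> real n \<and> 1 \<le> ln (real n) \<and>
     3 * (4097 * (real n powr (1 / 3) / 4) * ln (real n)) \<le> real n / 2 \<and>
     real n * (3 / real n ^ 4 + 3146496 * (real n powr (1 / 3))\<^sup>2 * ln (real n) / real n ^ 2) \<le> 1 / 100"
    using eventually_large unfolding eventually_sequentially by blast
  show ?thesis
  proof (rule exI[of _ "1 / 10000"], rule conjI, simp, rule exI[of _ N], intro allI impI)
    fix n assume "n \<ge> N"
    from N[OF this] have n64: "64 \<le> real n" and ln1: "1 \<le> ln (real n)"
      and win: "3 * (4097 * (real n powr (1 / 3) / 4) * ln (real n)) \<le> real n / 2"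
      and err: "real n * (3 / real n ^ 4 + 3146496 * (real n powr (1 / 3))\<^sup>2 * ln (real n) / real n ^ 2) \<le> 1 / 100"
      by auto
    define r where "r = real n powr (1 / 3)"
    \<comment> \<open>Rounding down gives 64 L^3 <= n; since L >= 1, also r / 4 < 2 L, which gives n
      <= 512 L^3.\<close>
    define L where "L = nat \<lfloor>r / 4\<rfloor>"
    \<comment> \<open>4096 = 4 * 1024 brings (1 - 1 / (1024 L))^w below n^(-4). It also suffices for
      the classes, each hit by a position with probability L^2 / n >= 1 / (512 L).\<close>
    define w where "w = nat \<lceil>4096 * real L * ln (real n)\<rceil>"
    define H where "H = n div 2"
    \<comment> \<open>With 1 / 10000, K windows of 3 w positions cover at most 12291 / 40000 of the
      n positions, less than half.\<close>
    define K where "K = 1 / 10000 * real n powr (2 / 3) / ln (real n)"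
    have n0: "n > 0" "real n > 0"
      using n64 by auto
    have r3: "r ^ 3 = real n" and r2: "r ^ 2 = real n powr (2 / 3)"
      unfolding r_def using n0 by (simp_all add: powr_powr flip: powr_numeral)
    have r4: "4 \<le> r"
    proof (rule power_le_imp_le_base[where n = 2])
      show "4 ^ Suc 2 \<le> r ^ Suc 2"
        using n64 r3 by (simp add: power3_eq_cube)
    qed (simp add: r_def)
    have L: "real L \<le> r / 4" "r / 4 < real L + 1" "1 \<le> L"
    proof -
      have "1 \<le> \<lfloor>r / 4\<rfloor>"
        using r4 by (simp add: le_floor_iff)
      then show "real L \<le> r / 4" "r / 4 < real L + 1" "1 \<le> L"
        unfolding L_def using floor_correct[of "r / 4"] by linarith+
    qed
    have wl: "4096 * real L * ln (real n) \<le> real w"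
      unfolding w_def by (rule real_nat_ceiling_ge)
    have wu: "real w \<le> 4097 * real L * ln (real n)"
    proof -
      have "1 * 1 \<le> real L * ln (real n)"
        using L(3) ln1 by (intro mult_mono) auto
      moreover have "real w \<le> 4096 * real L * ln (real n) + 1"
      proof -
        define x where "x = 4096 * real L * ln (real n)"
        have "0 \<le> x"
          unfolding x_def using ln1 by simp
        then show ?thesis
          unfolding w_def x_def[symmetric] using ceiling_correct[of x] by linarith
      qed
      ultimately show ?thesis
        by linarith
    qed
    have lower: "64 * real L ^ 3 \<le> real n"
    proof -
      have "real L ^ 3 \<le> (r / 4) ^ 3"
        using L by (intro power_mono) auto
      then show ?thesis
        by (simp add: power_divide r3)
    qed
    have upper: "real n \<le> 512 * real L ^ 3"
    proof -
      have "r / 4 \<le> 2 * real L"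
        using L by linarith
      then have "(r / 4) ^ 3 \<le> (2 * real L) ^ 3"
        using r4 by (intro power_mono) auto
      then show ?thesis
        by (simp add: power_divide power_mult_distrib r3)
    qed
    have nat_bounds: "64 * L ^ 3 \<le> n" "n \<le> 512 * L ^ 3"
      using lower upper by (simp_all flip: of_nat_le_iff[where 'a = real])
    \<comment> \<open>The matrix order must be a power of two: q = 2^(d + 1) satisfies n^4 < q <= 2
      n^4, so sqrt q exceeds n^2 while q <= n^5.\<close>
    obtain d where d: "2 ^ d \<le> n ^ 4" "n ^ 4 < 2 ^ (d + 1)"
      using ex_power_ivl1[of 2 "n ^ 4"] n0 by auto
    define q :: nat where "q = 2 * 2 ^ d"
    have qn: "q \<le> n ^ 5"
    proof -
      have "q \<le> 2 * n ^ 4"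
        unfolding q_def using d(1) by simp
      also have "\<dots> \<le> n * n ^ 4"
        using n64 by (intro mult_le_mono1) simp
      finally show ?thesis
        by (simp add: numeral_eq_Suc)
    qed
    have sqrt_q: "real n ^ 2 \<le> sqrt (2 * 2 ^ d)"
    proof (rule real_le_rsqrt)
      have "real (n ^ 4) \<le> real (2 ^ (d + 1))"
        using d(2) by (intro of_nat_mono) simp
      then show "(real n ^ 2)\<^sup>2 \<le> 2 * 2 ^ d"
        by (simp flip: power_mult)
    qed
    interpret grouped n L d
      by unfold_locales (use L(3) nat_bounds in auto)
    show "\<exists>q \<mu>. q \<le> n ^ 5 \<and> set_pmf \<mu> \<subseteq> cube q n \<and>
      (\<forall>dflt. is_dist_on q dflt \<longrightarrow> measure (sampler_space n q)
         {\<omega> \<in> space (sampler_space n q). sampler_rounds_at_least \<mu> dflt n (fst \<omega>) (snd \<omega>)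
              (1 / 10000 * real n powr (2/3) / ln (real n))} \<ge> 0.99)"
    proof (intro exI[of _ q] exI[of _ planted] conjI allI impI)
      show "q \<le> n ^ 5"
        by (rule qn)
      show "set_pmf planted \<subseteq> cube q n"
        unfolding q_def by (rule set_planted)
      fix dflt assume dist: "is_dist_on q dflt"
      have wr: "real w \<le> 4097 * (r / 4) * ln (real n)"
        using wu L(1) ln1 by (intro order_trans[OF wu] mult_right_mono mult_left_mono) auto
      have H: "H < n" "H + 3 * w \<le> n" "K * real (3 * w) \<le> real H"
      proof -
        show "H < n"
          unfolding H_def using n0 by simp
        have "real H \<le> real n / 2"
          unfolding H_def by linarith
        moreover have "3 * real w \<le> real n / 2"
          using wr win unfolding r_def by linarith
        ultimately have "real (H + 3 * w) \<le> real n"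
          by simp
        then show "H + 3 * w \<le> n"
          by (simp only: of_nat_le_iff)
        have "K * real (3 * w) \<le> K * (3 * (4097 * (r / 4) * ln (real n)))"
          using wr ln1 by (intro mult_left_mono) (auto simp: K_def)
        also have "\<dots> = 12291 / 40000 * (r ^ 2 * r)"
          unfolding K_def r2[symmetric] using ln1 by (simp add: field_simps)
        also have "r ^ 2 * r = real n"
          unfolding r3[symmetric] by (simp add: power3_eq_cube power2_eq_square)
        also have "12291 / 40000 * real n \<le> real H"
          unfolding H_def using n64 by linarith
        finally show "K * real (3 * w) \<le> real H" .
      qed
      have t1: "real L * (1 - real (L ^ 2) / real n) ^ w \<le> 1 / real n ^ 4"
      proof -
        have "L ^ 2 \<le> n"
          using power_increasing[of 2 3 L] L(3) L3_le by linarith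
        \<comment> \<open>The fifth power pays for the union over the L <= n classes.\<close>
        have "(1 - real (L ^ 2) / real n) ^ w \<le> 1 / real n ^ 5"
        proof (rule one_minus_power_le)
          show "real (L ^ 2) / real n \<le> 1"
            using \<open>L ^ 2 \<le> n\<close> n0 by (simp add: divide_le_eq flip: of_nat_power)
          have "5 * ln (real n) \<le> 8 * ln (real n)"
            using ln1 by simp
          also have "\<dots> = 1 / (512 * real L) * (4096 * real L * ln (real n))"
            using L(3) by simp
          also have "\<dots> \<le> real (L ^ 2) / real n * real w"
          proof (rule mult_mono)
            show "1 / (512 * real L) \<le> real (L ^ 2) / real n"
              using upper n0 L(3) by (simp add: field_simps power2_eq_square power3_eq_cube)
          qed (use wl ln1 in auto)
          finally show "real 5 * ln (real n) \<le> real (L ^ 2) / real n * real w"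
            by simp
        qed (use n0 in auto)
        then have "real L * (1 - real (L ^ 2) / real n) ^ w \<le> real n * (1 / real n ^ 5)"
          using \<open>L ^ 2 \<le> n\<close> power_increasing[of 1 2 L] L(3) \<open>L ^ 2 \<le> n\<close> n0
          by (intro mult_mono) (auto intro!: zero_le_power simp: divide_le_eq simp flip: of_nat_power)
        also have "\<dots> = 1 / real n ^ 4"
          using n0 by (simp add: numeral_eq_Suc)
        finally show ?thesis .
      qed
      have L1: "1 \<le> real L"
        using L(3) by simp
      have t2: "(1 / 16) ^ w \<le> 1 / real n ^ 4"
      proof -
        have "(1 - 15 / 16 :: real) ^ w \<le> 1 / real n ^ 4"
        proof (rule one_minus_power_le)
          have "4096 * 1 * ln (real n) \<le> 4096 * real L * ln (real n)"
            using L1 ln1 by (intro mult_right_mono) auto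
          then show "real 4 * ln (real n) \<le> 15 / 16 * real w"
            using wl ln1 by linarith
        qed (use n0 in auto)
        then show ?thesis by simp
      qed
      have t4: "(1 - 1 / (1024 * real L)) ^ w \<le> 1 / real n ^ 4"
      proof (rule one_minus_power_le)
        show "real 4 * ln (real n) \<le> 1 / (1024 * real L) * real w"
          using wl L1 by (simp add: field_simps)
      qed (use n0 L1 in auto)
      have t3: "real (2 * w) * (6144 * real L / sqrt (2 * 2 ^ d)) \<le> 3146496 * r\<^sup>2 * ln (real n) / real n ^ 2"
      proof -
        have "real (2 * w) * (6144 * real L / sqrt (2 * 2 ^ d))
            \<le> (2 * (4097 * (r / 4) * ln (real n))) * (6144 * (r / 4) / real n ^ 2)"
          using wr L(1) sqrt_q n0 r4 ln1 by (intro mult_mono frac_le) auto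
        also have "\<dots> = 3146496 * r\<^sup>2 * ln (real n) / real n ^ 2"
          by (simp add: power2_eq_square)
        finally show ?thesis .
      qed
      have "real (Suc H) * (real L * (1 - real (L ^ 2) / real n) ^ w + (1 / 16) ^ w
          + (real (2 * w) * (6144 * real L / sqrt (2 * 2 ^ d)) + (1 - 1 / (1024 * real L)) ^ w))
        \<le> real n * (3 / real n ^ 4 + 3146496 * r\<^sup>2 * ln (real n) / real n ^ 2)"
      proof (rule mult_mono)
        show "real L * (1 - real (L ^ 2) / real n) ^ w + (1 / 16) ^ w
          + (real (2 * w) * (6144 * real L / sqrt (2 * 2 ^ d)) + (1 - 1 / (1024 * real L)) ^ w)
          \<le> 3 / real n ^ 4 + 3146496 * r\<^sup>2 * ln (real n) / real n ^ 2"
          using t1 t2 t3 t4 by simp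
        have "real (L ^ 2) / real n \<le> 1"
          using power_increasing[of 2 3 L] L(3) L3_le n0 by (simp add: divide_le_eq flip: of_nat_power)
        then show "0 \<le> real L * (1 - real (L ^ 2) / real n) ^ w + (1 / 16) ^ w
          + (real (2 * w) * (6144 * real L / sqrt (2 * 2 ^ d)) + (1 - 1 / (1024 * real L)) ^ w)"
          using L1 by (intro add_nonneg_nonneg mult_nonneg_nonneg zero_le_power) auto
      qed (use H in auto)
      also have "\<dots> \<le> 1 / 100"
        using err by (simp add: r_def)
      finally have small: "real (Suc H) * (real L * (1 - real (L ^ 2) / real n) ^ w + (1 / 16) ^ w
          + (real (2 * w) * (6144 * real L / sqrt (2 * 2 ^ d)) + (1 - 1 / (1024 * real L)) ^ w)) \<le> 1 / 100" .
      have "(0.99 :: real) = 1 - 1 / 100"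
        by simp
      then show "0.99 \<le> measure (sampler_space n q)
         {\<omega> \<in> space (sampler_space n q). sampler_rounds_at_least planted dflt n (fst \<omega>) (snd \<omega>)
              (1 / 10000 * real n powr (2/3) / ln (real n))}"
        using measure_rounds_ge[OF dist[unfolded q_def] H] small unfolding q_def K_def by argo
    qed
  qed
qed

end
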